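(* For every integer $k\ge 2$ there exist integer matrices $E_k$ (of size $d\times n$ for some $d,n$, with $\ker E_k\cap\mathbb{R}^n_{\ge 0}=\{0\}$) and $B_k$ (of size $d\times 2k$) such that for every dominant weight $\lambda$ of $\mathfrak{sl}_k\mathbb{C}$ and every weight $\beta\in\Lambda_W$ with $\lambda-\beta\in\Lambda_R$, the vector $B_k\binom{\lambda}{\beta}$ is integral and $$m_\lambda(\beta)=\phi_{E_k}\!\left(B_k\binom{\lambda}{\beta}\right),$$ where $\binom{\lambda}{\beta}\in\mathbb{R}^{2k}$ is the column vector $(\lambda_1,\dots,\lambda_k,\beta_1,\dots,\beta_k)^T$.
   Context: Identify the dual $\mathfrak{h}^*$ of the Cartan subalgebra of traceless diagonal matrices of $\mathfrak{sl}_k\mathbb{C}$ with $\{x\in\mathbb{R}^k:\sum_i x_i=0\}$. The simple roots are $\alpha_i=e_i-e_{i+1}$, $1\le i\le k-1$, and the fundamental weights are $\omega_i=\frac1k(k-i,\dots,k-i,-i,\dots,-i)$ ($i$ entries $k-i$, then $k-i$ entries $-i$). $\Lambda_R$ is the $\mathbb{Z}$-span of the $\alpha_i$ (root lattice), $\Lambda_W$ the $\mathbb{Z}$-span of the $\omega_i$ (weight lattice). A weight $\lambda\in\Lambda_W$ is dominant if $\lambda_1\ge\lambda_2\ge\cdots\ge\lambda_k$. For dominant $\lambda$, $V_\lambda$ is the irreducible representation with highest weight $\lambda$ and $m_\lambda(\beta)$ is the dimension of its $\beta$-weight space. For an integer $d\times n$ matrix $M$ with $\ker M\cap\mathbb{R}^n_{\ge0}=\{0\}$,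 the vector partition function is $\phi_M:\mathbb{Z}^d\to\mathbb{N}$, $\phi_M(b)=|\{x\in\mathbb{N}^n: Mx=b\}|$. *)

theory Defs
  imports "Jordan_Normal_Form.VS_Connect" Complex_Main
begin

(* Vectors and matrices are indexed from 0, so the i-th coordinate of the literature is v $ (i - 1). *)

definition int_span :: "nat \<Rightarrow> 'i set \<Rightarrow> ('i \<Rightarrow> real vec) \<Rightarrow> real vec set" where
  "int_span k I f =
     {vec k (\<lambda>j. \<Sum>i\<in>I. of_int (c i) * f i $ j) | c :: 'i \<Rightarrow> int. True}"

definition simple_root :: "nat \<Rightarrow> nat \<Rightarrow> real vec" where
  "simple_root k i = unit_vec k (i - 1) - unit_vec k i"

definition fund_weight :: "nat \<Rightarrow> nat \<Rightarrow> real vec" where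
  "fund_weight k i =
     (1 / real k) \<cdot>\<^sub>v vec k (\<lambda>j. if j < i then real k - real i else - real i)"

definition root_lattice :: "nat \<Rightarrow> real vec set" where
  "root_lattice k = int_span k {1..k - 1} (simple_root k)"

definition weight_lattice :: "nat \<Rightarrow> real vec set" where
  "weight_lattice k = int_span k {1..k - 1} (fund_weight k)"

definition dominant_weight :: "nat \<Rightarrow> real vec \<Rightarrow> bool" where
  "dominant_weight k l \<longleftrightarrow>
     l \<in> weight_lattice k \<and> (\<forall>i j. i \<le> j \<and> j < k \<longrightarrow> l $ j \<le> l $ i)"

definition sl :: "nat \<Rightarrow> complex mat set" where
  "sl k = {A \<in> carrier_mat k k. (\<Sum>i<k. A $$ (i, i)) = 0}"

definition cartan :: "nat \<Rightarrow> complex mat set" where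
  "cartan k = {H \<in> sl k. diagonal_mat H}"

definition elem_mat :: "nat \<Rightarrow> nat \<Rightarrow> nat \<Rightarrow> complex mat" where
  "elem_mat k i j = mat k k (\<lambda>(a, b). if a = i \<and> b = j then 1 else 0)"

(* Finite-dimensional representations are given in coordinates, on the space of column
   vectors of length N; the values of \<rho> outside sl k are irrelevant. *)
definition sl_rep :: "nat \<Rightarrow> nat \<Rightarrow> (complex mat \<Rightarrow> complex mat) \<Rightarrow> bool" where
  "sl_rep k N \<rho> \<longleftrightarrow>
     (\<forall>A\<in>sl k. \<rho> A \<in> carrier_mat N N) \<and>
     (\<forall>A\<in>sl k. \<forall>B\<in>sl k. \<rho> (A + B) = \<rho> A + \<rho> B) \<and>
     (\<forall>c. \<forall>A\<in>sl k. \<rho> (c \<cdot>\<^sub>m A) = c \<cdot>\<^sub>m \<rho> A) \<and>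
     (\<forall>A\<in>sl k. \<forall>B\<in>sl k. \<rho> (A * B - B * A) = \<rho> A * \<rho> B - \<rho> B * \<rho> A)"

definition irreducible_sl_rep :: "nat \<Rightarrow> nat \<Rightarrow> (complex mat \<Rightarrow> complex mat) \<Rightarrow> bool" where
  "irreducible_sl_rep k N \<rho> \<longleftrightarrow>
     sl_rep k N \<rho> \<and> 0 < N \<and>
     (\<forall>W. VectorSpace.subspace class_ring W (module_vec TYPE(complex) N) \<and>
          (\<forall>A\<in>sl k. \<forall>w\<in>W. \<rho> A *\<^sub>v w \<in> W) \<longrightarrow>
          W = {0\<^sub>v N} \<or> W = carrier_vec N)"

(* b stands for the functional on the Cartan subalgebra sending H to the sum of b_i H_ii. *)
definition weight_space ::
    "nat \<Rightarrow> nat \<Rightarrow> (complex mat \<Rightarrow> complex mat) \<Rightarrow> real vec \<Rightarrow> complex vec set" where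
  "weight_space k N \<rho> b =
     {v \<in> carrier_vec N. \<forall>H\<in>cartan k.
        \<rho> H *\<^sub>v v = (\<Sum>i<k. complex_of_real (b $ i) * H $$ (i, i)) \<cdot>\<^sub>v v}"

definition weight_mult ::
    "nat \<Rightarrow> nat \<Rightarrow> (complex mat \<Rightarrow> complex mat) \<Rightarrow> real vec \<Rightarrow> nat" where
  "weight_mult k N \<rho> b =
     vectorspace.dim class_ring ((module_vec TYPE(complex) N)\<lparr>carrier := weight_space k N \<rho> b\<rparr>)"

(* The positive roots are e_i - e_j with i < j, with root vectors elem_mat k i j. *)
definition has_highest_weight ::
    "nat \<Rightarrow> nat \<Rightarrow> (complex mat \<Rightarrow> complex mat) \<Rightarrow> real vec \<Rightarrow> bool" where
  "has_highest_weight k N \<rho> l \<longleftrightarrow>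
     (\<exists>v \<in> weight_space k N \<rho> l. v \<noteq> 0\<^sub>v N \<and>
        (\<forall>i j. i < j \<and> j < k \<longrightarrow> \<rho> (elem_mat k i j) *\<^sub>v v = 0\<^sub>v N))"

definition irrep_of_highest_weight ::
    "nat \<Rightarrow> real vec \<Rightarrow> nat \<Rightarrow> (complex mat \<Rightarrow> complex mat) \<Rightarrow> bool" where
  "irrep_of_highest_weight k l N \<rho> \<longleftrightarrow>
     irreducible_sl_rep k N \<rho> \<and> has_highest_weight k N \<rho> l"

definition ker_meets_orthant_trivially :: "nat \<Rightarrow> nat \<Rightarrow> int mat \<Rightarrow> bool" where
  "ker_meets_orthant_trivially d n M \<longleftrightarrow>
     {x \<in> carrier_vec n. (\<forall>i<n. 0 \<le> x $ i) \<and> map_mat real_of_int M *\<^sub>v x = 0\<^sub>v d} = {0\<^sub>v n}"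

definition vector_partition :: "int mat \<Rightarrow> int vec \<Rightarrow> nat" where
  "vector_partition M b =
     card {x :: nat vec. x \<in> carrier_vec (dim_col M) \<and> M *\<^sub>v map_vec int x = b}"

end

(* The multiplicity is the number of Gelfand-Tsetlin patterns with top row l and weight b, and
   counting patterns is counting natural solutions of a linear system in the slacks of the
   interlacing inequalities.

   To identify the multiplicity, take the space of functions on patterns with the Gelfand-Tsetlin
   operators E_j, F_j. They satisfy [E_i, F_j] = delta_ij H_i (a Lagrange interpolation identity),
   the top pattern generates, and it spans the singular vectors. The given irreducible
   representation has these properties too. In either module a combination of words F_J applied to
   the highest weight vector vanishes iff it is annihilated by all words E_I of the same length,
   i.e. iff its coefficients are in the kernel of the Shapovalov matrix, which depends only on the
   highest weight. So the two modules satisfy the same linear relations between words, and their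
   weight spaces have equal dimensions. *)

theory Submission
  imports Defs "HOL-Library.Function_Algebras"
begin

section \<open>Highest weight modules\<close>

text \<open>The coordinates of weights are fractions, but only two kinds of quantities enter the
  count: the differences of neighbouring coordinates of the highest weight, which give the top row
  up to a common shift, and the partial sums of highest weight minus weight, which are its
  coefficients in simple roots. Both are integral and linear in the data, and they make up
  \<open>B_k\<close>. The two modules live on different sets and no map between them is constructed;
  what is carried across are linear relations between words of one length. Hence bases of weight
  spaces are chosen among words, not among patterns. The delicate point is the boundary of the
  polytope, where a move may leave the set of patterns and denominators may vanish. In the product
  of a raising and a lowering coefficient of one entry the numerator vanishes at every forbidden
  move, so the interpolation identity can be used there as well. Generation and the absence of
  further singular vectors both come from one triangularity, obtained by raising the leftmost entry
  that falls short of the row above.\<close>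

definition cscale :: "complex \<Rightarrow> ('a \<Rightarrow> complex) \<Rightarrow> 'a \<Rightarrow> complex" where
  "cscale c x = (\<lambda>t. c * x t)"

lemma cscale_apply: "cscale c x t = c * x t"
  by (simp add: cscale_def)

interpretation cfun: vector_space "cscale :: complex \<Rightarrow> ('a \<Rightarrow> complex) \<Rightarrow> 'a \<Rightarrow> complex"
  by unfold_locales (auto simp: cscale_apply algebra_simps fun_eq_iff)

(* As simp rules these would rewrite unapplied functions into lambda abstractions. *)
declare zero_fun_apply [simp del] plus_fun_apply [simp del]

lemma sum_fun_apply: "(\<Sum>a\<in>A. h a) t = (\<Sum>a\<in>A. h a t)" for h :: "'b \<Rightarrow> 'a \<Rightarrow> complex"
  by (induction A rule: infinite_finite_induct) (auto simp: zero_fun_apply plus_fun_apply)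

lemmas fun_apply = zero_fun_apply plus_fun_apply cscale_apply sum_fun_apply

section \<open>Linear maps between function spaces and simultaneous eigenvectors\<close>

definition clin :: "(('a \<Rightarrow> complex) \<Rightarrow> ('b \<Rightarrow> complex)) \<Rightarrow> bool" where
  "clin g \<longleftrightarrow> (\<forall>x y. g (x + y) = g x + g y) \<and> (\<forall>c x. g (cscale c x) = cscale c (g x))"

lemma clin_add: "clin g \<Longrightarrow> g (x + y) = g x + g y"
  and clin_scale: "clin g \<Longrightarrow> g (cscale c x) = cscale c (g x)"
  by (simp_all add: clin_def)

lemma clin_zero: "clin g \<Longrightarrow> g 0 = 0"
  using clin_scale[of g 0 0] by simp

lemma clin_sum: "clin g \<Longrightarrow> g (sum h A) = (\<Sum>a\<in>A. g (h a))"
  by (induction A rule: infinite_finite_induct) (auto simp: clin_zero clin_add)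

lemma clin_sum_list: "clin g \<Longrightarrow> g (sum_list xs) = sum_list (map g xs)"
  by (induction xs) (auto simp: clin_zero clin_add)

lemma clin_span:
  assumes "clin g" "x \<in> cfun.span S" "\<And>s. s \<in> S \<Longrightarrow> g s \<in> cfun.span T"
  shows "g x \<in> cfun.span T"
  using assms(2)
proof (induction rule: cfun.span_induct_alt)
  case base
  then show ?case by (simp add: clin_zero[OF assms(1)] cfun.span_zero)
next
  case (step c x y)
  then show ?case
    using assms by (simp add: clin_add clin_scale cfun.span_add cfun.span_scale)
qed

lemma sum_list_in_span: "(\<And>x. x \<in> set xs \<Longrightarrow> x \<in> cfun.span T) \<Longrightarrow> sum_list xs \<in> cfun.span T"
  by (induction xs) (auto intro: cfun.span_add cfun.span_zero)

lemma clin_fold: "(\<And>i. i \<in> set I \<Longrightarrow> clin (g i)) \<Longrightarrow> clin (fold g I)"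
proof (induction I)
  case Nil
  then show ?case by (simp add: clin_def)
next
  case (Cons i I)
  then have "clin (g i)" "clin (fold g I)" by auto
  then show ?case by (simp add: clin_def)
qed

text \<open>Choose an \<open>h\<close> that separates \<open>s0\<close> from \<open>\<chi>0\<close>.
  Then \<open>D h - \<chi> s0 h\<close> kills the summand of \<open>s0\<close>, multiplies
  \<open>z\<close> by \<open>c\<close> and rescales the other summands, so the induction continues
  with one summand less. Characters within \<open>T\<close> may coincide.\<close>

lemma zero_of_eigen_sum:
  fixes u :: "'b \<Rightarrow> 'a \<Rightarrow> complex"
  assumes "finite T" "\<And>h. h \<in> H \<Longrightarrow> clin (D h)"
    and "\<And>s h. s \<in> T \<Longrightarrow> h \<in> H \<Longrightarrow> D h (u s) = cscale (\<chi> s h) (u s)"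
    and "\<And>s. s \<in> T \<Longrightarrow> \<exists>h\<in>H. \<chi> s h \<noteq> \<chi>0 h"
    and "\<And>h. h \<in> H \<Longrightarrow> D h z = cscale (\<chi>0 h) z"
    and "z = (\<Sum>s\<in>T. u s)"
  shows "z = 0"
  using assms
proof (induction T arbitrary: z u rule: finite_induct)
  case empty
  then show ?case by simp
next
  case (insert s0 T)
  obtain h where h: "h \<in> H" "\<chi> s0 h \<noteq> \<chi>0 h" using insert.prems(3) by blast
  define c where "c = \<chi>0 h - \<chi> s0 h"
  have c: "c \<noteq> 0" using h by (simp add: c_def)
  define w where "w s = cscale ((\<chi> s h - \<chi> s0 h) / c) (u s)" for s
  have "D h z = (\<Sum>s\<in>insert s0 T. D h (u s))"
    using insert.prems(5) clin_sum[OF insert.prems(1)[OF h(1)]] by simp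
  also have "\<dots> = (\<Sum>s\<in>insert s0 T. cscale (\<chi> s h) (u s))"
    using insert.prems(2) h(1) by (intro sum.cong) auto
  finally have e1: "cscale (\<chi>0 h) z = (\<Sum>s\<in>insert s0 T. cscale (\<chi> s h) (u s))"
    using insert.prems(4) h by simp
  have e2: "cscale (\<chi> s0 h) z = (\<Sum>s\<in>insert s0 T. cscale (\<chi> s0 h) (u s))"
    unfolding insert.prems(5) by (simp add: cfun.scale_sum_right)
  have "cscale c z = (\<Sum>s\<in>insert s0 T. cscale (\<chi> s h - \<chi> s0 h) (u s))"
    unfolding c_def cfun.scale_left_diff_distrib e1 e2 by (simp add: sum_subtractf)
  also have "\<dots> = (\<Sum>s\<in>T. cscale (\<chi> s h - \<chi> s0 h) (u s))"
    using insert.hyps by simp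
  finally have cz: "cscale c z = (\<Sum>s\<in>T. cscale (\<chi> s h - \<chi> s0 h) (u s))" .
  have "z = cscale (1 / c) (cscale c z)" using c by simp
  also have "\<dots> = (\<Sum>s\<in>T. w s)"
    unfolding cz by (simp add: w_def cfun.scale_sum_right)
  finally have z: "z = (\<Sum>s\<in>T. w s)" .
  show ?case
  proof (rule insert.IH[of w])
    show "D h' (w s) = cscale (\<chi> s h') (w s)" if "s \<in> T" "h' \<in> H" for s h'
      using that insert.prems(1,2)
      by (simp add: w_def clin_scale del: cfun.scale_scale) (simp add: mult.commute)
  qed (use insert.prems z in auto)
qed

text \<open>Sort the terms of a combination by whether their character is \<open>\<chi>0\<close>.
  The good part \<open>y\<close> has the eigenvalues of \<open>z\<close>, hence so has the remainder
  \<open>x\<close>, which vanishes by \<open>zero_of_eigen_sum\<close>. This is how a weight vector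
  is expanded in words of its own weight.\<close>

lemma eigenvector_in_span:
  fixes z :: "'a \<Rightarrow> complex"
  assumes z: "z \<in> cfun.span S" and lin: "\<And>h. h \<in> H \<Longrightarrow> clin (D h)"
    and eig: "\<And>s h. s \<in> S \<Longrightarrow> h \<in> H \<Longrightarrow> D h s = cscale (\<chi> s h) s"
    and zeig: "\<And>h. h \<in> H \<Longrightarrow> D h z = cscale (\<chi>0 h) z"
  shows "z \<in> cfun.span {s \<in> S. \<forall>h\<in>H. \<chi> s h = \<chi>0 h}"
proof -
  obtain T r where T: "finite T" "T \<subseteq> S" "z = (\<Sum>s\<in>T. cscale (r s) s)"
    using z unfolding cfun.span_explicit by blast
  define P where "P s \<longleftrightarrow> (\<forall>h\<in>H. \<chi> s h = \<chi>0 h)" for s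
  define y where "y = (\<Sum>s\<in>{s\<in>T. P s}. cscale (r s) s)"
  define x where "x = (\<Sum>s\<in>{s\<in>T. \<not> P s}. cscale (r s) s)"
  have zxy: "z = y + x"
    unfolding T(3) y_def x_def using T(1)
    by (subst sum.union_disjoint[symmetric]) (auto intro!: sum.cong)
  have eigr: "D h (cscale (r s) s) = cscale (\<chi> s h) (cscale (r s) s)"
    if "s \<in> T" "h \<in> H" for s h
    using that T(2) lin eig by (subst clin_scale) (auto simp: mult.commute)
  have yeig: "D h y = cscale (\<chi>0 h) y" if "h \<in> H" for h
  proof -
    have "D h y = (\<Sum>s\<in>{s\<in>T. P s}. D h (cscale (r s) s))"
      unfolding y_def by (rule clin_sum[OF lin[OF that]])
    also have "\<dots> = (\<Sum>s\<in>{s\<in>T. P s}. cscale (\<chi>0 h) (cscale (r s) s))"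
    proof (rule sum.cong[OF refl])
      fix s assume s: "s \<in> {s\<in>T. P s}"
      then have "\<chi> s h = \<chi>0 h" using that by (simp add: P_def)
      then show "D h (cscale (r s) s) = cscale (\<chi>0 h) (cscale (r s) s)"
        using eigr[of s h] s that by simp
    qed
    finally show ?thesis unfolding y_def by (simp add: cfun.scale_sum_right)
  qed
  have "x = 0"
  proof (rule zero_of_eigen_sum[of "{s\<in>T. \<not> P s}" H D "\<lambda>s. cscale (r s) s" \<chi> \<chi>0])
    show "D h x = cscale (\<chi>0 h) x" if "h \<in> H" for h
    proof -
      have "D h z = D h y + D h x" unfolding zxy by (rule clin_add[OF lin[OF that]])
      then have "cscale (\<chi>0 h) (y + x) = cscale (\<chi>0 h) y + D h x"
        using zeig[OF that] yeig[OF that] zxy by simp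
      then show ?thesis by (simp add: cfun.scale_right_distrib)
    qed
  qed (use T eigr lin in \<open>auto simp: P_def x_def\<close>)
  then have "z = y" using zxy by simp
  moreover have "y \<in> cfun.span {s \<in> S. P s}"
    unfolding y_def using T(2)
    by (intro cfun.span_sum cfun.span_scale cfun.span_base) auto
  ultimately show ?thesis by (simp add: P_def)
qed

section \<open>Words in the lowering operators and their Shapovalov matrix\<close>

definition cartan_entry :: "nat \<Rightarrow> nat \<Rightarrow> int" where
  "cartan_entry i j = (if i = j then 2 else if i = Suc j \<or> j = Suc i then -1 else 0)"

text \<open>The eigenvalue of \<open>H_i\<close> on \<open>F_J x_0\<close> if it is
  \<open>a i\<close> on \<open>x_0\<close>: the letter \<open>j\<close> subtracts the simple root
  \<open>j\<close>, on which \<open>H_i\<close> takes the value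
  \<open>cartan_entry i j\<close>.\<close>

fun lower_weight :: "(nat \<Rightarrow> int) \<Rightarrow> nat \<Rightarrow> nat list \<Rightarrow> int" where
  "lower_weight a i [] = a i"
| "lower_weight a i (j # J) = lower_weight a i J - cartan_entry i j"

text \<open>\<open>E_i F_J x_0\<close> as a formal combination of words one letter shorter. Moving
  \<open>E_i\<close> to the right until it kills \<open>x_0\<close> leaves one term for each letter
  \<open>i\<close>, with the weight of the tail behind it as coefficient. It is a list because the
  same word can arise several times.\<close>

fun raise_word :: "(nat \<Rightarrow> int) \<Rightarrow> nat \<Rightarrow> nat list \<Rightarrow> (int \<times> nat list) list" where
  "raise_word a i [] = []"
| "raise_word a i (j # J) =
     map (\<lambda>(c, K). (c, j # K)) (raise_word a i J) @ (if i = j then [(lower_weight a i J, J)] else [])"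

text \<open>The coefficient of the highest weight vector in \<open>E\<^sub>I F\<^sub>J x\<^sub>0\<close>: it is computed from the commutation
  relations alone, so it depends on the highest weight only.\<close>

fun shapovalov :: "(nat \<Rightarrow> int) \<Rightarrow> nat list \<Rightarrow> nat list \<Rightarrow> int" where
  "shapovalov a [] J = (if J = [] then 1 else 0)"
| "shapovalov a (i # I) J = (\<Sum>(c, K)\<leftarrow>raise_word a i J. c * shapovalov a I K)"

lemma raise_word_length: "(c, K) \<in> set (raise_word a i J) \<Longrightarrow> length J = Suc (length K)"
  by (induction J arbitrary: K c) (auto split: if_splits)

lemma raise_word_set: "(c, K) \<in> set (raise_word a i J) \<Longrightarrow> set K \<subseteq> set J"
  by (induction J arbitrary: K c) (auto split: if_splits, blast)

text \<open>The Serre relations are not needed: a module with a highest weight vector and no other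
  singular vectors is determined by its highest weight already over the free product of the
  raising and lowering operators, subject to the commutation relations between the two kinds.\<close>

locale hw_module =
  fixes n :: nat and a :: "nat \<Rightarrow> int"
    and e f :: "nat \<Rightarrow> ('a \<Rightarrow> complex) \<Rightarrow> 'a \<Rightarrow> complex" and x0 :: "'a \<Rightarrow> complex"
  assumes lin_e: "i < n \<Longrightarrow> clin (e i)" and lin_f: "i < n \<Longrightarrow> clin (f i)"
    and x0: "x0 \<noteq> 0" "i < n \<Longrightarrow> e i x0 = 0"
    and comm: "i < n \<Longrightarrow> j < n \<Longrightarrow> set J \<subseteq> {..<n} \<Longrightarrow>
      e i (f j (foldr f J x0)) = f j (e i (foldr f J x0)) +
        (if i = j then cscale (of_int (lower_weight a i J)) (foldr f J x0) else 0)"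
    and singular: "0 < m \<Longrightarrow> x \<in> cfun.span {foldr f J x0 | J. set J \<subseteq> {..<n} \<and> length J = m} \<Longrightarrow>
      (\<And>i. i < n \<Longrightarrow> e i x = 0) \<Longrightarrow> x = 0"
begin

definition level :: "nat \<Rightarrow> ('a \<Rightarrow> complex) set" where
  "level m = cfun.span {foldr f J x0 | J. set J \<subseteq> {..<n} \<and> length J = m}"

lemma word_in_level: "set J \<subseteq> {..<n} \<Longrightarrow> foldr f J x0 \<in> level (length J)"
  unfolding level_def by (rule cfun.span_base) auto

lemma raise:
  assumes "i < n" "set J \<subseteq> {..<n}"
  shows "e i (foldr f J x0) = (\<Sum>(c, K)\<leftarrow>raise_word a i J. cscale (of_int c) (foldr f K x0))"
  using assms(2)
proof (induction J)
  case Nil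
  then show ?case using x0 assms by simp
next
  case (Cons j J)
  then have j: "j < n" "set J \<subseteq> {..<n}" by auto
  have "e i (foldr f (j # J) x0) = f j (e i (foldr f J x0)) +
        (if i = j then cscale (of_int (lower_weight a i J)) (foldr f J x0) else 0)"
    using comm[OF assms(1) j] by simp
  also have "f j (e i (foldr f J x0)) =
      (\<Sum>(c, K)\<leftarrow>raise_word a i J. cscale (of_int c) (foldr f (j # K) x0))"
    unfolding Cons.IH[OF j(2)] clin_sum_list[OF lin_f[OF j(1)]] map_map
    by (intro arg_cong[where f = sum_list] map_cong refl)
       (auto simp: clin_scale[OF lin_f[OF j(1)]])
  finally show ?case
    by (simp add: comp_def case_prod_unfold)
qed

lemma raise_level:
  assumes "i < n" "x \<in> level (Suc m)"
  shows "e i x \<in> level m"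
proof -
  have "e i (foldr f J x0) \<in> level m" if J: "set J \<subseteq> {..<n}" "length J = Suc m" for J
    unfolding raise[OF assms(1) J(1)] level_def
  proof (rule sum_list_in_span, clarsimp)
    fix c K assume K: "(c, K) \<in> set (raise_word a i J)"
    have "set K \<subseteq> {..<n}" "length K = m"
      using raise_word_length[OF K] raise_word_set[OF K] J by auto
    then have "foldr f K x0 \<in> level m" using word_in_level by blast
    then show "cscale (of_int c) (foldr f K x0)
      \<in> cfun.span {foldr f J x0 |J. set J \<subseteq> {..<n} \<and> length J = m}"
      unfolding level_def by (rule cfun.span_scale)
  qed
  then show ?thesis
    using clin_span[OF lin_e[OF assms(1)] assms(2)[unfolded level_def]] unfolding level_def by blast
qed

text \<open>Nondegeneracy of the pairing of raising and lowering words: a nonzero vector of positive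
  level is not singular, so some \<open>e i\<close> keeps it nonzero one level lower, and induction
  reaches level 0.\<close>

lemma zero_of_raised:
  assumes "x \<in> level m" "\<And>I. set I \<subseteq> {..<n} \<Longrightarrow> length I = m \<Longrightarrow> fold e I x = 0"
  shows "x = 0"
  using assms
proof (induction m arbitrary: x)
  case 0
  from 0(2)[of "[]"] show ?case by simp
next
  case (Suc m)
  have "e i x = 0" if "i < n" for i
  proof (rule Suc.IH)
    show "e i x \<in> level m" using raise_level[OF that Suc.prems(1)] .
    show "fold e I (e i x) = 0" if "set I \<subseteq> {..<n}" "length I = m" for I
      using Suc.prems(2)[of "i # I"] that \<open>i < n\<close> by simp
  qed
  then show ?case using singular[of "Suc m" x] Suc.prems(1) by (auto simp: level_def)
qed

text \<open>Equal lengths bring the word back to a multiple of \<open>x0\<close>.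
  \<open>fold\<close> applies the first letter of \<open>I\<close> first, in step with the recursion
  of \<open>shapovalov\<close>.\<close>

lemma fold_raise_word:
  assumes "set I \<subseteq> {..<n}" "set J \<subseteq> {..<n}" "length I = length J"
  shows "fold e I (foldr f J x0) = cscale (of_int (shapovalov a I J)) x0"
  using assms
proof (induction I arbitrary: J)
  case Nil
  then show ?case by simp
next
  case (Cons i I)
  have lin: "clin (fold e I)" using Cons.prems(1) by (intro clin_fold lin_e) auto
  have "fold e (i # I) (foldr f J x0) =
      fold e I (\<Sum>(c, K)\<leftarrow>raise_word a i J. cscale (of_int c) (foldr f K x0))"
    using raise[of i J] Cons.prems by simp
  also have "\<dots> = (\<Sum>(c, K)\<leftarrow>raise_word a i J. cscale (of_int (c * shapovalov a I K)) x0)"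
    unfolding clin_sum_list[OF lin] map_map
  proof (intro arg_cong[where f = sum_list] map_cong refl, clarsimp simp: clin_scale[OF lin])
    fix c K assume K: "(c, K) \<in> set (raise_word a i J)"
    have "fold e I (foldr f K x0) = cscale (of_int (shapovalov a I K)) x0"
      using raise_word_length[OF K] raise_word_set[OF K] Cons.prems by (intro Cons.IH) auto
    then show "cscale (of_int c) (fold e I (foldr f K x0)) =
       cscale (of_int c * of_int (shapovalov a I K)) x0" by simp
  qed
  also have "\<dots> = cscale (of_int (shapovalov a (i # I) J)) x0"
  proof -
    have "(\<Sum>(c, K)\<leftarrow>xs. cscale (of_int (c * shapovalov a I K)) x0) =
      cscale (of_int (\<Sum>(c, K)\<leftarrow>xs. c * shapovalov a I K)) x0" for xs
      by (induction xs) (auto simp: cfun.scale_left_distrib)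
    then show ?thesis by simp
  qed
  finally show ?case .
qed

lemma relation_iff:
  assumes "\<And>J. J \<in> S \<Longrightarrow> set J \<subseteq> {..<n} \<and> length J = m"
  shows "(\<Sum>J\<in>S. cscale (r J) (foldr f J x0)) = 0 \<longleftrightarrow>
    (\<forall>I. set I \<subseteq> {..<n} \<and> length I = m \<longrightarrow> (\<Sum>J\<in>S. r J * of_int (shapovalov a I J)) = 0)"
proof -
  let ?x = "\<Sum>J\<in>S. cscale (r J) (foldr f J x0)"
  have fold_x: "fold e I ?x = cscale (\<Sum>J\<in>S. r J * of_int (shapovalov a I J)) x0"
    if I: "set I \<subseteq> {..<n}" "length I = m" for I
  proof -
    have lin: "clin (fold e I)" using I by (intro clin_fold lin_e) auto
    have "fold e I ?x = (\<Sum>J\<in>S. cscale (r J) (fold e I (foldr f J x0)))"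
      by (simp add: clin_sum[OF lin] clin_scale[OF lin])
    also have "\<dots> = (\<Sum>J\<in>S. cscale (r J * of_int (shapovalov a I J)) x0)"
      using assms I by (intro sum.cong) (auto simp: fold_raise_word)
    also have "\<dots> = cscale (\<Sum>J\<in>S. r J * of_int (shapovalov a I J)) x0"
      by (rule cfun.scale_sum_left[symmetric])
    finally show ?thesis .
  qed
  have "?x \<in> level m"
    unfolding level_def using assms by (intro cfun.span_sum cfun.span_scale cfun.span_base) blast
  then have "?x = 0 \<longleftrightarrow> (\<forall>I. set I \<subseteq> {..<n} \<and> length I = m \<longrightarrow> fold e I ?x = 0)"
  proof (intro iffI allI impI)
    fix I assume z: "?x = 0" and I: "set I \<subseteq> {..<n} \<and> length I = m"
    have "clin (fold e I)" using I by (intro clin_fold lin_e) auto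
    then show "fold e I ?x = 0" unfolding z by (rule clin_zero)
  qed (rule zero_of_raised, auto)
  also have "\<dots> \<longleftrightarrow> (\<forall>I. set I \<subseteq> {..<n} \<and> length I = m \<longrightarrow>
      (\<Sum>J\<in>S. r J * of_int (shapovalov a I J)) = 0)"
    using x0(1) by (simp add: fold_x cong: imp_cong conj_cong)
  finally show ?thesis .
qed

end

text \<open>The criterion of \<open>relation_iff\<close> mentions the highest weight
  \<open>a\<close> and the words, but not the operators. This is the only bridge between the two
  modules, whose functions live on different types.\<close>

lemma same_relations:
  assumes "hw_module n a e f x0" "hw_module n a e' f' y0"
    and "\<And>J. J \<in> S \<Longrightarrow> set J \<subseteq> {..<n} \<and> length J = m"
  shows "(\<Sum>J\<in>S. cscale (r J) (foldr f J x0)) = 0 \<longleftrightarrow> (\<Sum>J\<in>S. cscale (r J) (foldr f' J y0)) = 0"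
  using hw_module.relation_iff[OF assms(1,3)] hw_module.relation_iff[OF assms(2,3)] by simp

section \<open>Gelfand--Tsetlin patterns\<close>

text \<open>The left side is a rational function of \<open>y\<close> with simple poles at the nodes
  and value 1 at infinity. Enlarging \<open>T\<close> by \<open>u\<close> multiplies it by
  \<open>(y - x u) / (y - z u) = 1 + D / (y - z u)\<close>, and the induction follows this
  product.\<close>

lemma partial_fractions:
  fixes z x :: "'t \<Rightarrow> complex"
  assumes "finite T" "inj_on z T" "y \<notin> z ` T"
  shows "(\<Prod>s\<in>T. y - x s) / (\<Prod>s\<in>T. y - z s) =
    1 + (\<Sum>t\<in>T. (\<Prod>s\<in>T. z t - x s) / (\<Prod>s\<in>T - {t}. z t - z s) / (y - z t))"
  using assms
proof (induction T arbitrary: y rule: finite_induct)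
  case empty
  then show ?case by simp
next
  case (insert u T)
  define \<tau> where "\<tau> t = (\<Prod>s\<in>T. z t - x s) / (\<Prod>s\<in>T - {t}. z t - z s)" for t
  define D where "D = z u - x u"
  have inj: "inj_on z T" "z u \<notin> z ` T" and yu: "y \<noteq> z u" "y \<notin> z ` T"
    using insert by auto
  have zt: "z t \<noteq> z u" "y \<noteq> z t" if "t \<in> T" for t using that inj yu by (metis imageI)+
  have gy: "(\<Prod>s\<in>T. y - x s) / (\<Prod>s\<in>T. y - z s) = 1 + (\<Sum>t\<in>T. \<tau> t / (y - z t))"
    unfolding \<tau>_def by (rule insert.IH[OF inj(1) yu(2)])
  have gu: "(\<Prod>s\<in>T. z u - x s) / (\<Prod>s\<in>T. z u - z s) = 1 + (\<Sum>t\<in>T. \<tau> t / (z u - z t))"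
    unfolding \<tau>_def by (rule insert.IH[OF inj])
  \<comment> \<open>A residue at an old node gains the factor
    \<open>(z t - x u) / (z t - z u) = 1 + D / (z t - z u)\<close>.\<close>
  have upd: "(\<Prod>s\<in>insert u T. z t - x s) / (\<Prod>s\<in>insert u T - {t}. z t - z s) = \<tau> t + D * \<tau> t / (z t - z u)"
    if t: "t \<in> T" for t
  proof -
    have "insert u T - {t} = insert u (T - {t})" "u \<notin> T - {t}" using insert t by auto
    then show ?thesis using insert.hyps zt[OF t]
      by (simp add: \<tau>_def D_def divide_simps) (simp add: algebra_simps)
  qed
  \<comment> \<open>The residue at the new node is \<open>D\<close> times the old function at
    \<open>z u\<close>, which is why the induction hypothesis is taken at \<open>y = z u\<close>
    too.\<close>
  have termu: "(\<Prod>s\<in>insert u T. z u - x s) / (\<Prod>s\<in>insert u T - {u}. z u - z s) =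
      D * (1 + (\<Sum>t\<in>T. \<tau> t / (z u - z t)))"
    unfolding gu[symmetric] using insert.hyps by (simp add: D_def)
  have "(\<Sum>t\<in>insert u T. (\<Prod>s\<in>insert u T. z t - x s) / (\<Prod>s\<in>insert u T - {t}. z t - z s) / (y - z t))
    = D * (1 + (\<Sum>t\<in>T. \<tau> t / (z u - z t))) / (y - z u) + (\<Sum>t\<in>T. (\<tau> t + D * \<tau> t / (z t - z u)) / (y - z t))"
    unfolding sum.insert[OF insert.hyps(1,2)] termu using upd
    by (intro arg_cong2[where f = "(+)"] sum.cong refl) simp_all
  also have "\<dots> = D / (y - z u) + (\<Sum>t\<in>T. D * \<tau> t / (z u - z t) / (y - z u) + (\<tau> t + D * \<tau> t / (z t - z u)) / (y - z t))"
    by (simp add: sum.distrib sum_distrib_left sum_divide_distrib ring_distribs add_divide_distrib mult.assoc)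
  also have "\<dots> = D / (y - z u) + (\<Sum>t\<in>T. \<tau> t / (y - z t) * (1 + D / (y - z u)))"
  proof (intro arg_cong2[where f = "(+)"] refl sum.cong)
    fix t assume t: "t \<in> T"
    have "z u - z t \<noteq> 0" "z t - z u \<noteq> 0" "y - z t \<noteq> 0" "y - z u \<noteq> 0" using zt[OF t] yu by auto
    then show "D * \<tau> t / (z u - z t) / (y - z u) + (\<tau> t + D * \<tau> t / (z t - z u)) / (y - z t) =
      \<tau> t / (y - z t) * (1 + D / (y - z u))"
      by (simp add: divide_simps) (simp add: algebra_simps)
  qed
  also have "\<dots> = D / (y - z u) + (\<Sum>t\<in>T. \<tau> t / (y - z t)) * (1 + D / (y - z u))"
    by (simp add: sum_distrib_right)
  finally have "1 + (\<Sum>t\<in>insert u T. (\<Prod>s\<in>insert u T. z t - x s) / (\<Prod>s\<in>insert u T - {t}. z t - z s) / (y - z t))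
     = (1 + (\<Sum>t\<in>T. \<tau> t / (y - z t))) * (1 + D / (y - z u))"
    by (simp add: algebra_simps)
  also have "1 + D / (y - z u) = (y - x u) / (y - z u)"
    using yu by (simp add: D_def divide_simps)
  finally show ?case
    unfolding gy[symmetric] using insert.hyps by (simp add: mult.commute)
qed

text \<open>This compares the coefficients of \<open>1 / y\<close> at infinity in
  \<open>partial_fractions\<close>. Instead of an expansion, an induction evaluates
  \<open>partial_fractions\<close> at each new node.\<close>

lemma lagrange_sum_inj:
  fixes z x :: "'t \<Rightarrow> complex"
  assumes "finite T" "inj_on z T"
  shows "(\<Sum>t\<in>T. (\<Prod>s\<in>T. z t - x s) / (\<Prod>s\<in>T - {t}. z t - z s)) = (\<Sum>t\<in>T. z t - x t)"
  using assms
proof (induction T rule: finite_induct)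
  case empty
  then show ?case by simp
next
  case (insert u T)
  define \<tau> where "\<tau> t = (\<Prod>s\<in>T. z t - x s) / (\<Prod>s\<in>T - {t}. z t - z s)" for t
  define D where "D = z u - x u"
  have inj: "inj_on z T" "z u \<notin> z ` T" using insert by auto
  have zt: "z t \<noteq> z u" if "t \<in> T" for t using that inj by (metis imageI)
  have gu: "(\<Prod>s\<in>T. z u - x s) / (\<Prod>s\<in>T. z u - z s) = 1 + (\<Sum>t\<in>T. \<tau> t / (z u - z t))"
    unfolding \<tau>_def by (rule partial_fractions[OF insert.hyps(1) inj])
  have upd: "(\<Prod>s\<in>insert u T. z t - x s) / (\<Prod>s\<in>insert u T - {t}. z t - z s) = \<tau> t - D * (\<tau> t / (z u - z t))"
    if t: "t \<in> T" for t
  proof -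
    have "insert u T - {t} = insert u (T - {t})" "u \<notin> T - {t}" using insert t by auto
    then show ?thesis using insert.hyps zt[OF t]
      by (simp add: \<tau>_def D_def divide_simps) (simp add: algebra_simps)
  qed
  have termu: "(\<Prod>s\<in>insert u T. z u - x s) / (\<Prod>s\<in>insert u T - {u}. z u - z s) =
      D * (1 + (\<Sum>t\<in>T. \<tau> t / (z u - z t)))"
    unfolding gu[symmetric] using insert.hyps by (simp add: D_def)
  have "(\<Sum>t\<in>insert u T. (\<Prod>s\<in>insert u T. z t - x s) / (\<Prod>s\<in>insert u T - {t}. z t - z s))
    = D * (1 + (\<Sum>t\<in>T. \<tau> t / (z u - z t))) + (\<Sum>t\<in>T. \<tau> t - D * (\<tau> t / (z u - z t)))"
    using insert.hyps termu upd by simp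
  also have "\<dots> = D + (\<Sum>t\<in>T. \<tau> t)"
    by (simp add: sum_subtractf sum_distrib_left ring_distribs)
  also have "(\<Sum>t\<in>T. \<tau> t) = (\<Sum>t\<in>T. z t - x t)"
    unfolding \<tau>_def by (rule insert.IH[OF inj(1)])
  finally show ?case using insert.hyps by (simp add: D_def)
qed

text \<open>Coinciding nodes are allowed as long as the numerator vanishes there; their summands are then
  \<open>0 / 0 = 0\<close>. This is what happens at the boundary of the Gelfand--Tsetlin polytope.\<close>

lemma lagrange_sum:
  fixes z x :: "'t \<Rightarrow> complex"
  assumes fin: "finite T"
    and coll: "\<And>s t. s \<in> T \<Longrightarrow> t \<in> T \<Longrightarrow> s \<noteq> t \<Longrightarrow> z s = z t \<Longrightarrow> x t = z t"
  shows "(\<Sum>t\<in>T. (\<Prod>s\<in>T. z t - x s) / (\<Prod>s\<in>T - {t}. z t - z s)) = (\<Sum>t\<in>T. z t - x t)"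
proof -
  \<comment> \<open>The nodes that collide with no other node. At all others the root of the
    numerator equals the node, so their factors cancel from the summands that remain.\<close>
  define T' where "T' = {t \<in> T. \<forall>s\<in>T - {t}. z s \<noteq> z t}"
  have sub: "T' \<subseteq> T" "finite T'" using fin by (auto simp: T'_def)
  have out: "x t = z t" if "t \<in> T - T'" for t
    using that coll by (auto simp: T'_def)
  have "(\<Sum>t\<in>T. (\<Prod>s\<in>T. z t - x s) / (\<Prod>s\<in>T - {t}. z t - z s)) =
        (\<Sum>t\<in>T'. (\<Prod>s\<in>T. z t - x s) / (\<Prod>s\<in>T - {t}. z t - z s))"
  proof (rule sum.mono_neutral_right[OF fin sub(1)], intro ballI)
    fix t assume "t \<in> T - T'"
    then have "z t - x t = 0" "t \<in> T" using out by auto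
    then have "(\<Prod>s\<in>T. z t - x s) = 0" using fin by (auto intro: prod_zero)
    then show "(\<Prod>s\<in>T. z t - x s) / (\<Prod>s\<in>T - {t}. z t - z s) = 0" by simp
  qed
  also have "\<dots> = (\<Sum>t\<in>T'. (\<Prod>s\<in>T'. z t - x s) / (\<Prod>s\<in>T' - {t}. z t - z s))"
  proof (rule sum.cong[OF refl])
    fix t assume t: "t \<in> T'"
    define R where "R = (\<Prod>s\<in>T - T'. z t - z s)"
    have "z t \<noteq> z s" if "s \<in> T - T'" for s
    proof -
      have "s \<in> T - {t}" using t that by auto
      moreover have "\<forall>s\<in>T - {t}. z s \<noteq> z t" using t by (simp add: T'_def)
      ultimately show ?thesis by metis
    qed
    then have "R \<noteq> 0" using fin by (simp add: R_def)
    moreover have "(\<Prod>s\<in>T. z t - x s) = R * (\<Prod>s\<in>T'. z t - x s)"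
      unfolding prod.subset_diff[OF sub(1) fin] R_def using out by simp
    moreover have "(\<Prod>s\<in>T - {t}. z t - z s) = R * (\<Prod>s\<in>T' - {t}. z t - z s)"
    proof -
      have "T - {t} - (T' - {t}) = T - T'" using t by auto
      then show ?thesis using prod.subset_diff[of "T' - {t}" "T - {t}"] sub fin
        by (simp add: R_def Diff_mono)
    qed
    ultimately show "(\<Prod>s\<in>T. z t - x s) / (\<Prod>s\<in>T - {t}. z t - z s) =
      (\<Prod>s\<in>T'. z t - x s) / (\<Prod>s\<in>T' - {t}. z t - z s)" by simp
  qed
  also have "\<dots> = (\<Sum>t\<in>T'. z t - x t)"
    by (rule lagrange_sum_inj) (use sub in \<open>auto simp: inj_on_def T'_def\<close>)
  also have "\<dots> = (\<Sum>t\<in>T. z t - x t)"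
    by (rule sum.mono_neutral_left[OF fin sub(1)]) (use out in auto)
  finally show ?thesis .
qed

text \<open>Here \<open>l\<close> is row \<open>j\<close> of a pattern, \<open>d\<close> the row
  below and \<open>u\<close> the row above, in shifted entries. Up to a common sign the two sums are
  the diagonal coefficients of \<open>F_j E_j\<close> and \<open>E_j F_j\<close>. Together they are
  one Lagrange sum over the \<open>2 (j + 1)\<close> nodes \<open>l i\<close> and
  \<open>l i - 1\<close>, with the \<open>u m\<close> and \<open>d m - 1\<close> as roots of the
  numerator.\<close>

lemma interlacing_identity:
  fixes l d u :: "nat \<Rightarrow> complex"
  assumes inj: "\<And>s t. s \<le> j \<Longrightarrow> t \<le> j \<Longrightarrow> l s = l t \<Longrightarrow> s = t"
    and coll: "\<And>s t. s \<le> j \<Longrightarrow> t \<le> j \<Longrightarrow> l s = l t - 1 \<Longrightarrow> t < j \<and> u s = l s \<and> d t = l t"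
  shows "(\<Sum>i\<le>j. (\<Prod>m<j. l i + 1 - d m) * (\<Prod>m<Suc (Suc j). l i - u m) /
              ((\<Prod>m\<in>{..j} - {i}. l i - l m) * (\<Prod>m\<in>{..j} - {i}. l i + 1 - l m)))
       - (\<Sum>i\<le>j. (\<Prod>m<j. l i - d m) * (\<Prod>m<Suc (Suc j). l i - 1 - u m) /
              ((\<Prod>m\<in>{..j} - {i}. l i - l m) * (\<Prod>m\<in>{..j} - {i}. l i - 1 - l m)))
       = (\<Sum>i\<le>j. 2 * l i - 1) - (\<Sum>m<j. d m - 1) - (\<Sum>m<Suc (Suc j). u m)"
proof -
  define z where "z = case_sum l (\<lambda>i. l i - 1)"
  \<comment> \<open>The pairing of roots with nodes is dictated by the collisions
    \<open>l s = l t - 1\<close>: there \<open>u s\<close> meets the node \<open>l s\<close>, and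
    \<open>d t - 1\<close> the node \<open>l t - 1\<close>. The unmatched node \<open>Inr j\<close>
    takes \<open>u (Suc j)\<close>; it never collides, as collisions have
    \<open>t < j\<close>.\<close>
  define x where "x = case_sum u (\<lambda>i. if i < j then d i - 1 else u (Suc j))"
  let ?T = "{..j} <+> {..j}"
  have num: "(\<Prod>s\<in>?T. y - x s) = (\<Prod>m<j. y + 1 - d m) * (\<Prod>m<Suc (Suc j). y - u m)" for y
  proof -
    have "(\<Prod>i\<le>j. y - (if i < j then d i - 1 else u (Suc j))) =
        (\<Prod>i<j. y + 1 - d i) * (y - u (Suc j))"
      by (simp add: lessThan_Suc_atMost[symmetric] algebra_simps)
    moreover have "(\<Prod>m<Suc (Suc j). y - u m) = (\<Prod>m\<le>j. y - u m) * (y - u (Suc j))"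
      by (simp only: prod.lessThan_Suc lessThan_Suc_atMost[symmetric])
    ultimately show ?thesis by (simp add: prod.Plus x_def ac_simps del: prod.lessThan_Suc)
  qed
  have denl: "(\<Prod>s\<in>?T - {Inl i}. z (Inl i) - z s) =
      (\<Prod>m\<in>{..j} - {i}. l i - l m) * (\<Prod>m\<in>{..j} - {i}. l i + 1 - l m)" if "i \<le> j" for i
  proof -
    have "?T - {Inl i} = ({..j} - {i}) <+> {..j}" by auto
    moreover have "(\<Prod>m\<le>j. l i - (l m - 1)) = (\<Prod>m\<in>{..j} - {i}. l i + 1 - l m)"
      using that by (subst prod.remove[of _ i]) (auto simp: algebra_simps)
    ultimately show ?thesis by (simp add: prod.Plus z_def)
  qed
  \<comment> \<open>The factor that \<open>l i - 1\<close> and \<open>l i\<close> contribute is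
    \<open>-1\<close> here and 1 in \<open>denl\<close>; this turns the single Lagrange sum into a
    difference.\<close>
  have denr: "(\<Prod>s\<in>?T - {Inr i}. z (Inr i) - z s) =
      - ((\<Prod>m\<in>{..j} - {i}. l i - l m) * (\<Prod>m\<in>{..j} - {i}. l i - 1 - l m))" if "i \<le> j" for i
  proof -
    have "?T - {Inr i} = {..j} <+> ({..j} - {i})" by auto
    moreover have "(\<Prod>m\<le>j. l i - 1 - l m) = - (\<Prod>m\<in>{..j} - {i}. l i - 1 - l m)"
      using that by (subst prod.remove[of _ i]) (auto simp: algebra_simps)
    ultimately show ?thesis by (simp add: prod.Plus z_def)
  qed
  have "(\<Sum>t\<in>?T. (\<Prod>s\<in>?T. z t - x s) / (\<Prod>s\<in>?T - {t}. z t - z s)) = (\<Sum>t\<in>?T. z t - x t)"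
  proof (rule lagrange_sum)
    fix s t assume "s \<in> ?T" "t \<in> ?T" "s \<noteq> t" "z s = z t"
    then show "x t = z t"
      using inj coll by (auto simp: z_def x_def)
  qed simp
  also have "(\<Sum>t\<in>?T. (\<Prod>s\<in>?T. z t - x s) / (\<Prod>s\<in>?T - {t}. z t - z s)) =
      (\<Sum>i\<le>j. (\<Prod>m<j. l i + 1 - d m) * (\<Prod>m<Suc (Suc j). l i - u m) /
              ((\<Prod>m\<in>{..j} - {i}. l i - l m) * (\<Prod>m\<in>{..j} - {i}. l i + 1 - l m)))
       + (\<Sum>i\<le>j. (\<Prod>m<j. l i - d m) * (\<Prod>m<Suc (Suc j). l i - 1 - u m) /
              (- ((\<Prod>m\<in>{..j} - {i}. l i - l m) * (\<Prod>m\<in>{..j} - {i}. l i - 1 - l m))))"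
    by (simp add: sum.Plus num denl denr) (simp add: z_def)
  also have "(\<Sum>t\<in>?T. z t - x t) = (\<Sum>i\<le>j. 2 * l i - 1) - (\<Sum>m<j. d m - 1) - (\<Sum>m<Suc (Suc j). u m)"
    by (simp add: sum.Plus z_def x_def sum_subtractf sum.distrib sum_distrib_left[symmetric]
        lessThan_Suc_atMost[symmetric])
  finally show ?thesis by (simp add: sum_negf)
qed

text \<open>The form in which the weight of a word is compared with the commutator on patterns,
  where the number of letters \<open>j\<close> in the word is the deficit of row
  \<open>j\<close>.\<close>

lemma lower_weight_count:
  "lower_weight a i J = a i - 2 * int (count_list J i)
     + (if 0 < i then int (count_list J (i - 1)) else 0) + int (count_list J (Suc i))"
proof (induction J)
  case (Cons j J)
  consider "i = j" | "i = Suc j" | "j = Suc i" | "i \<noteq> j" "i \<noteq> Suc j" "j \<noteq> Suc i" by blast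
  then show ?case
  proof cases
    case 4
    then have "0 < i \<Longrightarrow> j \<noteq> i - 1" by arith
    then show ?thesis using 4 Cons.IH by (auto simp: cartan_entry_def)
  next
    case 1
    then show ?thesis using Cons.IH by (cases i) (simp_all add: cartan_entry_def)
  qed (use Cons.IH in \<open>simp_all add: cartan_entry_def\<close>)
qed simp

section \<open>Shifts of patterns and the Gelfand-Tsetlin coefficients\<close>

text \<open>Row \<open>j\<close> of a pattern has the entries \<open>L j 0, \<dots>, L j j\<close>, so the top row of a pattern for
  \<open>sl\<^sub>k\<close> is row \<open>k - 1\<close> and the simple root \<open>j\<close> acts on row \<open>j\<close>.\<close>

definition shift :: "(nat \<Rightarrow> nat \<Rightarrow> int) \<Rightarrow> nat \<Rightarrow> nat \<Rightarrow> int \<Rightarrow> nat \<Rightarrow> nat \<Rightarrow> int" where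
  "shift L j i s = L(j := (L j)(i := L j i + s))"

lemma shift_apply: "shift L j i s r m = (if r = j \<and> m = i then L j i + s else L r m)"
  by (simp add: shift_def)

lemma shift_shift_same: "shift (shift L j i s) j i t = shift L j i (s + t)"
  by (simp add: shift_def add.assoc)

lemma shift_zero [simp]: "shift L j i 0 = L"
  by (simp add: shift_def)

lemma shift_commute: "(j, i) \<noteq> (j', i') \<Longrightarrow> shift (shift L j i s) j' i' t = shift (shift L j' i' t) j i s"
  by (auto simp: shift_apply fun_eq_iff)

text \<open>Subtracting the column index makes the rows of a pattern strictly decreasing, so the
  denominators of the coefficients below are nonzero on patterns.\<close>

definition entry :: "(nat \<Rightarrow> nat \<Rightarrow> int) \<Rightarrow> nat \<Rightarrow> nat \<Rightarrow> complex" where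
  "entry L j i = of_int (L j i - int i)"

text \<open>The rational (not normalised) form of the Gelfand--Tsetlin matrix coefficients for raising and
  lowering the entry \<open>i\<close> of row \<open>j\<close>.\<close>

definition ecoef :: "(nat \<Rightarrow> nat \<Rightarrow> int) \<Rightarrow> nat \<Rightarrow> nat \<Rightarrow> complex" where
  "ecoef L j i = - (\<Prod>m<Suc (Suc j). entry L j i - entry L (Suc j) m) /
     (\<Prod>m\<in>{..j} - {i}. entry L j i - entry L j m)"

text \<open>Like \<open>ecoef\<close>, evaluated at the pattern before the move. For
  \<open>j = 0\<close> the numerator is an empty product, so the truncated \<open>j - 1\<close> does
  no harm.\<close>

definition fcoef :: "(nat \<Rightarrow> nat \<Rightarrow> int) \<Rightarrow> nat \<Rightarrow> nat \<Rightarrow> complex" where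
  "fcoef L j i = (\<Prod>m<j. entry L j i - entry L (j - 1) m) /
     (\<Prod>m\<in>{..j} - {i}. entry L j i - entry L j m)"

lemma ecoef_cong: "L j = M j \<Longrightarrow> L (Suc j) = M (Suc j) \<Longrightarrow> ecoef L j i = ecoef M j i"
  by (simp add: ecoef_def entry_def)

lemma fcoef_cong: "L j = M j \<Longrightarrow> (0 < j \<Longrightarrow> L (j - 1) = M (j - 1)) \<Longrightarrow> fcoef L j i = fcoef M j i"
  by (cases "j = 0") (simp_all add: fcoef_def entry_def)

text \<open>Two ways lead from \<open>shift L j i' 1\<close> to \<open>shift L j i 1\<close>: lower
  \<open>i'\<close> and then raise \<open>i\<close>, or the other way round. Only the denominator
  factors that join the two entries change, and
  \<open>(x - y) (y + 1 - x) = (y - x) (x - y - 1)\<close>. Comparing whole products keeps this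
  valid where a denominator is 0.\<close>

lemma coef_commute_same_row:
  assumes "i \<noteq> i'" "i \<le> j" "i' \<le> j"
  shows "ecoef L j i * fcoef (shift L j i' 1) j i' =
    fcoef (shift (shift L j i 1) j i' 1) j i' * ecoef (shift L j i' 1) j i"
proof -
  let ?x = "entry L j i" and ?y = "entry L j i'"
  have j: "j - Suc 0 \<noteq> j" using assms by auto
  define P where "P = (\<Prod>m<Suc (Suc j). ?x - entry L (Suc j) m)"
  define Q where "Q = (\<Prod>m<j. ?y + 1 - entry L (j - 1) m)"
  define R where "R = (\<Prod>m\<in>{..j} - {i} - {i'}. ?x - entry L j m)"
  define S where "S = (\<Prod>m\<in>{..j} - {i'} - {i}. ?y + 1 - entry L j m)"
  have sh: "entry (shift M r m s) r' m' = entry M r' m' + (if r' = r \<and> m' = m then of_int s else 0)"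
    for M r m s r' m'
    by (simp add: entry_def shift_apply)
  have "(\<Prod>m\<in>{..j} - {i}. ?x - entry L j m) = (?x - ?y) * R"
    unfolding R_def using assms by (subst prod.remove[of _ i']) auto
  then have 1: "ecoef L j i = - P / ((?x - ?y) * R)" by (simp add: ecoef_def P_def)
  have "(\<Prod>m\<in>{..j} - {i'}. ?y + 1 - entry (shift L j i' 1) j m) = (?y + 1 - ?x) * S"
    unfolding S_def using assms by (subst prod.remove[of _ i]) (auto simp: sh)
  then have 2: "fcoef (shift L j i' 1) j i' = Q / ((?y + 1 - ?x) * S)"
    by (simp add: fcoef_def Q_def sh j)
  have "(\<Prod>m\<in>{..j} - {i'}. ?y + 1 - entry (shift (shift L j i 1) j i' 1) j m) = (?y - ?x) * S"
    unfolding S_def using assms by (subst prod.remove[of _ i]) (auto simp: sh)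
  then have 3: "fcoef (shift (shift L j i 1) j i' 1) j i' = Q / ((?y - ?x) * S)"
    using assms by (simp add: fcoef_def Q_def sh j)
  have "(\<Prod>m\<in>{..j} - {i}. ?x - entry (shift L j i' 1) j m) = (?x - (?y + 1)) * R"
    unfolding R_def using assms by (subst prod.remove[of _ i']) (auto simp: sh)
  then have 4: "ecoef (shift L j i' 1) j i = - P / ((?x - (?y + 1)) * R)"
    using assms by (simp add: ecoef_def P_def sh)
  have "((?x - ?y) * R) * ((?y + 1 - ?x) * S) = ((?y - ?x) * S) * ((?x - (?y + 1)) * R)"
    by (simp add: algebra_simps)
  then show ?thesis unfolding 1 2 3 4 by (simp only: times_divide_times_eq mult.commute[of "- P" Q])
qed

text \<open>The same identity of four factors, now in the numerators: raising in row
  \<open>j\<close> reads row \<open>j + 1\<close>, and lowering in row \<open>j + 1\<close> reads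
  row \<open>j\<close>.\<close>

lemma coef_commute_above:
  assumes "i \<le> j" "i' \<le> Suc j"
  shows "ecoef L j i * fcoef (shift L (Suc j) i' 1) (Suc j) i' =
    fcoef (shift (shift L j i 1) (Suc j) i' 1) (Suc j) i' * ecoef (shift L (Suc j) i' 1) j i"
proof -
  let ?x = "entry L j i" and ?y = "entry L (Suc j) i'"
  have sh: "entry (shift M r m s) r' m' = entry M r' m' + (if r' = r \<and> m' = m then of_int s else 0)"
    for M r m s r' m'
    by (simp add: entry_def shift_apply)
  define P where "P = (\<Prod>m\<in>{..<Suc (Suc j)} - {i'}. ?x - entry L (Suc j) m)"
  define Q where "Q = (\<Prod>m\<in>{..<Suc j} - {i}. ?y + 1 - entry L j m)"
  define R where "R = (\<Prod>m\<in>{..j} - {i}. ?x - entry L j m)"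
  define S where "S = (\<Prod>m\<in>{..Suc j} - {i'}. ?y + 1 - entry L (Suc j) m)"
  have "(\<Prod>m<Suc (Suc j). ?x - entry L (Suc j) m) = (?x - ?y) * P"
    unfolding P_def using assms by (subst prod.remove[of _ i']) auto
  then have 1: "ecoef L j i = - ((?x - ?y) * P) / R" by (simp add: ecoef_def R_def)
  have "(\<Prod>m<Suc j. ?y + 1 - entry L j m) = (?y + 1 - ?x) * Q"
    unfolding Q_def using assms by (subst prod.remove[of _ i]) auto
  moreover have "(\<Prod>m\<in>{..Suc j} - {i'}. ?y + 1 - entry (shift L (Suc j) i' 1) (Suc j) m) = S"
    unfolding S_def by (rule prod.cong) (auto simp: sh)
  ultimately have 2: "fcoef (shift L (Suc j) i' 1) (Suc j) i' = ((?y + 1 - ?x) * Q) / S"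
    by (simp add: fcoef_def sh)
  have "(\<Prod>m<Suc j. ?y + 1 - entry (shift (shift L j i 1) (Suc j) i' 1) j m) = (?y - ?x) * Q"
    unfolding Q_def using assms by (subst prod.remove[of _ i]) (auto simp: sh)
  moreover have "(\<Prod>m\<in>{..Suc j} - {i'}. ?y + 1 - entry (shift (shift L j i 1) (Suc j) i' 1) (Suc j) m) = S"
    unfolding S_def by (rule prod.cong) (auto simp: sh)
  ultimately have 3: "fcoef (shift (shift L j i 1) (Suc j) i' 1) (Suc j) i' = ((?y - ?x) * Q) / S"
    by (simp add: fcoef_def sh)
  have "(\<Prod>m<Suc (Suc j). ?x - entry (shift L (Suc j) i' 1) (Suc j) m) = (?x - (?y + 1)) * P"
    unfolding P_def using assms by (subst prod.remove[of _ i']) (auto simp: sh)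
  then have 4: "ecoef (shift L (Suc j) i' 1) j i = - ((?x - (?y + 1)) * P) / R"
    by (simp add: ecoef_def R_def sh)
  have "- ((?x - ?y) * P) * ((?y + 1 - ?x) * Q) = ((?y - ?x) * Q) * - ((?x - (?y + 1)) * P)"
    by (simp add: algebra_simps)
  then show ?thesis unfolding 1 2 3 4 by (simp only: times_divide_times_eq mult.commute[of R S])
qed

text \<open>Raising reads rows \<open>j\<close> and \<open>j + 1\<close>, lowering reads rows
  \<open>j'\<close> and \<open>j' - 1\<close>, so the moves interact only for \<open>j' = j\<close>
  and \<open>j' = j + 1\<close>.\<close>

lemma coef_commute:
  assumes "(j, i) \<noteq> (j', i')" "i \<le> j" "i' \<le> j'"
  shows "ecoef L j i * fcoef (shift L j' i' 1) j' i' =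
    fcoef (shift (shift L j i 1) j' i' 1) j' i' * ecoef (shift L j' i' 1) j i"
proof (cases "j' = j \<or> j' = Suc j")
  case True
  then show ?thesis using coef_commute_same_row coef_commute_above assms by auto
next
  case False
  then have "ecoef (shift L j' i' 1) j i = ecoef L j i"
    by (intro ecoef_cong) (auto simp: shift_def)
  moreover have "fcoef (shift (shift L j i 1) j' i' 1) j' i' = fcoef (shift L j' i' 1) j' i'"
    using False by (intro fcoef_cong) (auto simp: shift_def)
  ultimately show ?thesis by simp
qed

section \<open>Interlacing patterns\<close>

locale gelfand_tsetlin =
  fixes n :: nat and p :: "nat \<Rightarrow> int"
  assumes p_antimono: "i \<le> j \<Longrightarrow> j \<le> n \<Longrightarrow> p j \<le> p i"
begin

text \<open>Zeros outside the triangle make each pattern a unique function, so that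
  \<open>GT\<close> is finite and its cardinality is the number of patterns.\<close>

definition GT :: "(nat \<Rightarrow> nat \<Rightarrow> int) set" where
  "GT = {L. (\<forall>j i. \<not> (i \<le> j \<and> j \<le> n) \<longrightarrow> L j i = 0) \<and> (\<forall>i\<le>n. L n i = p i) \<and>
     (\<forall>j<n. \<forall>i\<le>j. L (Suc j) (Suc i) \<le> L j i \<and> L j i \<le> L (Suc j) i)}"

lemma GT_D:
  assumes "L \<in> GT"
  shows "\<not> (i \<le> j \<and> j \<le> n) \<Longrightarrow> L j i = 0" "i \<le> n \<Longrightarrow> L n i = p i"
    "j < n \<Longrightarrow> i \<le> j \<Longrightarrow> L (Suc j) (Suc i) \<le> L j i" "j < n \<Longrightarrow> i \<le> j \<Longrightarrow> L j i \<le> L (Suc j) i"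
  using assms unfolding GT_def by blast+

lemma GT_I:
  assumes "\<And>j i. \<not> (i \<le> j \<and> j \<le> n) \<Longrightarrow> L j i = 0" "\<And>i. i \<le> n \<Longrightarrow> L n i = p i"
    "\<And>j i. j < n \<Longrightarrow> i \<le> j \<Longrightarrow> L (Suc j) (Suc i) \<le> L j i" "\<And>j i. j < n \<Longrightarrow> i \<le> j \<Longrightarrow> L j i \<le> L (Suc j) i"
  shows "L \<in> GT"
  using assms unfolding GT_def by blast

lemma row_antimono:
  assumes L: "L \<in> GT" and "j \<le> n" "i \<le> m" "m \<le> j"
  shows "L j m \<le> L j i"
proof (cases "j = n")
  case True
  then show ?thesis using GT_D(2)[OF L] p_antimono assms by simp
next
  case False
  have "\<forall>m. i \<le> m \<and> m \<le> j \<longrightarrow> L j m \<le> L j i"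
  proof (intro allI impI, elim conjE)
    fix m assume "i \<le> m" "m \<le> j"
    then show "L j m \<le> L j i"
    proof (induction m rule: dec_induct)
      case base
      then show ?case by simp
    next
      case (step m)
      have "L j (Suc m) \<le> L (Suc j) (Suc m)" "L (Suc j) (Suc m) \<le> L j m"
        using GT_D(3,4)[OF L, of j] False assms step by auto
      then show ?case using step by simp
    qed
  qed
  then show ?thesis using assms by blast
qed

lemma GT_le_p:
  assumes L: "L \<in> GT" and "i \<le> j" "j \<le> n"
  shows "L j i \<le> p i"
  using assms(3,2)
proof (induction j rule: inc_induct)
  case base
  then show ?case using GT_D(2)[OF L, of i] assms by simp
next
  case (step j)
  then show ?case using GT_D(4)[OF L, of j i] by fastforce
qed

lemma GT_ge_p:
  assumes L: "L \<in> GT" and "i \<le> j" "j \<le> n"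
  shows "p n \<le> L j i"
  using assms(3,2)
proof (induction j arbitrary: i rule: inc_induct)
  case base
  then show ?case using GT_D(2)[OF L] p_antimono by simp
next
  case (step j)
  have "p n \<le> L (Suc j) (Suc i)" using step by simp
  then show ?case using GT_D(3)[OF L, of j i] step by fastforce
qed

lemma finite_GT: "finite GT"
proof -
  \<comment> \<open>The range has to contain 0 for the entries of the square outside the
    triangle.\<close>
  let ?F = "{f. \<forall>x. (x \<in> {..n} \<times> {..n} \<longrightarrow> f x \<in> {min 0 (p n)..max 0 (p 0)}) \<and>
      (x \<notin> {..n} \<times> {..n} \<longrightarrow> f x = (0::int))}"
  have "GT \<subseteq> curry ` ?F"
  proof
    fix L assume L: "L \<in> GT"
    have "case_prod L \<in> ?F"
    proof (intro CollectI allI)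
      fix x :: "nat \<times> nat"
      obtain j i where x: "x = (j, i)" by (cases x)
      show "(x \<in> {..n} \<times> {..n} \<longrightarrow> (case x of (j, i) \<Rightarrow> L j i) \<in> {min 0 (p n)..max 0 (p 0)}) \<and>
         (x \<notin> {..n} \<times> {..n} \<longrightarrow> (case x of (j, i) \<Rightarrow> L j i) = 0)"
      proof (cases "i \<le> j \<and> j \<le> n")
        case True
        then have "p n \<le> L j i" "L j i \<le> p i" "p i \<le> p 0"
          using GT_ge_p[OF L] GT_le_p[OF L] p_antimono by auto
        then show ?thesis using True x by auto
      next
        case False
        then show ?thesis using False GT_D(1)[OF L False] x by auto
      qed
    qed
    moreover have "L = curry (case_prod L)" by (simp add: fun_eq_iff)
    ultimately show "L \<in> curry ` ?F" by blast
  qed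
  moreover have "finite ?F" by (rule finite_set_of_finite_funs) auto
  ultimately show ?thesis by (meson finite_imageI finite_subset)
qed

lemma shift_up_iff:
  assumes L: "L \<in> GT" and "j < n" "i \<le> j"
  shows "shift L j i 1 \<in> GT \<longleftrightarrow> L j i < L (Suc j) i \<and> (0 < i \<longrightarrow> L j i < L (j - 1) (i - 1))"
proof
  assume S: "shift L j i 1 \<in> GT"
  have "L j i < L (Suc j) i" using GT_D(4)[OF S assms(2,3)] by (simp add: shift_apply)
  moreover have "L j i < L (j - 1) (i - 1)" if "0 < i"
    using GT_D(3)[OF S, of "j - 1" "i - 1"] assms that
    by (cases j; cases i) (auto simp: shift_apply)
  ultimately show "L j i < L (Suc j) i \<and> (0 < i \<longrightarrow> L j i < L (j - 1) (i - 1))" by blast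
next
  assume *: "L j i < L (Suc j) i \<and> (0 < i \<longrightarrow> L j i < L (j - 1) (i - 1))"
  show "shift L j i 1 \<in> GT"
  proof (rule GT_I)
    fix r m assume r: "r < n" "m \<le> r"
    show "shift L j i 1 (Suc r) (Suc m) \<le> shift L j i 1 r m"
      using GT_D(3)[OF L r] * by (auto simp: shift_apply)
    show "shift L j i 1 r m \<le> shift L j i 1 (Suc r) m"
      using GT_D(4)[OF L r] * by (auto simp: shift_apply)
  qed (use GT_D(1,2)[OF L] assms in \<open>auto simp: shift_apply\<close>)
qed

lemma shift_down_iff:
  assumes L: "L \<in> GT" and "j < n" "i \<le> j"
  shows "shift L j i (-1) \<in> GT \<longleftrightarrow> L (Suc j) (Suc i) < L j i \<and> (i < j \<longrightarrow> L (j - 1) i < L j i)"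
proof
  assume S: "shift L j i (-1) \<in> GT"
  have "L (Suc j) (Suc i) < L j i" using GT_D(3)[OF S assms(2,3)] by (simp add: shift_apply)
  moreover have "L (j - 1) i < L j i" if "i < j"
    using GT_D(4)[OF S, of "j - 1" i] assms that
    by (cases j) (auto simp: shift_apply)
  ultimately show "L (Suc j) (Suc i) < L j i \<and> (i < j \<longrightarrow> L (j - 1) i < L j i)" by blast
next
  assume *: "L (Suc j) (Suc i) < L j i \<and> (i < j \<longrightarrow> L (j - 1) i < L j i)"
  show "shift L j i (-1) \<in> GT"
  proof (rule GT_I)
    fix r m assume r: "r < n" "m \<le> r"
    show "shift L j i (-1) (Suc r) (Suc m) \<le> shift L j i (-1) r m"
      using GT_D(3)[OF L r] * by (auto simp: shift_apply)
    show "shift L j i (-1) r m \<le> shift L j i (-1) (Suc r) m"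
      using GT_D(4)[OF L r] * r by (auto simp: shift_apply)
  qed (use GT_D(1,2)[OF L] assms in \<open>auto simp: shift_apply\<close>)
qed

text \<open>If the moves touch both sides of one inequality, its start and end versions imply the
  intermediate ones: \<open>a - 1 \<ge> b + 1\<close> gives \<open>a - 1 \<ge> b\<close> and
  \<open>a \<ge> b + 1\<close>, while \<open>a \<le> b\<close> gives \<open>a - 1 \<le> b\<close>
  and \<open>a \<le> b + 1\<close>. Hence the cut-offs agree for both orders of a raising and a
  lowering move.\<close>

lemma shift_between:
  assumes L: "L \<in> GT" and M: "shift (shift L j i (-1)) j' i' 1 \<in> GT" and "(j, i) \<noteq> (j', i')"
    and "j < n" "i \<le> j" "j' < n" "i' \<le> j'"
  shows "shift L j i (-1) \<in> GT" "shift L j' i' 1 \<in> GT"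
proof -
  show "shift L j i (-1) \<in> GT"
  proof (rule GT_I)
    fix r m assume r: "r < n" "m \<le> r"
    show "shift L j i (-1) (Suc r) (Suc m) \<le> shift L j i (-1) r m"
      using GT_D(3)[OF L r] GT_D(3)[OF M r] assms(3) by (auto simp: shift_apply split: if_splits)
    show "shift L j i (-1) r m \<le> shift L j i (-1) (Suc r) m"
      using GT_D(4)[OF L r] GT_D(4)[OF M r] assms(3) by (auto simp: shift_apply split: if_splits)
  qed (use GT_D(1,2)[OF L] assms in \<open>auto simp: shift_apply\<close>)
  show "shift L j' i' 1 \<in> GT"
  proof (rule GT_I)
    fix r m assume r: "r < n" "m \<le> r"
    show "shift L j' i' 1 (Suc r) (Suc m) \<le> shift L j' i' 1 r m"
      using GT_D(3)[OF L r] GT_D(3)[OF M r] assms(3) by (auto simp: shift_apply split: if_splits)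
    show "shift L j' i' 1 r m \<le> shift L j' i' 1 (Suc r) m"
      using GT_D(4)[OF L r] GT_D(4)[OF M r] assms(3) by (auto simp: shift_apply split: if_splits)
  qed (use GT_D(1,2)[OF L] assms in \<open>auto simp: shift_apply\<close>)
qed

text \<open>The weight of \<open>L\<close> in root coordinates: the highest weight minus the weight
  of \<open>L\<close> contains the simple root \<open>j\<close> exactly \<open>deficit L j\<close>
  times.\<close>

definition deficit :: "(nat \<Rightarrow> nat \<Rightarrow> int) \<Rightarrow> nat \<Rightarrow> int" where
  "deficit L j = (\<Sum>i\<le>j. p i - L j i)"

lemma deficit_shift:
  assumes "i \<le> j"
  shows "deficit (shift L j i s) r = deficit L r - (if r = j then s else 0)"
proof (cases "r = j")
  case True
  have "deficit (shift L j i s) j = (\<Sum>m\<le>j. (p m - L j m) - (if m = i then s else 0))"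
    unfolding deficit_def by (rule sum.cong) (auto simp: shift_apply)
  also have "\<dots> = deficit L j - s"
    using assms by (simp add: sum_subtractf deficit_def)
  finally show ?thesis using True by simp
qed (simp add: deficit_def shift_apply)

lemma deficit_nonneg: "L \<in> GT \<Longrightarrow> j \<le> n \<Longrightarrow> 0 \<le> deficit L j"
  unfolding deficit_def by (rule sum_nonneg) (simp add: GT_le_p)

text \<open>The operators act on functions on patterns, which turns a shift by \<open>+1\<close> of basis vectors into
  a shift by \<open>-1\<close> of arguments. Shifts that leave the polytope have to be cut off
  explicitly, because \<open>ecoef\<close> does not vanish on all of them.\<close>

definition raise_op :: "nat \<Rightarrow> ((nat \<Rightarrow> nat \<Rightarrow> int) \<Rightarrow> complex) \<Rightarrow> (nat \<Rightarrow> nat \<Rightarrow> int) \<Rightarrow> complex" where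
  "raise_op j c L = (if L \<in> GT then \<Sum>i\<le>j. if shift L j i (-1) \<in> GT
     then ecoef (shift L j i (-1)) j i * c (shift L j i (-1)) else 0 else 0)"

definition lower_op :: "nat \<Rightarrow> ((nat \<Rightarrow> nat \<Rightarrow> int) \<Rightarrow> complex) \<Rightarrow> (nat \<Rightarrow> nat \<Rightarrow> int) \<Rightarrow> complex" where
  "lower_op j c L = (if L \<in> GT then \<Sum>i\<le>j. if shift L j i 1 \<in> GT
     then fcoef (shift L j i 1) j i * c (shift L j i 1) else 0 else 0)"

section \<open>Commutation relations of the operators on patterns\<close>

lemma clin_raise_op: "clin (raise_op j)"
  unfolding clin_def
proof (intro conjI allI ext)
  fix x y L
  show "raise_op j (x + y) L = (raise_op j x + raise_op j y) L"
    unfolding raise_op_def plus_fun_apply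
    by (simp add: sum.distrib[symmetric] if_distrib distrib_left cong: if_cong)
next
  fix c x L
  show "raise_op j (cscale c x) L = cscale c (raise_op j x) L"
    unfolding raise_op_def cscale_apply by (simp add: sum_distrib_left if_distrib mult.left_commute cong: if_cong)
qed

lemma clin_lower_op: "clin (lower_op j)"
  unfolding clin_def
proof (intro conjI allI ext)
  fix x y L
  show "lower_op j (x + y) L = (lower_op j x + lower_op j y) L"
    unfolding lower_op_def plus_fun_apply
    by (simp add: sum.distrib[symmetric] if_distrib distrib_left cong: if_cong)
next
  fix c x L
  show "lower_op j (cscale c x) L = cscale c (lower_op j x) L"
    unfolding lower_op_def cscale_apply by (simp add: sum_distrib_left if_distrib mult.left_commute cong: if_cong)
qed

lemma entry_strict:
  assumes L: "L \<in> GT" and "j \<le> n" "s \<le> j" "t \<le> j" "entry L j s = entry L j t"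
  shows "s = t"
proof -
  have eq: "L j s - int s = L j t - int t" using assms(5) unfolding entry_def of_int_eq_iff .
  show ?thesis using row_antimono[OF L assms(2), of s t] row_antimono[OF L assms(2), of t s] eq assms
    by (cases s t rule: linorder_cases) auto
qed

lemma sum_entry: "(\<Sum>i\<le>j. entry L j i) = of_int ((\<Sum>i\<le>j. p i) - deficit L j) - of_nat (\<Sum>i\<le>j. i)"
  by (simp add: deficit_def entry_def sum_subtractf)

text \<open>Every term that is cut off would be 0 anyway, so the sums are those of
  \<open>interlacing_identity\<close>; the sign in \<open>ecoef\<close> makes their difference the
  eigenvalue of \<open>H_j\<close>.\<close>

lemma commutator_diag:
  assumes L: "L \<in> GT" and j: "j < n"
  shows "(\<Sum>i\<le>j. if shift L j i (-1) \<in> GT then ecoef (shift L j i (-1)) j i * fcoef L j i else 0)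
    - (\<Sum>i\<le>j. if shift L j i 1 \<in> GT then fcoef (shift L j i 1) j i * ecoef L j i else 0)
    = of_int (p j - p (Suc j) - 2 * deficit L j + (if 0 < j then deficit L (j - 1) else 0)
        + deficit L (Suc j))"
proof -
  let ?l = "entry L j" and ?d = "entry L (j - 1)" and ?u = "entry L (Suc j)"
  define up where "up i = (\<Prod>m<j. ?l i + 1 - ?d m) * (\<Prod>m<Suc (Suc j). ?l i - ?u m) /
              ((\<Prod>m\<in>{..j} - {i}. ?l i - ?l m) * (\<Prod>m\<in>{..j} - {i}. ?l i + 1 - ?l m))" for i
  define dn where "dn i = (\<Prod>m<j. ?l i - ?d m) * (\<Prod>m<Suc (Suc j). ?l i - 1 - ?u m) /
              ((\<Prod>m\<in>{..j} - {i}. ?l i - ?l m) * (\<Prod>m\<in>{..j} - {i}. ?l i - 1 - ?l m))" for i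
  have up: "(if shift L j i 1 \<in> GT then fcoef (shift L j i 1) j i * ecoef L j i else 0) = - up i"
    if i: "i \<le> j" for i
  proof (cases "shift L j i 1 \<in> GT")
    case True
    have "(\<Prod>m<j. entry (shift L j i 1) j i - entry (shift L j i 1) (j - 1) m) =
      (\<Prod>m<j. ?l i + 1 - ?d m)"
      by (rule prod.cong) (auto simp: entry_def shift_apply)
    moreover have "(\<Prod>m\<in>{..j} - {i}. entry (shift L j i 1) j i - entry (shift L j i 1) j m) =
      (\<Prod>m\<in>{..j} - {i}. ?l i + 1 - ?l m)"
      by (rule prod.cong) (auto simp: entry_def shift_apply)
    ultimately show ?thesis using True
      by (simp add: fcoef_def ecoef_def up_def mult.commute del: prod.lessThan_Suc)
  next
    case False
    \<comment> \<open>The entry is blocked by the row above or by the row below. In the first case a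
      factor of \<open>ecoef\<close> vanishes, in the second a factor of the shifted
      \<open>fcoef\<close>.\<close>
    then have "L j i = L (Suc j) i \<or> 0 < i \<and> L j i = L (j - 1) (i - 1)"
      using shift_up_iff[OF L j i] GT_D(4)[OF L j i] GT_D(3)[OF L, of "j - 1" "i - 1"] i j
      by fastforce
    then have "(\<exists>m<Suc (Suc j). ?l i = ?u m) \<or> (\<exists>m<j. ?l i + 1 = ?d m)"
    proof
      assume "L j i = L (Suc j) i"
      then show ?thesis using i by (auto simp: entry_def intro!: exI[of _ i])
    next
      assume *: "0 < i \<and> L j i = L (j - 1) (i - 1)"
      have "?l i + 1 = ?d (i - 1)" using * by (simp add: entry_def of_nat_diff)
      then show ?thesis using i * by (intro disjI2 exI[of _ "i - 1"]) auto
    qed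
    then have "up i = 0" by (auto simp: up_def simp del: prod.lessThan_Suc)
    then show ?thesis using False by simp
  qed
  have dn: "(if shift L j i (-1) \<in> GT then ecoef (shift L j i (-1)) j i * fcoef L j i else 0) = - dn i"
    if i: "i \<le> j" for i
  proof (cases "shift L j i (-1) \<in> GT")
    case True
    have "(\<Prod>m<Suc (Suc j). entry (shift L j i (-1)) j i - entry (shift L j i (-1)) (Suc j) m) =
      (\<Prod>m<Suc (Suc j). ?l i - 1 - ?u m)"
      by (rule prod.cong) (auto simp: entry_def shift_apply)
    moreover have "(\<Prod>m\<in>{..j} - {i}. entry (shift L j i (-1)) j i - entry (shift L j i (-1)) j m) =
      (\<Prod>m\<in>{..j} - {i}. ?l i - 1 - ?l m)"
      by (rule prod.cong) (auto simp: entry_def shift_apply)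
    ultimately show ?thesis using True
      by (simp add: fcoef_def ecoef_def dn_def mult.commute del: prod.lessThan_Suc)
  next
    case False
    then have "L j i = L (Suc j) (Suc i) \<or> i < j \<and> L j i = L (j - 1) i"
      using shift_down_iff[OF L j i] GT_D(3)[OF L j i] GT_D(4)[OF L, of "j - 1" "i"] i j
      by fastforce
    then have "(\<exists>m<Suc (Suc j). ?l i - 1 = ?u m) \<or> (\<exists>m<j. ?l i = ?d m)"
    proof
      assume "L j i = L (Suc j) (Suc i)"
      then show ?thesis using i by (auto simp: entry_def intro!: exI[of _ "Suc i"])
    next
      assume *: "i < j \<and> L j i = L (j - 1) i"
      then show ?thesis by (auto simp: entry_def)
    qed
    then have "dn i = 0" by (auto simp: dn_def simp del: prod.lessThan_Suc)
    then show ?thesis using False by simp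
  qed
  have "(\<Sum>i\<le>j. up i) - (\<Sum>i\<le>j. dn i) = (\<Sum>i\<le>j. 2 * ?l i - 1) - (\<Sum>m<j. ?d m - 1) - (\<Sum>m<Suc (Suc j). ?u m)"
    unfolding up_def dn_def
  proof (rule interlacing_identity)
    show "s = t" if "s \<le> j" "t \<le> j" "?l s = ?l t" for s t
      using entry_strict[OF L _ that] j by simp
    fix s t assume st: "s \<le> j" "t \<le> j" "?l s = ?l t - 1"
    \<comment> \<open>Shifted entries decrease strictly, so a gap of 1 forces
      \<open>s = t + 1\<close> with equal values; interlacing then squeezes the entry between them
      in each neighbouring row to the same value.\<close>
    have "of_int (L j s - int s) = (of_int (L j t - int t - 1) :: complex)"
      using st(3) by (simp add: entry_def)
    then have eq: "L j s - int s = L j t - int t - 1" unfolding of_int_eq_iff .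
    have "\<not> s \<le> t" using row_antimono[OF L _ _ st(2), of s] j eq by auto
    then have "t < s" by simp
    then have s: "s = Suc t" using row_antimono[OF L _ _ st(1), of t] j eq by auto
    then have tj: "t < j" "L j s = L j t" using st eq by auto
    have "L j s \<le> L (Suc j) s" "L (Suc j) s \<le> L j t" using GT_D(3,4)[OF L j] st s by auto
    then have u: "L (Suc j) s = L j s" using tj by simp
    have "L j (Suc t) \<le> L (j - 1) t" "L (j - 1) t \<le> L j t"
      using GT_D(3,4)[OF L, of "j - 1" t] tj j by auto
    then have d: "L (j - 1) t = L j t" using tj s by simp
    show "t < j \<and> ?u s = ?l s \<and> ?d t = ?l t" using tj(1) u d by (simp add: entry_def)
  qed
  also have "\<dots> = of_int (p j - p (Suc j) - 2 * deficit L j + (if 0 < j then deficit L (j - 1) else 0)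
        + deficit L (Suc j))"
  proof -
    have 1: "(\<Sum>i\<le>j. 2 * ?l i - 1) = 2 * (of_int ((\<Sum>i\<le>j. p i) - deficit L j) - of_nat (\<Sum>i\<le>j. i)) - of_nat (Suc j)"
      by (simp add: sum_subtractf sum_distrib_left[symmetric] sum_entry)
    have 2: "(\<Sum>m<Suc (Suc j). ?u m) = of_int ((\<Sum>i\<le>Suc j. p i) - deficit L (Suc j)) - of_nat (\<Sum>i\<le>Suc j. i)"
      unfolding lessThan_Suc_atMost by (rule sum_entry)
    have 3: "(\<Sum>m<j. ?d m - 1) = (if 0 < j then of_int ((\<Sum>i<j. p i) - deficit L (j - 1)) else 0) - of_nat (\<Sum>i<j. i) - of_nat j"
    proof (cases j)
      case (Suc j')
      show ?thesis unfolding Suc lessThan_Suc_atMost by (simp add: sum_subtractf sum_entry)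
    qed simp
    have 4: "(\<Sum>i\<le>j. p i) = (\<Sum>i<j. p i) + p j" "(\<Sum>i\<le>j. i) = (\<Sum>i<j. i) + j"
      by (simp_all add: lessThan_Suc_atMost[symmetric])
    show ?thesis unfolding 1 2 3 by (cases "j = 0") (simp_all add: 4)
  qed
  finally show ?thesis by (simp add: up dn sum_negf)
qed

text \<open>The two double sums agree term by term, except where one move undoes the other; those
  terms return to \<open>L\<close> and give \<open>commutator_diag\<close>.\<close>

lemma commutator:
  assumes L: "L \<in> GT" and j: "j < n" "j' < n"
  shows "raise_op j (lower_op j' c) L = lower_op j' (raise_op j c) L +
    (if j = j' then of_int (p j - p (Suc j) - 2 * deficit L j + (if 0 < j then deficit L (j - 1) else 0)
        + deficit L (Suc j)) * c L else 0)"
proof -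
  let ?m = "\<lambda>i. shift L j i (-1)" and ?q = "\<lambda>i'. shift L j' i' 1"
  define g where "g i i' = (if ?m i \<in> GT \<and> shift (?m i) j' i' 1 \<in> GT
      then ecoef (?m i) j i * (fcoef (shift (?m i) j' i' 1) j' i' * c (shift (?m i) j' i' 1)) else 0)" for i i'
  define h where "h i i' = (if ?q i' \<in> GT \<and> shift (?q i') j i (-1) \<in> GT
      then fcoef (?q i') j' i' * (ecoef (shift (?q i') j i (-1)) j i * c (shift (?q i') j i (-1))) else 0)" for i i'
  have lhs: "raise_op j (lower_op j' c) L = (\<Sum>i\<le>j. \<Sum>i'\<le>j'. g i i')"
    using L by (auto simp: raise_op_def lower_op_def g_def sum_distrib_left intro!: sum.cong)
  have rhs: "lower_op j' (raise_op j c) L = (\<Sum>i\<le>j. \<Sum>i'\<le>j'. h i i')"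
    using L by (subst sum.swap) (auto simp: raise_op_def lower_op_def h_def sum_distrib_left intro!: sum.cong)
  have gh: "g i i' = h i i'" if i: "i \<le> j" "i' \<le> j'" "(j, i) \<noteq> (j', i')" for i i'
  proof -
    have comm: "shift (?m i) j' i' 1 = shift (?q i') j i (-1)"
      using shift_commute[OF i(3)] .
    have inv: "shift (?m i) j i 1 = L" by (simp add: shift_shift_same)
    have "ecoef (?m i) j i * fcoef (shift (?m i) j' i' 1) j' i' =
      fcoef (?q i') j' i' * ecoef (shift (?q i') j i (-1)) j i"
      using coef_commute[OF i(3,1,2), of "?m i"] unfolding inv comm .
    moreover have "?m i \<in> GT \<and> ?q i' \<in> GT" if "shift (?q i') j i (-1) \<in> GT"
      using shift_between[OF L _ i(3) j(1) i(1) j(2) i(2)] that comm by simp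
    ultimately show ?thesis unfolding g_def h_def comm by (auto simp: mult.assoc[symmetric])
  qed
  show ?thesis
  proof (cases "j = j'")
    case False
    then have "(\<Sum>i\<le>j. \<Sum>i'\<le>j'. g i i') = (\<Sum>i\<le>j. \<Sum>i'\<le>j'. h i i')"
      by (intro sum.cong refl gh) auto
    then show ?thesis using False lhs rhs by simp
  next
    case True
    have "(\<Sum>i\<le>j. \<Sum>i'\<le>j. g i i') - (\<Sum>i\<le>j. \<Sum>i'\<le>j. h i i') = (\<Sum>i\<le>j. \<Sum>i'\<le>j. g i i' - h i i')"
      by (simp add: sum_subtractf)
    also have "\<dots> = (\<Sum>i\<le>j. \<Sum>i'\<le>j. if i' = i then g i i - h i i else 0)"
      using gh True by (intro sum.cong refl) auto
    also have "\<dots> = (\<Sum>i\<le>j. g i i) - (\<Sum>i\<le>j. h i i)"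
      by (simp add: sum_subtractf)
    also have "(\<Sum>i\<le>j. g i i) = (\<Sum>i\<le>j. if ?m i \<in> GT then ecoef (?m i) j i * fcoef L j i else 0) * c L"
      unfolding sum_distrib_right using True L
      by (intro sum.cong refl) (simp add: g_def shift_shift_same)
    also have "(\<Sum>i\<le>j. h i i) = (\<Sum>i\<le>j. if ?q i \<in> GT then fcoef (?q i) j i * ecoef L j i else 0) * c L"
      unfolding sum_distrib_right using True L
      by (intro sum.cong refl) (simp add: h_def shift_shift_same)
    finally have "(\<Sum>i\<le>j. \<Sum>i'\<le>j. g i i') - (\<Sum>i\<le>j. \<Sum>i'\<le>j. h i i') =
      of_int (p j - p (Suc j) - 2 * deficit L j + (if 0 < j then deficit L (j - 1) else 0)
        + deficit L (Suc j)) * c L"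
      unfolding True[symmetric] left_diff_distrib[symmetric] commutator_diag[OF L j(1)] .
    then show ?thesis
      using lhs rhs unfolding True[symmetric] by (simp add: diff_eq_eq add.commute del: of_int_add of_int_diff)
  qed
qed

end

section \<open>Generation by the top pattern, singular vectors and a basis of words\<close>

lemma finite_support_expansion:
  assumes "finite A" "\<And>t. t \<notin> A \<Longrightarrow> c t = 0"
  shows "c = (\<Sum>a\<in>A. cscale (c a) (\<lambda>t. if t = a then 1 else 0))"
proof
  fix t
  have "(\<Sum>a\<in>A. cscale (c a) (\<lambda>t. if t = a then 1 else 0)) t = (\<Sum>a\<in>A. if t = a then c a else 0)"
    unfolding sum_fun_apply cscale_apply by (rule sum.cong) auto
  also have "\<dots> = c t" using assms by simp
  finally show "c t = (\<Sum>a\<in>A. cscale (c a) (\<lambda>t. if t = a then 1 else 0)) t" by simp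
qed

text \<open>The words of weight highest weight minus \<open>\<kappa> j\<close> times each simple
  root \<open>j\<close>. Integer values make \<open>\<kappa>\<close> available for every weight in
  the coset; a negative value leaves no word, and likewise no pattern.\<close>

definition words :: "nat \<Rightarrow> (nat \<Rightarrow> int) \<Rightarrow> nat list set" where
  "words n \<kappa> = {J. set J \<subseteq> {..<n} \<and> (\<forall>j<n. int (count_list J j) = \<kappa> j)}"

lemma words_length: "J \<in> words n \<kappa> \<Longrightarrow> set J \<subseteq> {..<n} \<and> length J = nat (\<Sum>j<n. \<kappa> j)"
proof -
  assume J: "J \<in> words n \<kappa>"
  then have sub: "set J \<subseteq> {..<n}" by (simp add: words_def)
  have "length J = (\<Sum>j\<in>set J. count_list J j)" by (rule sum_count_set[symmetric]) auto
  also have "\<dots> = (\<Sum>j<n. count_list J j)"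
    using sub by (intro sum.mono_neutral_left) (auto simp: count_list_0_iff)
  finally have "int (length J) = (\<Sum>j<n. \<kappa> j)" using J by (simp add: words_def)
  then show ?thesis using sub by simp
qed

context gelfand_tsetlin
begin

definition top_pattern :: "nat \<Rightarrow> nat \<Rightarrow> int" where
  "top_pattern j i = (if i \<le> j \<and> j \<le> n then p i else 0)"

definition point :: "(nat \<Rightarrow> nat \<Rightarrow> int) \<Rightarrow> (nat \<Rightarrow> nat \<Rightarrow> int) \<Rightarrow> complex" where
  "point L = (\<lambda>M. if M = L then 1 else 0)"

definition GT_deficit :: "(nat \<Rightarrow> int) \<Rightarrow> (nat \<Rightarrow> nat \<Rightarrow> int) set" where
  "GT_deficit \<kappa> = {L \<in> GT. \<forall>j<n. deficit L j = \<kappa> j}"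

abbreviation word :: "nat list \<Rightarrow> (nat \<Rightarrow> nat \<Rightarrow> int) \<Rightarrow> complex" where
  "word J \<equiv> foldr lower_op J (point top_pattern)"

lemma top_pattern_GT: "top_pattern \<in> GT"
  by (rule GT_I) (use p_antimono in \<open>auto simp: top_pattern_def\<close>)

lemma deficit_top_pattern: "j \<le> n \<Longrightarrow> deficit top_pattern j = 0"
  by (simp add: deficit_def top_pattern_def)

lemma word_support:
  assumes "set J \<subseteq> {..<n}" "word J L \<noteq> 0"
  shows "L \<in> GT \<and> (\<forall>j\<le>n. deficit L j = int (count_list J j))"
  using assms
proof (induction J arbitrary: L)
  case Nil
  then show ?case
    by (auto simp: point_def top_pattern_GT deficit_top_pattern split: if_splits)
next
  case (Cons j J)
  then have L: "L \<in> GT" by (auto simp: lower_op_def split: if_splits)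
  have "\<exists>i\<le>j. shift L j i 1 \<in> GT \<and> word J (shift L j i 1) \<noteq> 0"
  proof (rule ccontr)
    assume "\<not> ?thesis"
    then have "word (j # J) L = 0" by (auto simp: lower_op_def intro!: sum.neutral)
    then show False using Cons.prems by simp
  qed
  then obtain i where i: "i \<le> j" "word J (shift L j i 1) \<noteq> 0" by blast
  have "\<forall>r\<le>n. deficit (shift L j i 1) r = int (count_list J r)"
    using Cons.IH[OF _ i(2)] Cons.prems by simp
  then show ?case using L deficit_shift[OF i(1), of L 1] by auto
qed

text \<open>Rows 0 to \<open>m\<close> form the top pattern over row \<open>m\<close>, so no entry
  in the rows below \<open>m\<close> can be raised.\<close>

definition agree :: "nat \<Rightarrow> (nat \<Rightarrow> nat \<Rightarrow> int) \<Rightarrow> bool" where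
  "agree m L \<longleftrightarrow> (\<forall>r<m. \<forall>i\<le>r. L r i = L (Suc r) i)"

lemma agree_top:
  assumes L: "L \<in> GT" and "agree n L"
  shows "L = top_pattern"
proof -
  have "L j i = p i" if "i \<le> j" "j \<le> n" for i j
    using that(2,1)
  proof (induction j rule: inc_induct)
    case base
    then show ?case using GT_D(2)[OF L] by simp
  next
    case (step j)
    then show ?case using assms(2) by (simp add: agree_def)
  qed
  then show ?thesis using GT_D(1)[OF L] by (auto simp: top_pattern_def fun_eq_iff)
qed

text \<open>Makes the action triangular: the coefficient at \<open>shift L m i 1\<close> of a raised vector involves \<open>L\<close>
  and otherwise only patterns that do not satisfy \<open>agree m\<close>. Reading the same fact for the
  lowering operators shows that the top pattern generates.\<close>

lemma agree_step:
  assumes L: "L \<in> GT" and m: "m < n" and ag: "agree m L" and nag: "\<not> agree (Suc m) L"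
  shows "\<exists>i\<le>m. shift L m i 1 \<in> GT \<and>
    (\<forall>i'\<le>m. i' \<noteq> i \<longrightarrow> \<not> agree m (shift (shift L m i 1) m i' (-1)))"
proof -
  \<comment> \<open>The first column violating equality is the leftmost entry of row
    \<open>m\<close> that falls short of the row above. In the column to its left rows
    \<open>m - 1\<close>, \<open>m\<close> and \<open>m + 1\<close> agree, which leaves room to
    raise it.\<close>
  define P where "P i \<longleftrightarrow> i \<le> m \<and> L m i \<noteq> L (Suc m) i" for i
  have "\<exists>i. P i" using ag nag unfolding agree_def P_def by (metis less_Suc_eq)
  then obtain i where i: "P i" "\<And>i'. i' < i \<Longrightarrow> \<not> P i'" using exists_least_iff[of P] by blast
  have im: "i \<le> m" using i by (simp add: P_def)
  have lt: "L m i < L (Suc m) i" using GT_D(4)[OF L m im] i by (simp add: P_def)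
  have "L m i < L (m - 1) (i - 1)" if "0 < i"
  proof -
    have "L (m - 1) (i - 1) = L m (i - 1)"
      using ag[unfolded agree_def, rule_format, of "m - 1" "i - 1"] that im by simp
    also have "\<dots> = L (Suc m) (i - 1)" using i(2)[of "i - 1"] that im by (simp add: P_def)
    also have "\<dots> \<ge> L (Suc m) i" using row_antimono[OF L, of "Suc m" "i - 1" i] m im by simp
    finally show ?thesis using lt by simp
  qed
  then have up: "shift L m i 1 \<in> GT" using shift_up_iff[OF L m im] lt by simp
  have "\<not> agree m (shift (shift L m i 1) m i' (-1))" if i': "i' \<le> m" "i' \<noteq> i" for i'
  proof
    let ?M = "shift (shift L m i 1) m i' (-1)"
    assume M: "agree m ?M"
    \<comment> \<open>Of the two distinct columns \<open>i\<close> and \<open>i'\<close> one is less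
      than \<open>m\<close>; there row \<open>m\<close> has changed and row \<open>m - 1\<close> has
      not.\<close>
    define s where "s = (if i = m then i' else i)"
    have s: "s < m" "s = i \<or> s = i'" using i' im by (auto simp: s_def)
    have "?M (m - 1) s = ?M m s" "L (m - 1) s = L m s"
      using M[unfolded agree_def, rule_format, of "m - 1" s]
        ag[unfolded agree_def, rule_format, of "m - 1" s] s(1) by simp_all
    moreover have "?M (m - 1) s = L (m - 1) s" using s by (cases m) (auto simp: shift_apply)
    moreover have "?M m s \<noteq> L m s" using s that by (auto simp: shift_apply)
    ultimately show False by simp
  qed
  then show ?thesis using im up by blast
qed

text \<open>Shifted entries are strictly separated: those of row \<open>j + 1\<close> in columns up
  to \<open>i\<close> lie above the entry, because it can be raised, and those further right lie
  below it. \<open>fcoef_nonzero\<close> is the mirror image with the row below.\<close>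

lemma ecoef_nonzero:
  assumes L: "L \<in> GT" and j: "j < n" "i \<le> j" and S: "shift L j i 1 \<in> GT"
  shows "ecoef L j i \<noteq> 0"
proof -
  have "entry L j i \<noteq> entry L (Suc j) m" if m: "m < Suc (Suc j)" for m
  proof -
    have "L j i - int i \<noteq> L (Suc j) m - int m"
    proof (cases "m \<le> i")
      case True
      have "L j i < L (Suc j) i" using shift_up_iff[OF L j] S by simp
      moreover have "L (Suc j) i \<le> L (Suc j) m" using row_antimono[OF L _ True, of "Suc j"] j by simp
      ultimately show ?thesis using True by simp
    next
      case False
      have "L (Suc j) (Suc i) \<le> L j i" using GT_D(3)[OF L j] .
      moreover have "L (Suc j) m \<le> L (Suc j) (Suc i)"
        using row_antimono[OF L, of "Suc j" "Suc i" m] j m False by simp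
      ultimately show ?thesis using False by simp
    qed
    then show ?thesis unfolding entry_def of_int_eq_iff .
  qed
  moreover have "entry L j i \<noteq> entry L j m" if "m \<le> j" "m \<noteq> i" for m
    using entry_strict[OF L, of j i m] j that by auto
  ultimately show ?thesis by (auto simp: ecoef_def simp del: prod.lessThan_Suc)
qed

lemma fcoef_nonzero:
  assumes L: "L \<in> GT" and j: "j < n" "i \<le> j" and S: "shift L j i (-1) \<in> GT"
  shows "fcoef L j i \<noteq> 0"
proof -
  have "entry L j i \<noteq> entry L (j - 1) m" if m: "m < j" for m
  proof -
    have j1: "j - 1 < n" "j - 1 \<le> n" "m \<le> j - 1" "Suc (j - 1) = j" using j m by auto
    have "L j i - int i \<noteq> L (j - 1) m - int m"
    proof (cases "i \<le> m")
      case True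
      then have "L (j - 1) i < L j i" using shift_down_iff[OF L j] S m by simp
      moreover have "L (j - 1) m \<le> L (j - 1) i" using row_antimono[OF L j1(2) True j1(3)] .
      ultimately show ?thesis using True by simp
    next
      case False
      have "L j (Suc m) \<le> L (j - 1) m" using GT_D(3)[OF L j1(1,3)] j1(4) by simp
      moreover have "L j i \<le> L j (Suc m)"
        using row_antimono[OF L, of "j" "Suc m" i] j m False by simp
      ultimately show ?thesis using False by simp
    qed
    then show ?thesis unfolding entry_def of_int_eq_iff .
  qed
  moreover have "entry L j i \<noteq> entry L j m" if "m \<le> j" "m \<noteq> i" for m
    using entry_strict[OF L, of j i m] j that by auto
  ultimately show ?thesis by (auto simp: fcoef_def)
qed

text \<open>By \<open>agree_step\<close>, the value of \<open>raise_op m c\<close> at the raised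
  pattern is a nonzero multiple of \<open>c L\<close> plus values of \<open>c\<close> at patterns
  violating \<open>agree m\<close>, which vanish by induction. At \<open>m = n\<close> only the top
  pattern is left.\<close>

lemma singular_supp:
  assumes sing: "\<And>j. j < n \<Longrightarrow> raise_op j c = 0"
  shows "m \<le> n \<Longrightarrow> L \<in> GT \<Longrightarrow> \<not> agree m L \<Longrightarrow> c L = 0"
proof (induction m arbitrary: L)
  case 0
  then show ?case by (simp add: agree_def)
next
  case (Suc m)
  show ?case
  proof (cases "agree m L")
    case False
    then show ?thesis using Suc by simp
  next
    case True
    have m: "m < n" using Suc by simp
    obtain i where i: "i \<le> m" "shift L m i 1 \<in> GT"
      "\<And>i'. i' \<le> m \<Longrightarrow> i' \<noteq> i \<Longrightarrow> \<not> agree m (shift (shift L m i 1) m i' (-1))"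
      using agree_step[OF Suc.prems(2) m True Suc.prems(3)] by blast
    let ?M = "shift L m i 1"
    have "0 = raise_op m c ?M" using sing[OF m] by (simp add: zero_fun_apply)
    also have "\<dots> = (\<Sum>i'\<le>m. if shift ?M m i' (-1) \<in> GT
        then ecoef (shift ?M m i' (-1)) m i' * c (shift ?M m i' (-1)) else 0)"
      using i(2) by (simp add: raise_op_def)
    also have "\<dots> = (\<Sum>i'\<le>m. if i' = i then ecoef L m i * c L else 0)"
    proof (rule sum.cong[OF refl])
      fix i' assume i': "i' \<in> {..m}"
      show "(if shift ?M m i' (-1) \<in> GT then ecoef (shift ?M m i' (-1)) m i' * c (shift ?M m i' (-1)) else 0)
        = (if i' = i then ecoef L m i * c L else 0)"
      proof (cases "i' = i")
        case True
        then show ?thesis using Suc.prems by (simp add: shift_shift_same)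
      next
        case False
        then have "c (shift ?M m i' (-1)) = 0" if "shift ?M m i' (-1) \<in> GT"
          using Suc.IH[OF _ that] i(3)[of i'] i' m by simp
        then show ?thesis using False by simp
      qed
    qed
    also have "\<dots> = ecoef L m i * c L" using i(1) by simp
    finally show ?thesis using ecoef_nonzero[OF Suc.prems(2) m i(1,2)] by simp
  qed
qed

lemma lower_op_point:
  assumes M: "M \<in> GT" and m: "m < n"
  shows "lower_op m (point M) = (\<Sum>i\<le>m. if shift M m i (-1) \<in> GT
    then cscale (fcoef M m i) (point (shift M m i (-1))) else 0)"
proof
  fix L
  have eq: "shift L m i 1 = M \<longleftrightarrow> L = shift M m i (-1)" for i
    by (auto simp: shift_shift_same)
  show "lower_op m (point M) L = (\<Sum>i\<le>m. if shift M m i (-1) \<in> GT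
    then cscale (fcoef M m i) (point (shift M m i (-1))) else 0) L"
  proof (cases "L \<in> GT")
    case True
    then show ?thesis
      unfolding lower_op_def sum_fun_apply using M
      by (auto simp: point_def eq fun_apply shift_shift_same intro!: sum.cong)
  next
    case False
    then show ?thesis
      unfolding lower_op_def sum_fun_apply
      by (auto simp: point_def fun_apply intro!: sum.neutral)
  qed
qed

lemma word_span_lower:
  assumes "x \<in> cfun.span (word ` words n \<kappa>)" "m < n"
  shows "lower_op m x \<in> cfun.span (word ` words n (\<kappa>(m := \<kappa> m + 1)))"
proof (rule clin_span[OF clin_lower_op assms(1)])
  fix s assume "s \<in> word ` words n \<kappa>"
  then obtain J where J: "J \<in> words n \<kappa>" "s = word J" by blast
  then have "m # J \<in> words n (\<kappa>(m := \<kappa> m + 1))" using assms(2) by (auto simp: words_def)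
  moreover have "lower_op m s = word (m # J)" using J by simp
  ultimately show "lower_op m s \<in> cfun.span (word ` words n (\<kappa>(m := \<kappa> m + 1)))"
    by (metis cfun.span_base imageI)
qed

lemma words_cong: "(\<And>j. j < n \<Longrightarrow> \<kappa> j = \<kappa>' j) \<Longrightarrow> words n \<kappa> = words n \<kappa>'"
  by (auto simp: words_def)

text \<open>The same triangularity for lowering: \<open>lower_op m\<close> sends the point at the
  raised pattern, whose total deficit is smaller, to a nonzero multiple of the given point plus
  points violating \<open>agree m\<close>.\<close>

lemma point_in_span:
  assumes "L \<in> GT"
  shows "point L \<in> cfun.span (word ` words n (deficit L))"
  using assms
proof (induction "nat (\<Sum>j<n. deficit L j)" arbitrary: L rule: less_induct)
  case (less L)
  note L = less.prems
  \<comment> \<open>The remaining points have the same deficits as \<open>L\<close>, out of reach of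
    the outer induction; an inner induction on the row handles them.\<close>
  have main: "m \<le> n \<Longrightarrow> M \<in> GT \<Longrightarrow> (\<forall>j. deficit M j = deficit L j) \<Longrightarrow> \<not> agree m M \<Longrightarrow>
     point M \<in> cfun.span (word ` words n (deficit L))" for m M
  proof (induction m arbitrary: M)
    case 0
    then show ?case by (simp add: agree_def)
  next
    case (Suc m)
    note M = Suc.prems(2)
    show ?case
    proof (cases "agree m M")
      case False
      then show ?thesis using Suc by simp
    next
      case True
      have m: "m < n" using Suc by simp
      obtain i where i: "i \<le> m" "shift M m i 1 \<in> GT"
        "\<And>i'. i' \<le> m \<Longrightarrow> i' \<noteq> i \<Longrightarrow> \<not> agree m (shift (shift M m i 1) m i' (-1))"
        using agree_step[OF Suc.prems(2) m True Suc.prems(4)] by blast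
      let ?M = "shift M m i 1"
      have def_M: "deficit ?M r = deficit L r - (if r = m then 1 else 0)" for r
        using deficit_shift[OF i(1), of M 1 r] Suc.prems(3) by simp
      have "(\<Sum>j<n. deficit ?M j) = (\<Sum>j<n. deficit L j) - 1"
        using m by (simp add: def_M sum_subtractf)
      moreover have "0 \<le> (\<Sum>j<n. deficit ?M j)"
        by (intro sum_nonneg deficit_nonneg i(2)) auto
      ultimately have "nat (\<Sum>j<n. deficit ?M j) < nat (\<Sum>j<n. deficit L j)" by simp
      then have "point ?M \<in> cfun.span (word ` words n (deficit ?M))"
        using less.hyps i(2) by blast
      then have "lower_op m (point ?M) \<in>
          cfun.span (word ` words n ((deficit ?M)(m := deficit ?M m + 1)))"
        using word_span_lower m by blast
      moreover have "words n ((deficit ?M)(m := deficit ?M m + 1)) = words n (deficit L)"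
        by (rule words_cong) (simp add: def_M)
      ultimately have low: "lower_op m (point ?M) \<in> cfun.span (word ` words n (deficit L))" by simp
      define R where "R = (\<Sum>i'\<in>{..m} - {i}. if shift ?M m i' (-1) \<in> GT
        then cscale (fcoef ?M m i') (point (shift ?M m i' (-1))) else 0)"
      have R: "R \<in> cfun.span (word ` words n (deficit L))"
        unfolding R_def
      proof (rule cfun.span_sum)
        fix i' assume i': "i' \<in> {..m} - {i}"
        let ?Q = "shift ?M m i' (-1)"
        have "point ?Q \<in> cfun.span (word ` words n (deficit L))" if "?Q \<in> GT"
        proof (rule Suc.IH[OF _ that])
          show "\<forall>j. deficit ?Q j = deficit L j"
            using deficit_shift[of i' m ?M "-1"] i' def_M by simp
        qed (use m i i' in auto)
        then show "(if ?Q \<in> GT then cscale (fcoef ?M m i') (point ?Q) else 0)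
          \<in> cfun.span (word ` words n (deficit L))"
          by (simp add: cfun.span_scale cfun.span_zero)
      qed
      have inv: "shift ?M m i (-1) = M" by (simp add: shift_shift_same)
      have nz: "fcoef ?M m i \<noteq> 0" using fcoef_nonzero[OF i(2) m i(1)] M inv by simp
      have "lower_op m (point ?M) = cscale (fcoef ?M m i) (point M) + R"
        unfolding lower_op_point[OF i(2) m] R_def using i(1) M
        by (subst sum.remove[of _ i]) (auto simp: inv)
      then have "cscale (fcoef ?M m i) (point M) = lower_op m (point ?M) - R" by simp
      then have "cscale (fcoef ?M m i) (point M) \<in> cfun.span (word ` words n (deficit L))"
        using low R cfun.span_diff by simp
      then have "cscale (1 / fcoef ?M m i) (cscale (fcoef ?M m i) (point M))
          \<in> cfun.span (word ` words n (deficit L))"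
        by (rule cfun.span_scale)
      then show ?thesis using nz by simp
    qed
  qed
  show ?case
  proof (cases "agree n L")
    case True
    then have eq: "L = top_pattern" using agree_top[OF L] by simp
    then have "[] \<in> words n (deficit L)" by (simp add: words_def deficit_top_pattern)
    then have "word [] \<in> cfun.span (word ` words n (deficit L))" by (intro cfun.span_base imageI)
    then show ?thesis unfolding eq by simp
  next
    case False
    then show ?thesis using main[of n L] L by simp
  qed
qed

lemma hw_module_GT: "hw_module n (\<lambda>i. p i - p (Suc i)) raise_op lower_op (point top_pattern)"
proof
  show "clin (raise_op i)" "clin (lower_op i)" for i
    by (rule clin_raise_op clin_lower_op)+
  show "point top_pattern \<noteq> 0"
    by (auto simp: point_def fun_eq_iff zero_fun_apply)
  show "raise_op i (point top_pattern) = 0" if i: "i < n" for i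
  proof
    fix L
    have "shift L i m (-1) \<noteq> top_pattern" if "L \<in> GT" "m \<le> i" for m
    proof
      assume "shift L i m (-1) = top_pattern"
      then have "deficit (shift L i m (-1)) i = 0" using deficit_top_pattern i by simp
      then have "deficit L i = -1" using deficit_shift[OF that(2), of L "-1" i] by simp
      then show False using deficit_nonneg[OF that(1), of i] i by simp
    qed
    then show "raise_op i (point top_pattern) L = 0 L"
      by (auto simp: raise_op_def point_def zero_fun_apply intro!: sum.neutral)
  qed
  show "raise_op i (lower_op j (word J)) = lower_op j (raise_op i (word J)) +
        (if i = j then cscale (of_int (lower_weight (\<lambda>i. p i - p (Suc i)) i J)) (word J) else 0)"
    if i: "i < n" "j < n" and J: "set J \<subseteq> {..<n}" for i j J
  proof
    fix L
    show "raise_op i (lower_op j (word J)) L = (lower_op j (raise_op i (word J)) +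
        (if i = j then cscale (of_int (lower_weight (\<lambda>i. p i - p (Suc i)) i J)) (word J) else 0)) L"
    proof (cases "L \<in> GT")
      case True
      \<comment> \<open>On the support of a word the deficits are the letter counts, so the
        pattern-dependent scalar of \<open>commutator\<close> becomes the constant
        \<open>lower_weight\<close>.\<close>
      have "of_int (p i - p (Suc i) - 2 * deficit L i + (if 0 < i then deficit L (i - 1) else 0)
          + deficit L (Suc i)) * word J L
        = of_int (lower_weight (\<lambda>i. p i - p (Suc i)) i J) * word J L"
      proof (cases "word J L = 0")
        case False
        then show ?thesis using word_support[OF J False] i by (simp add: lower_weight_count)
      qed simp
      then show ?thesis
        unfolding plus_fun_apply commutator[OF True i, of "word J"]
        by (cases "i = j") (simp_all only: if_True if_False cscale_apply zero_fun_apply simp_thms)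
    next
      case False
      then have "word J L = 0" using word_support[OF J] by blast
      then show ?thesis using False by (simp add: fun_apply raise_op_def lower_op_def)
    qed
  qed
  show "x = 0" if m: "0 < m" and x: "x \<in> cfun.span {word J |J. set J \<subseteq> {..<n} \<and> length J = m}"
    and sing: "\<And>i. i < n \<Longrightarrow> raise_op i x = 0" for m x
  proof -
    \<comment> \<open>A word of positive length vanishes at the top pattern, whose deficits are 0;
      at the other patterns \<open>singular_supp\<close> will apply.\<close>
    have supp: "(\<forall>L. L \<notin> GT \<longrightarrow> x L = 0) \<and> x top_pattern = 0" using x
    proof (induction rule: cfun.span_induct_alt)
      case base
      then show ?case by (simp add: zero_fun_apply)
    next
      case (step c s y)
      then obtain J where J: "s = word J" "set J \<subseteq> {..<n}" "length J = m" by blast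
      then obtain j where "j \<in> set J" using m by (cases J) auto
      then have "count_list J j \<noteq> 0" "j \<le> n" using J by (auto simp: count_list_0_iff)
      then have "s top_pattern = 0" using word_support[OF J(2), of top_pattern] J deficit_top_pattern by fastforce
      moreover have "\<forall>L. L \<notin> GT \<longrightarrow> s L = 0" using word_support[OF J(2)] J by blast
      ultimately show ?case using step by (simp add: fun_apply)
    qed
    show "x = 0"
    proof
      fix L
      show "x L = 0 L"
      proof (cases "L \<in> GT \<and> L \<noteq> top_pattern")
        case True
        then have "\<not> agree n L" using agree_top by blast
        then show ?thesis using singular_supp[of x n L] sing True by (simp add: zero_fun_apply)
      next
        case False
        then show ?thesis using supp by (auto simp: zero_fun_apply)
      qed
    qed
  qed
qed

text \<open>By \<open>word_support\<close> and \<open>point_in_span\<close> the words span the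
  functions supported on \<open>GT_deficit \<kappa>\<close>, so a basis can be picked among them. It
  is described by relations between words because these are what \<open>same_relations\<close>
  transports.\<close>

lemma word_basis:
  obtains S where "finite S" "S \<subseteq> words n \<kappa>" "card S = card (GT_deficit \<kappa>)"
    "\<And>r. (\<Sum>J\<in>S. cscale (r J) (word J)) = 0 \<Longrightarrow> \<forall>J\<in>S. r J = 0"
    "\<And>K. K \<in> words n \<kappa> \<Longrightarrow> \<exists>r. word K = (\<Sum>J\<in>S. cscale (r J) (word J))"
proof -
  let ?W = "word ` words n \<kappa>" and ?P = "point ` GT_deficit \<kappa>"
  have finP: "finite (GT_deficit \<kappa>)" using finite_GT by (auto simp: GT_deficit_def)
  have "cfun.span ?W = cfun.span ?P"
  proof (rule antisym)
    show "cfun.span ?W \<subseteq> cfun.span ?P"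
    proof (rule cfun.span_minimal)
      show "?W \<subseteq> cfun.span ?P"
      proof
        fix x assume "x \<in> ?W"
        then obtain J where J: "J \<in> words n \<kappa>" "x = word J" by blast
        have "x L = 0" if "L \<notin> GT_deficit \<kappa>" for L
        proof (rule ccontr)
          assume "x L \<noteq> 0"
          then have "L \<in> GT \<and> (\<forall>j\<le>n. deficit L j = int (count_list J j))"
            using word_support[of J L] J by (simp add: words_def)
          then show False using that J by (auto simp: words_def GT_deficit_def less_imp_le)
        qed
        then have "x = (\<Sum>a\<in>GT_deficit \<kappa>. cscale (x a) (point a))"
          unfolding point_def by (rule finite_support_expansion[OF finP])
        moreover have "(\<Sum>a\<in>GT_deficit \<kappa>. cscale (x a) (point a)) \<in> cfun.span ?P"
          by (intro cfun.span_sum cfun.span_scale cfun.span_base) auto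
        ultimately show "x \<in> cfun.span ?P" by simp
      qed
    qed (rule cfun.subspace_span)
    show "cfun.span ?P \<subseteq> cfun.span ?W"
    proof (rule cfun.span_minimal)
      show "?P \<subseteq> cfun.span ?W"
      proof
        fix x assume "x \<in> ?P"
        then obtain L where L: "L \<in> GT" "\<forall>j<n. deficit L j = \<kappa> j" "x = point L"
          by (auto simp: GT_deficit_def)
        then have "words n (deficit L) = words n \<kappa>" by (intro words_cong) simp
        then show "x \<in> cfun.span ?W" using point_in_span[OF L(1)] L(3) by simp
      qed
    qed (rule cfun.subspace_span)
  qed
  moreover have "cfun.independent ?P"
  proof (rule cfun.independent_if_scalars_zero)
    show "finite ?P" using finP by simp
    fix r x assume sum: "(\<Sum>x\<in>?P. cscale (r x) x) = 0" and x: "x \<in> ?P"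
    have inj: "inj_on point (GT_deficit \<kappa>)" by (auto simp: inj_on_def point_def fun_eq_iff split: if_splits)
    obtain L where L: "L \<in> GT_deficit \<kappa>" "x = point L" using x by blast
    have "0 = (\<Sum>x\<in>?P. cscale (r x) x) L" using sum by (simp add: zero_fun_apply)
    also have "\<dots> = (\<Sum>M\<in>GT_deficit \<kappa>. r (point M) * point M L)"
      unfolding sum.reindex[OF inj] sum_fun_apply by (simp add: cscale_apply)
    also have "\<dots> = (\<Sum>M\<in>GT_deficit \<kappa>. if L = M then r (point L) else 0)"
      by (rule sum.cong) (auto simp: point_def)
    also have "\<dots> = r x" using finP L by simp
    finally show "r x = 0" by simp
  qed
  moreover have "card ?P = card (GT_deficit \<kappa>)"
    by (rule card_image) (auto simp: inj_on_def point_def fun_eq_iff split: if_splits)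
  moreover obtain B where B: "B \<subseteq> ?W" "cfun.independent B" "?W \<subseteq> cfun.span B"
    using cfun.maximal_independent_subset by blast
  ultimately have spanB: "cfun.span B = cfun.span ?P"
    using cfun.span_mono[OF B(1)] cfun.span_minimal[OF B(3)] by auto
  have finB: "finite B"
    using cfun.independent_span_bound[of ?P B] B(2) spanB finP cfun.span_superset by auto
  have cardB: "card B = card (GT_deficit \<kappa>)"
    using cfun.dim_eq_card[OF spanB B(2)] cfun.dim_eq_card[OF refl \<open>cfun.independent ?P\<close>]
      \<open>card ?P = card (GT_deficit \<kappa>)\<close> by simp
  \<comment> \<open>One word for each basis vector, so that \<open>word\<close> is injective on
    \<open>S\<close>.\<close>
  define S where "S = inv_into (words n \<kappa>) word ` B"
  have wi: "word (inv_into (words n \<kappa>) word b) = b" if "b \<in> B" for b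
    using f_inv_into_f[OF subsetD[OF B(1) that]] .
  have injS: "inj_on word S" unfolding S_def by (intro inj_onI) (auto simp: wi)
  have imS: "word ` S = B" unfolding S_def image_image using wi by simp
  have cardS: "card S = card B" using card_image[OF injS] imS by simp
  have toS: "(\<Sum>J\<in>S. cscale (r (word J)) (word J)) = (\<Sum>b\<in>B. cscale (r b) b)" for r
    using sum.reindex[OF injS, of "\<lambda>b. cscale (r b) b"] imS by simp
  show ?thesis
  proof
    show "finite S" using finB by (simp add: S_def)
    show "S \<subseteq> words n \<kappa>" using B(1) by (auto simp: S_def intro!: inv_into_into)
    show "card S = card (GT_deficit \<kappa>)" using cardS cardB by simp
    show "\<forall>J\<in>S. r J = 0" if z: "(\<Sum>J\<in>S. cscale (r J) (word J)) = 0" for r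
    proof
      fix J assume J: "J \<in> S"
      define r' where "r' b = r (inv_into S word b)" for b
      have r': "r' (word J) = r J" if "J \<in> S" for J by (simp add: r'_def inv_into_f_f[OF injS that])
      have "(\<Sum>b\<in>B. cscale (r' b) b) = 0"
        unfolding toS[symmetric] using z r' by simp
      then have "r' (word J) = 0"
        using cfun.independentD[OF B(2) finB order.refl] J imS by blast
      then show "r J = 0" using r' J by simp
    qed
    show "\<exists>r. word K = (\<Sum>J\<in>S. cscale (r J) (word J))" if "K \<in> words n \<kappa>" for K
    proof -
      have "word K \<in> cfun.span B" using B(3) that by blast
      then obtain r where "word K = (\<Sum>b\<in>B. cscale (r b) b)"
        using cfun.span_finite[OF finB] by auto
      then show ?thesis using toS[of r] by (intro exI[of _ "\<lambda>J. r (word J)"]) simp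
    qed
  qed
qed

end

section \<open>Irreducible representations of \<open>sl\<^sub>k\<close>\<close>

text \<open>Interface to \<open>vectorspace.dim\<close>: span and independence are given by
  coordinates, so that facts about functions can be supplied.\<close>

lemma dim_eq_card:
  fixes B W :: "complex vec set"
  assumes finB: "finite B" and B: "B \<subseteq> carrier_vec N"
    and W: "\<And>w. w \<in> W \<longleftrightarrow> w \<in> carrier_vec N \<and> (\<exists>a. \<forall>i<N. w $ i = (\<Sum>b\<in>B. a b * b $ i))"
    and ind: "\<And>a. (\<forall>i<N. (\<Sum>b\<in>B. a b * b $ i) = 0) \<Longrightarrow> \<forall>b\<in>B. a b = 0"
  shows "vectorspace.dim class_ring ((module_vec TYPE(complex) N)\<lparr>carrier := W\<rparr>) = card B"
proof -
  interpret vec_space "TYPE(complex)" N .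
  have lc: "lincomb a B $ i = (\<Sum>b\<in>B. a b * b $ i)" if "i < N" for a i
    using lincomb_index[OF that B] .
  have lcd: "lincomb a B \<in> carrier_vec N" for a
    using lincomb_closed[of B a] B by simp
  have span: "span B = W"
  proof
    show "span B \<subseteq> W"
    proof
      fix w assume "w \<in> span B"
      then obtain a where "w = lincomb a B" using finite_span[OF finB] B by auto
      then show "w \<in> W" unfolding W using lc lcd by auto
    qed
    show "W \<subseteq> span B"
    proof
      fix w assume "w \<in> W"
      then obtain a where w: "w \<in> carrier_vec N" "\<forall>i<N. w $ i = (\<Sum>b\<in>B. a b * b $ i)"
        unfolding W by blast
      then have "w = lincomb a B" using lc lincomb_dim[OF finB B] by (intro eq_vecI) auto
      then show "w \<in> span B" using finite_span[OF finB] B by auto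
    qed
  qed
  have indep: "lin_indpt B"
  proof (rule finite_lin_indpt2[OF finB])
    fix a assume a: "lincomb a B = 0\<^sub>v N"
    have "(\<Sum>b\<in>B. a b * b $ i) = 0" if "i < N" for i
      using lc[OF that, of a] a that by simp
    then show "\<forall>v\<in>B. a v = 0" using ind by simp
  qed (use B in auto)
  have sm: "submodule class_ring W V"
    using span_is_submodule[of B] B unfolding span by simp
  have BW: "B \<subseteq> W" using in_own_span[of B] B span by simp
  have vs: "vectorspace class_ring (V\<lparr>carrier := W\<rparr>)"
    using subspace_is_vs[of W] sm by (simp add: VectorSpace.subspace_def vectorspace_axioms)
  have "LinearCombinations.module.span class_ring (V\<lparr>carrier := W\<rparr>) B = W"
    "\<not> LinearCombinations.module.lin_dep class_ring (V\<lparr>carrier := W\<rparr>) B"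
    using span_li_not_depend[OF BW sm] span indep by auto
  then have "vectorspace.basis class_ring (V\<lparr>carrier := W\<rparr>) B"
    unfolding vectorspace.basis_def[OF vs] using BW by simp
  then show ?thesis using vectorspace.dim_basis[OF vs finB] by simp
qed

section \<open>Vectors as functions and matrices as operators on them\<close>

text \<open>Vectors of length \<open>N\<close> become functions that vanish from \<open>N\<close> on, so that the results on
  spaces of functions apply.\<close>

definition vfun :: "nat \<Rightarrow> complex vec \<Rightarrow> nat \<Rightarrow> complex" where
  "vfun N v = (\<lambda>i. if i < N then v $ i else 0)"

definition mop :: "nat \<Rightarrow> complex mat \<Rightarrow> (nat \<Rightarrow> complex) \<Rightarrow> nat \<Rightarrow> complex" where
  "mop N M x = vfun N (M *\<^sub>v vec N x)"

lemma vec_vfun [simp]: "v \<in> carrier_vec N \<Longrightarrow> vec N (vfun N v) = v"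
  by (intro eq_vecI) (auto simp: vfun_def)

lemma vfun_vec: "(\<And>i. N \<le> i \<Longrightarrow> x i = 0) \<Longrightarrow> vfun N (vec N x) = x"
  by (auto simp: vfun_def fun_eq_iff)

lemma vfun_inject: "u \<in> carrier_vec N \<Longrightarrow> v \<in> carrier_vec N \<Longrightarrow> vfun N u = vfun N v \<longleftrightarrow> u = v"
  using vec_vfun by metis

lemma vfun_add: "u \<in> carrier_vec N \<Longrightarrow> v \<in> carrier_vec N \<Longrightarrow> vfun N (u + v) = vfun N u + vfun N v"
  by (auto simp: vfun_def fun_eq_iff fun_apply)

lemma vfun_smult: "u \<in> carrier_vec N \<Longrightarrow> vfun N (c \<cdot>\<^sub>v u) = cscale c (vfun N u)"
  by (auto simp: vfun_def fun_eq_iff fun_apply)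

lemma vfun_zero: "vfun N (0\<^sub>v N) = 0"
  by (auto simp: vfun_def fun_eq_iff fun_apply)

lemma vfun_supp: "N \<le> i \<Longrightarrow> vfun N v i = 0"
  by (simp add: vfun_def)

lemma vec_add_fun: "vec N (x + y) = vec N x + vec N (y :: nat \<Rightarrow> complex)"
  by (intro eq_vecI) (auto simp: fun_apply)

lemma vec_cscale: "vec N (cscale c x) = c \<cdot>\<^sub>v vec N x"
  by (intro eq_vecI) (auto simp: fun_apply)

lemma clin_mop: "M \<in> carrier_mat N N \<Longrightarrow> clin (mop N M)"
  unfolding clin_def mop_def vec_add_fun vec_cscale
  by (simp add: mult_add_distrib_mat_vec mult_mat_vec vfun_add[symmetric] vfun_smult[symmetric])

lemma mop_vfun: "v \<in> carrier_vec N \<Longrightarrow> mop N M (vfun N v) = vfun N (M *\<^sub>v v)"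
  by (simp add: mop_def)

lemma mop_add:
  "A \<in> carrier_mat N N \<Longrightarrow> B \<in> carrier_mat N N \<Longrightarrow> mop N (A + B) x = mop N A x + mop N B x"
  by (simp add: mop_def add_mult_distrib_mat_vec[of _ N N] vfun_add[symmetric])

lemma mop_smult: "A \<in> carrier_mat N N \<Longrightarrow> mop N (c \<cdot>\<^sub>m A) x = cscale c (mop N A x)"
  unfolding mop_def
  by (subst vfun_smult[symmetric, of _ N]) (auto intro!: arg_cong[where f = "vfun N"])

lemma mop_mult:
  "A \<in> carrier_mat N N \<Longrightarrow> B \<in> carrier_mat N N \<Longrightarrow> mop N (A * B) x = mop N A (mop N B x)"
  by (simp add: mop_def assoc_mult_mat_vec[of _ N N _ N])

lemma mop_diff:
  assumes "A \<in> carrier_mat N N" "B \<in> carrier_mat N N"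
  shows "mop N (A - B) x = mop N A x - mop N B x"
proof -
  have "mop N A x = mop N (A - B + B) x"
    using assms by (intro arg_cong2[where f = "mop N"] eq_matI) auto
  also have "\<dots> = mop N (A - B) x + mop N B x"
    using assms by (intro mop_add) (simp_all add: minus_carrier_mat)
  finally show ?thesis by simp
qed

lemma mop_supp: "N \<le> i \<Longrightarrow> mop N A x i = 0"
  by (simp add: mop_def vfun_supp)

section \<open>Elementary and diagonal matrices\<close>

lemma elem_mat_mult:
  assumes "j < k" "a < k"
  shows "elem_mat k i j * elem_mat k a b = (if j = a then elem_mat k i b else 0\<^sub>m k k)"
proof (rule eq_matI)
  fix r s assume rs: "r < dim_row (if j = a then elem_mat k i b else 0\<^sub>m k k)"
    "s < dim_col (if j = a then elem_mat k i b else 0\<^sub>m k k)"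
  then have rs: "r < k" "s < k" by (auto simp: elem_mat_def split: if_splits)
  have "(elem_mat k i j * elem_mat k a b) $$ (r, s) =
    (\<Sum>c = 0..<k. (if r = i \<and> c = j then 1 else 0) * (if c = a \<and> s = b then 1 else 0))"
    using rs by (simp add: elem_mat_def scalar_prod_def)
  also have "\<dots> = (\<Sum>c = 0..<k. if c = j then (if r = i \<and> a = j \<and> s = b then 1 else 0) else 0)"
    by (rule sum.cong) auto
  also have "\<dots> = (if j = a then elem_mat k i b else 0\<^sub>m k k) $$ (r, s)"
    using assms rs by (auto simp: elem_mat_def)
  finally show "(elem_mat k i j * elem_mat k a b) $$ (r, s) =
    (if j = a then elem_mat k i b else 0\<^sub>m k k) $$ (r, s)" .
qed (auto simp: elem_mat_def)

lemma elem_mat_sl: "i \<noteq> j \<Longrightarrow> elem_mat k i j \<in> sl k"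
  by (auto simp: sl_def elem_mat_def intro!: sum.neutral)

definition dmat :: "nat \<Rightarrow> (nat \<Rightarrow> complex) \<Rightarrow> complex mat" where
  "dmat k h = mat k k (\<lambda>(i, j). if i = j then h i else 0)"

lemma dmat_cartan: "(\<Sum>i<k. h i) = 0 \<Longrightarrow> dmat k h \<in> cartan k"
  by (simp add: dmat_def cartan_def sl_def diagonal_mat_def)

lemma cartan_dmat:
  assumes "H \<in> cartan k"
  shows "H = dmat k (\<lambda>i. H $$ (i, i))"
  using assms by (intro eq_matI) (auto simp: dmat_def cartan_def sl_def diagonal_mat_def)

lemma cartan_sl: "H \<in> cartan k \<Longrightarrow> H \<in> sl k"
  by (simp add: cartan_def)

lemma dmat_elem_mat_comm:
  assumes "i < k" "j < k"
  shows "dmat k h * elem_mat k i j - elem_mat k i j * dmat k h = (h i - h j) \<cdot>\<^sub>m elem_mat k i j"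
proof (rule eq_matI)
  fix r s assume "r < dim_row ((h i - h j) \<cdot>\<^sub>m elem_mat k i j)" "s < dim_col ((h i - h j) \<cdot>\<^sub>m elem_mat k i j)"
  then have rs: "r < k" "s < k" by (simp_all add: elem_mat_def)
  have "(dmat k h * elem_mat k i j) $$ (r, s) =
      (\<Sum>c = 0..<k. (if r = c then h r else 0) * (if c = i \<and> s = j then 1 else 0))"
    using rs by (simp add: elem_mat_def dmat_def scalar_prod_def)
  also have "\<dots> = (\<Sum>c = 0..<k. if c = r then (if r = i \<and> s = j then h i else 0) else 0)"
    by (rule sum.cong) auto
  finally have 1: "(dmat k h * elem_mat k i j) $$ (r, s) = (if r = i \<and> s = j then h i else 0)"
    using rs by simp
  have "(elem_mat k i j * dmat k h) $$ (r, s) =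
      (\<Sum>c = 0..<k. (if r = i \<and> c = j then 1 else 0) * (if c = s then h c else 0))"
    using rs by (simp add: elem_mat_def dmat_def scalar_prod_def)
  also have "\<dots> = (\<Sum>c = 0..<k. if c = s then (if r = i \<and> s = j then h j else 0) else 0)"
    by (rule sum.cong) auto
  finally have 2: "(elem_mat k i j * dmat k h) $$ (r, s) = (if r = i \<and> s = j then h j else 0)"
    using rs by simp
  from 1 2 show "(dmat k h * elem_mat k i j - elem_mat k i j * dmat k h) $$ (r, s) =
      ((h i - h j) \<cdot>\<^sub>m elem_mat k i j) $$ (r, s)"
    using rs assms by (auto simp: elem_mat_def dmat_def)
qed (auto simp: elem_mat_def dmat_def)

text \<open>Characters here belong to indices. A vector may have several indices, and the zero
  vector even different characters, so one index is chosen for each vector before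
  \<open>eigenvector_in_span\<close> applies.\<close>

lemma eigenvector_in_span_image:
  fixes z :: "'a \<Rightarrow> complex"
  assumes z: "z \<in> cfun.span (u ` I)" and lin: "\<And>h. h \<in> H \<Longrightarrow> clin (D h)"
    and eig: "\<And>j h. j \<in> I \<Longrightarrow> h \<in> H \<Longrightarrow> D h (u j) = cscale (\<chi> j h) (u j)"
    and zeig: "\<And>h. h \<in> H \<Longrightarrow> D h z = cscale (\<chi>0 h) z"
  shows "z \<in> cfun.span (u ` {j \<in> I. \<forall>h\<in>H. \<chi> j h = \<chi>0 h})"
proof -
  define g where "g = inv_into I u"
  have g: "g s \<in> I" "u (g s) = s" if "s \<in> u ` I" for s
    using that by (auto simp: g_def inv_into_into f_inv_into_f)
  have "z \<in> cfun.span {s \<in> u ` I. \<forall>h\<in>H. \<chi> (g s) h = \<chi>0 h}"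
  proof (rule eigenvector_in_span[where D = D and H = H, OF z lin _ zeig])
    fix s h assume "s \<in> u ` I" "h \<in> H"
    then show "D h s = cscale (\<chi> (g s) h) s" using eig[of "g s" h] g[of s] by simp
  qed
  moreover have "{s \<in> u ` I. \<forall>h\<in>H. \<chi> (g s) h = \<chi>0 h} \<subseteq> u ` {j \<in> I. \<forall>h\<in>H. \<chi> j h = \<chi>0 h}"
  proof
    fix s assume s: "s \<in> {s \<in> u ` I. \<forall>h\<in>H. \<chi> (g s) h = \<chi>0 h}"
    then have "g s \<in> {j \<in> I. \<forall>h\<in>H. \<chi> j h = \<chi>0 h}" "s = u (g s)" using g[of s] by auto
    then show "s \<in> u ` {j \<in> I. \<forall>h\<in>H. \<chi> j h = \<chi>0 h}" by (rule rev_image_eqI)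
  qed
  ultimately show ?thesis using cfun.span_mono by blast
qed

lemma eigen_on_span:
  assumes "clin g" "x \<in> cfun.span S" "\<And>s. s \<in> S \<Longrightarrow> g s = cscale c s"
  shows "g x = cscale c x"
  using assms(2)
proof (induction rule: cfun.span_induct_alt)
  case base
  then show ?case by (simp add: clin_zero[OF assms(1)])
next
  case (step r s y)
  then show ?case using assms(3)[of s]
    by (simp add: clin_add[OF assms(1)] clin_scale[OF assms(1)] cfun.scale_right_distrib mult.commute)
qed

lemma in_span_image_finite:
  assumes "finite S" "x \<in> cfun.span (u ` S)"
  shows "\<exists>r. x = (\<Sum>J\<in>S. cscale (r J) (u J))"
  using assms(2)
proof (induction rule: cfun.span_induct_alt)
  case base
  show ?case by (rule exI[of _ "\<lambda>_. 0"]) simp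
next
  case (step c s y)
  then obtain r K where r: "y = (\<Sum>J\<in>S. cscale (r J) (u J))" and K: "K \<in> S" "s = u K" by blast
  have "cscale c s + y = (\<Sum>J\<in>S. cscale (r J + (if J = K then c else 0)) (u J))"
  proof -
    have "(\<Sum>J\<in>S. cscale (r J + (if J = K then c else 0)) (u J)) =
      (\<Sum>J\<in>S. cscale (r J) (u J) + (if J = K then cscale c (u K) else 0))"
      by (rule sum.cong) (auto simp: cfun.scale_left_distrib)
    also have "\<dots> = y + cscale c s"
      using assms(1) K r by (simp add: sum.distrib)
    finally show ?thesis by (simp add: add.commute)
  qed
  then show ?case by (rule exI[of _ "\<lambda>J. r J + (if J = K then c else 0)"])
qed

lemma sl_smult: "A \<in> sl k \<Longrightarrow> c \<cdot>\<^sub>m A \<in> sl k"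
  by (auto simp: sl_def sum_distrib_left[symmetric])

lemma sl_carrier: "A \<in> sl k \<Longrightarrow> A \<in> carrier_mat k k"
  by (simp add: sl_def)

text \<open>The simple coroot \<open>H_i\<close>, the bracket of \<open>E_i\<close> and
  \<open>F_i\<close>.\<close>

definition hmat :: "nat \<Rightarrow> nat \<Rightarrow> complex mat" where
  "hmat k i = dmat k (\<lambda>m. if m = i then 1 else if m = Suc i then -1 else 0)"

lemma dmat_index: "i < k \<Longrightarrow> dmat k h $$ (i, i) = h i"
  by (simp add: dmat_def)

lemma hmat_cartan:
  assumes "Suc i < k"
  shows "hmat k i \<in> cartan k"
  unfolding hmat_def
proof (rule dmat_cartan)
  have "(\<Sum>m<k. if m = i then 1 else if m = Suc i then -1 else 0 :: complex) =
    (\<Sum>m<k. (if m = i then 1 else 0) - (if m = Suc i then 1 else 0))"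
    by (rule sum.cong) auto
  also have "\<dots> = 0" using assms by (simp add: sum_subtractf)
  finally show "(\<Sum>m<k. if m = i then 1 else if m = Suc i then -1 else 0 :: complex) = 0" .
qed

section \<open>The given irreducible representation as a highest weight module\<close>

locale sl_irrep =
  fixes k N :: nat and \<rho> :: "complex mat \<Rightarrow> complex mat" and l :: "real vec" and v :: "complex vec"
  assumes k: "2 \<le> k" and irr: "irreducible_sl_rep k N \<rho>"
    and v: "v \<in> weight_space k N \<rho> l" "v \<noteq> 0\<^sub>v N"
    and v_high: "i < j \<Longrightarrow> j < k \<Longrightarrow> \<rho> (elem_mat k i j) *\<^sub>v v = 0\<^sub>v N"
begin

abbreviation "act A \<equiv> mop N (\<rho> A)"
abbreviation "e i \<equiv> act (elem_mat k i (Suc i))"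
abbreviation "f i \<equiv> act (elem_mat k (Suc i) i)"
abbreviation "n \<equiv> k - 1"
abbreviation "x0 \<equiv> vfun N v"

lemma rep: "sl_rep k N \<rho>"
  using irr by (simp add: irreducible_sl_rep_def)

lemma rep_carrier: "A \<in> sl k \<Longrightarrow> \<rho> A \<in> carrier_mat N N"
  using rep by (simp add: sl_rep_def)

lemma clin_act: "A \<in> sl k \<Longrightarrow> clin (act A)"
  by (rule clin_mop[OF rep_carrier])

lemma act_add: "A \<in> sl k \<Longrightarrow> B \<in> sl k \<Longrightarrow> act (A + B) x = act A x + act B x"
  using rep by (simp add: sl_rep_def mop_add)

lemma act_smult: "A \<in> sl k \<Longrightarrow> act (c \<cdot>\<^sub>m A) x = cscale c (act A x)"
  using rep by (simp add: sl_rep_def mop_smult)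

lemma act_bracket:
  assumes "A \<in> sl k" "B \<in> sl k"
  shows "act (A * B - B * A) x = act A (act B x) - act B (act A x)"
proof -
  have c: "\<rho> A \<in> carrier_mat N N" "\<rho> B \<in> carrier_mat N N" using rep_carrier assms by auto
  have "\<rho> (A * B - B * A) = \<rho> A * \<rho> B - \<rho> B * \<rho> A" using rep assms by (simp add: sl_rep_def)
  then show ?thesis using c by (simp add: mop_diff mop_mult)
qed

lemma act_zero: "act (0\<^sub>m k k) x = 0"
proof -
  have "0\<^sub>m k k = 0 \<cdot>\<^sub>m elem_mat k 0 1" by (rule eq_matI) (auto simp: elem_mat_def)
  then show ?thesis using act_smult[OF elem_mat_sl[of 0 1 k], of 0 x] by simp
qed

lemma act_cartan_elem:
  assumes H: "H \<in> cartan k" and ij: "i < k" "j < k" "i \<noteq> j"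
  shows "act H (act (elem_mat k i j) x) =
    act (elem_mat k i j) (act H x) + cscale (H $$ (i, i) - H $$ (j, j)) (act (elem_mat k i j) x)"
proof -
  let ?E = "elem_mat k i j"
  have "H * ?E - ?E * H = (H $$ (i, i) - H $$ (j, j)) \<cdot>\<^sub>m ?E"
    using dmat_elem_mat_comm[OF ij(1,2), of "\<lambda>i. H $$ (i, i)"] cartan_dmat[OF H] by simp
  then have "act H (act ?E x) - act ?E (act H x) = cscale (H $$ (i, i) - H $$ (j, j)) (act ?E x)"
    using act_bracket[OF cartan_sl[OF H] elem_mat_sl[OF ij(3)], of x]
      act_smult[OF elem_mat_sl[OF ij(3)]] by simp
  then show ?thesis by (simp add: algebra_simps)
qed

lemma act_e_f:
  assumes "i < n" "j < n"
  shows "e i (f j x) = f j (e i x) + (if i = j then act (hmat k i) x else 0)"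
proof -
  let ?E = "elem_mat k i (Suc i)" and ?F = "elem_mat k (Suc j) j"
  have "act (?E * ?F - ?F * ?E) x = e i (f j x) - f j (e i x)"
    by (rule act_bracket) (simp_all add: elem_mat_sl)
  moreover have "?E * ?F - ?F * ?E = (if i = j then hmat k i else 0\<^sub>m k k)"
  proof (cases "i = j")
    case True
    have 1: "?E * ?F = elem_mat k i i" "?F * ?E = elem_mat k (Suc i) (Suc i)"
      using assms True by (auto simp: elem_mat_mult)
    show ?thesis unfolding 1 using assms True
      by (intro eq_matI) (auto simp: elem_mat_def hmat_def dmat_def)
  next
    case False
    then have 1: "?E * ?F = 0\<^sub>m k k" "?F * ?E = 0\<^sub>m k k"
      using assms by (auto simp: elem_mat_mult)
    show ?thesis unfolding 1 using False by (intro eq_matI) auto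
  qed
  ultimately show ?thesis by (simp add: act_zero algebra_simps split: if_splits)
qed

text \<open>Brackets of neighbouring \<open>e\<close> (or \<open>f\<close>) give all off-diagonal
  elementary matrices by induction on the distance from the diagonal, and \<open>A\<close> is its
  diagonal plus multiples of these.\<close>

lemma sl_stable:
  assumes U: "cfun.subspace U"
    and eU: "\<And>i x. i < n \<Longrightarrow> x \<in> U \<Longrightarrow> e i x \<in> U"
    and fU: "\<And>i x. i < n \<Longrightarrow> x \<in> U \<Longrightarrow> f i x \<in> U"
    and hU: "\<And>H x. H \<in> cartan k \<Longrightarrow> x \<in> U \<Longrightarrow> act H x \<in> U"
    and A: "A \<in> sl k" and x: "x \<in> U"
  shows "act A x \<in> U"
proof -
  have up: "Suc (i + d) < k \<Longrightarrow> (\<forall>x\<in>U. act (elem_mat k i (Suc (i + d))) x \<in> U)" for i d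
  proof (induction d)
    case 0
    then show ?case using eU by simp
  next
    case (Suc d)
    let ?A = "elem_mat k i (Suc (i + d))" and ?B = "elem_mat k (Suc (i + d)) (Suc (i + Suc d))"
    have "?A * ?B - ?B * ?A = elem_mat k i (Suc (i + Suc d)) - 0\<^sub>m k k"
      using Suc.prems by (simp add: elem_mat_mult)
    also have "\<dots> = elem_mat k i (Suc (i + Suc d))" by (rule eq_matI) (auto simp: elem_mat_def)
    finally have "act (elem_mat k i (Suc (i + Suc d))) x = act ?A (act ?B x) - act ?B (act ?A x)" for x
      using act_bracket[of ?A ?B x] by (simp add: elem_mat_sl)
    moreover have "act ?B x \<in> U" if "x \<in> U" for x
      using eU[of "Suc (i + d)"] that Suc.prems by simp
    ultimately show ?case using Suc cfun.subspace_diff[OF U] by (simp del: minus_apply)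
  qed
  have down: "Suc (i + d) < k \<Longrightarrow> (\<forall>x\<in>U. act (elem_mat k (Suc (i + d)) i) x \<in> U)" for i d
  proof (induction d)
    case 0
    then show ?case using fU by simp
  next
    case (Suc d)
    let ?A = "elem_mat k (Suc (i + d)) i" and ?B = "elem_mat k (Suc (i + Suc d)) (Suc (i + d))"
    have "?B * ?A - ?A * ?B = elem_mat k (Suc (i + Suc d)) i - 0\<^sub>m k k"
      using Suc.prems by (simp add: elem_mat_mult)
    also have "\<dots> = elem_mat k (Suc (i + Suc d)) i" by (rule eq_matI) (auto simp: elem_mat_def)
    finally have "act (elem_mat k (Suc (i + Suc d)) i) x = act ?B (act ?A x) - act ?A (act ?B x)" for x
      using act_bracket[of ?B ?A x] by (simp add: elem_mat_sl)
    moreover have "act ?B x \<in> U" if "x \<in> U" for x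
      using fU[of "Suc (i + d)"] that Suc.prems by simp
    ultimately show ?case using Suc cfun.subspace_diff[OF U] by (simp del: minus_apply)
  qed
  have elem: "act (elem_mat k i j) x \<in> U" if "i \<noteq> j" "i < k" "j < k" "x \<in> U" for i j x
  proof (cases "i < j")
    case True
    then obtain d where "j = Suc (i + d)" using less_imp_Suc_add by blast
    then show ?thesis using up[of i d] that by simp
  next
    case False
    then have "j < i" using that by simp
    then obtain d where "i = Suc (j + d)" using less_imp_Suc_add by blast
    then show ?thesis using down[of j d] that by simp
  qed
  \<comment> \<open>The whole diagonal of \<open>A\<close> is kept, so the trace is 0 for every
    \<open>P\<close> and the off-diagonal entries can be added one by one within
    \<open>sl k\<close>.\<close>
  define part where "part P = mat k k (\<lambda>(i, j). if i = j \<or> (i, j) \<in> P then A $$ (i, j) else 0)" for P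
  define Q where "Q = {(i, j). i < k \<and> j < k \<and> i \<noteq> j}"
  have finQ: "finite Q" by (rule finite_subset[of _ "{..<k} \<times> {..<k}"]) (auto simp: Q_def)
  have part_sl: "part P \<in> sl k" for P
    using A by (simp add: part_def sl_def)
  have main: "act (part P) x \<in> U" if "P \<subseteq> Q" for P
    using finite_subset[OF that finQ] that
  proof (induction P rule: finite_induct)
    case empty
    have "part {} \<in> cartan k" using part_sl[of "{}"] by (auto simp: cartan_def part_def diagonal_mat_def)
    then show ?case using hU x by simp
  next
    case (insert q P)
    obtain i j where q: "q = (i, j)" "i < k" "j < k" "i \<noteq> j" using insert.prems by (auto simp: Q_def)
    have "part (insert q P) = part P + A $$ (i, j) \<cdot>\<^sub>m elem_mat k i j"
      using q insert.hyps by (intro eq_matI) (auto simp: part_def elem_mat_def)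
    then have "act (part (insert q P)) x = act (part P) x + cscale (A $$ (i, j)) (act (elem_mat k i j) x)"
      using act_add[OF part_sl sl_smult[OF elem_mat_sl[OF q(4)]]] act_smult[OF elem_mat_sl[OF q(4)]] by simp
    then show ?case
      using insert elem[OF q(4,2,3) x] cfun.subspace_add[OF U] cfun.subspace_scale[OF U] by simp
  qed
  have "part Q = A"
    using sl_carrier[OF A] by (intro eq_matI) (auto simp: part_def Q_def)
  then show ?thesis using main[of Q] by simp
qed

lemma irreducible:
  assumes U: "cfun.subspace U" and supp: "\<And>x i. x \<in> U \<Longrightarrow> N \<le> i \<Longrightarrow> x i = 0"
    and stable: "\<And>A x. A \<in> sl k \<Longrightarrow> x \<in> U \<Longrightarrow> act A x \<in> U"
  shows "U = {0} \<or> (\<forall>w\<in>carrier_vec N. vfun N w \<in> U)"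
proof -
  let ?V = "module_vec TYPE(complex) N"
  define W where "W = {w \<in> carrier_vec N. vfun N w \<in> U}"
  have sm: "submodule class_ring W ?V"
    unfolding submodule_def
    using vec_module cfun.subspace_add[OF U] cfun.subspace_scale[OF U] cfun.subspace_0[OF U]
    by (auto simp: W_def module_vec_simps vfun_zero vfun_add vfun_smult)
  have sub: "VectorSpace.subspace class_ring W ?V"
    unfolding VectorSpace.subspace_def using sm vec_vs by blast
  have "\<forall>A\<in>sl k. \<forall>w\<in>W. \<rho> A *\<^sub>v w \<in> W"
  proof (intro ballI)
    fix A w assume A: "A \<in> sl k" "w \<in> W"
    then have "act A (vfun N w) \<in> U" using stable by (simp add: W_def)
    then show "\<rho> A *\<^sub>v w \<in> W"
      using A rep_carrier[OF A(1)] by (simp add: W_def mop_vfun)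
  qed
  then have "W = {0\<^sub>v N} \<or> W = carrier_vec N"
    using irr sub unfolding irreducible_sl_rep_def by blast
  then show ?thesis
  proof
    assume W: "W = {0\<^sub>v N}"
    have "x = 0" if "x \<in> U" for x
    proof -
      have x: "vfun N (vec N x) = x" using supp[OF that] by (rule vfun_vec)
      then have "vec N x \<in> W" using that by (simp add: W_def)
      then have "vec N x = 0\<^sub>v N" using W by simp
      then show ?thesis using x vfun_zero by metis
    qed
    then show ?thesis using cfun.subspace_0[OF U] by blast
  qed (auto simp: W_def)
qed

text \<open>Moving a Cartan element or an \<open>e i\<close> rightwards through the letters leaves
  combinations of such words, because at the end it meets \<open>Y\<close>, which is stable under
  the former and killed by the latter. This serves both the highest weight line and the singular
  vectors of one level.\<close>

lemma generated_stable:
  assumes Ye: "\<And>y i. y \<in> Y \<Longrightarrow> i < n \<Longrightarrow> e i y = 0"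
    and Yh: "\<And>y H. y \<in> Y \<Longrightarrow> H \<in> cartan k \<Longrightarrow> act H y \<in> Y"
    and A: "A \<in> sl k"
    and x: "x \<in> cfun.span {foldr f J y | J y. set J \<subseteq> {..<n} \<and> y \<in> Y}"
  shows "act A x \<in> cfun.span {foldr f J y | J y. set J \<subseteq> {..<n} \<and> y \<in> Y}"
proof -
  let ?G = "{foldr f J y | J y. set J \<subseteq> {..<n} \<and> y \<in> Y}"
  have linf: "clin (f i)" and line: "clin (e i)" for i
    by (rule clin_act, rule elem_mat_sl, simp)+
  have linh: "clin (act H)" if "H \<in> cartan k" for H by (rule clin_act[OF cartan_sl[OF that]])
  have fU: "f i x \<in> cfun.span ?G" if i: "i < n" and "x \<in> cfun.span ?G" for i x
  proof (rule clin_span[OF linf that(2)])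
    fix s assume "s \<in> ?G"
    then obtain J y where "s = foldr f J y" "set J \<subseteq> {..<n}" "y \<in> Y" by blast
    then have "f i s = foldr f (i # J) y" "set (i # J) \<subseteq> {..<n}" "y \<in> Y" using i by auto
    then show "f i s \<in> cfun.span ?G" by (intro cfun.span_base) blast
  qed
  have hgen: "act H (foldr f J y) \<in> cfun.span ?G"
    if H: "H \<in> cartan k" and y: "y \<in> Y" and "set J \<subseteq> {..<n}" for H y J
    using that(3)
  proof (induction J)
    case Nil
    have "foldr f [] (act H y) \<in> ?G" using Yh[OF y H] by fastforce
    then show ?case by (simp add: cfun.span_base)
  next
    case (Cons j J)
    then have j: "j < n" "Suc j < k" and J: "set J \<subseteq> {..<n}" by auto
    have "foldr f (j # J) y \<in> cfun.span ?G" using Cons.prems y by (intro cfun.span_base) blast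
    moreover have "f j (act H (foldr f J y)) \<in> cfun.span ?G" using fU[OF j(1)] Cons.IH[OF J] by blast
    ultimately show ?case
      using act_cartan_elem[OF H, of "Suc j" j] j by (simp add: cfun.span_add cfun.span_scale)
  qed
  have hU: "act H x \<in> cfun.span ?G" if H: "H \<in> cartan k" and "x \<in> cfun.span ?G" for H x
    by (rule clin_span[OF linh[OF H] that(2)]) (use hgen[OF H] in blast)
  have egen: "e i (foldr f J y) \<in> cfun.span ?G"
    if i: "i < n" and y: "y \<in> Y" and "set J \<subseteq> {..<n}" for i y J
    using that(3)
  proof (induction J)
    case Nil
    then show ?case using Ye[OF y i] by (simp add: cfun.span_zero)
  next
    case (Cons j J)
    then have j: "j < n" and J: "set J \<subseteq> {..<n}" by auto
    have w: "foldr f J y \<in> cfun.span ?G" using J y by (intro cfun.span_base) blast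
    have "hmat k i \<in> cartan k" using i by (intro hmat_cartan) auto
    then have "act (hmat k i) (foldr f J y) \<in> cfun.span ?G" using hU w by blast
    moreover have "f j (e i (foldr f J y)) \<in> cfun.span ?G" using fU[OF j] Cons.IH[OF J] by blast
    ultimately show ?case using act_e_f[OF i j, of "foldr f J y"]
      by (cases "i = j") (simp_all add: cfun.span_add)
  qed
  have eU: "e i x \<in> cfun.span ?G" if i: "i < n" and "x \<in> cfun.span ?G" for i x
    by (rule clin_span[OF line that(2)]) (use egen[OF i] in blast)
  show ?thesis by (rule sl_stable[OF cfun.subspace_span eU fU hU A x])
qed

lemma x0_nonzero: "x0 \<noteq> 0"
proof
  assume "x0 = 0"
  then have "vec N x0 = 0\<^sub>v N" by (intro eq_vecI) (auto simp: fun_apply)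
  then show False using v by (simp add: weight_space_def)
qed

lemma e_x0:
  assumes "i < n"
  shows "e i x0 = 0"
proof -
  have "e i x0 = vfun N (\<rho> (elem_mat k i (Suc i)) *\<^sub>v v)"
    using v(1) by (intro mop_vfun) (simp add: weight_space_def)
  also have "\<dots> = 0" using assms by (simp add: v_high vfun_zero)
  finally show ?thesis .
qed

text \<open>The weight of \<open>F_J x_0\<close> as a functional on the Cartan subalgebra.\<close>

definition wchar :: "nat list \<Rightarrow> complex mat \<Rightarrow> complex" where
  "wchar J H = (\<Sum>i<k. complex_of_real (l $ i) * H $$ (i, i)) -
     (\<Sum>j\<leftarrow>J. H $$ (j, j) - H $$ (Suc j, Suc j))"

lemma act_word:
  assumes H: "H \<in> cartan k" and "set J \<subseteq> {..<n}"
  shows "act H (foldr f J x0) = cscale (wchar J H) (foldr f J x0)"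
  using assms(2)
proof (induction J)
  case Nil
  have "act H x0 = vfun N (\<rho> H *\<^sub>v v)"
    using v(1) by (intro mop_vfun) (simp add: weight_space_def)
  then show ?case using v(1) H by (simp add: weight_space_def wchar_def vfun_smult)
next
  case (Cons j J)
  then have j: "j < k" "Suc j < k" and J: "set J \<subseteq> {..<n}" by auto
  have "act H (foldr f (j # J) x0) = f j (act H (foldr f J x0)) +
      cscale (H $$ (Suc j, Suc j) - H $$ (j, j)) (foldr f (j # J) x0)"
    using act_cartan_elem[OF H j(2,1)] by simp
  also have "f j (act H (foldr f J x0)) = cscale (wchar J H) (foldr f (j # J) x0)"
    unfolding Cons.IH[OF J] by (simp add: clin_scale[OF clin_act[OF elem_mat_sl]])
  finally have "act H (foldr f (j # J) x0) =
      cscale (wchar J H + (H $$ (Suc j, Suc j) - H $$ (j, j))) (foldr f (j # J) x0)"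
    unfolding cfun.scale_left_distrib .
  moreover have "wchar J H + (H $$ (Suc j, Suc j) - H $$ (j, j)) = wchar (j # J) H"
    by (simp add: wchar_def)
  ultimately show ?case by simp
qed

text \<open>Half the sum of the positive coroots: every simple root takes the value 1 on it, so its
  eigenvalue drops by 1 with each letter. The constant \<open>(k - 1) / 2\<close> makes the trace
  0.\<close>

definition grading :: "complex mat" where
  "grading = dmat k (\<lambda>i. of_nat (k - 1) / 2 - of_nat i)"

lemma grading_cartan: "grading \<in> cartan k"
  unfolding grading_def
proof (rule dmat_cartan)
  have "(\<Sum>i<m. of_nat i :: complex) = of_nat m * (of_nat m - 1) / 2" for m :: nat
    by (induction m) (auto simp: field_simps)
  then show "(\<Sum>i<k. complex_of_nat (k - 1) / 2 - of_nat i) = 0"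
    using k by (simp add: sum_subtractf of_nat_diff)
qed

lemma grading_diff: "Suc j < k \<Longrightarrow> grading $$ (j, j) - grading $$ (Suc j, Suc j) = 1"
  by (simp add: grading_def dmat_index)

lemma wchar_grading:
  assumes "set J \<subseteq> {..<n}"
  shows "wchar J grading = wchar [] grading - of_nat (length J)"
proof -
  have "(\<Sum>j\<leftarrow>J. grading $$ (j, j) - grading $$ (Suc j, Suc j)) = (\<Sum>j\<leftarrow>J. 1)"
    using assms by (intro arg_cong[where f = sum_list] map_cong) (auto simp: grading_diff)
  then show ?thesis by (simp add: wchar_def sum_list_triv)
qed

lemma words_span:
  assumes "w \<in> carrier_vec N"
  shows "vfun N w \<in> cfun.span ((\<lambda>J. foldr f J x0) ` {J. set J \<subseteq> {..<n}})"
proof -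
  \<comment> \<open>The whole line instead of \<open>x0\<close> alone, since
    \<open>generated_stable\<close> asks for a set stable under the Cartan subalgebra.\<close>
  define Y where "Y = range (\<lambda>c. cscale c x0)"
  let ?U = "cfun.span {foldr f J y | J y. set J \<subseteq> {..<n} \<and> y \<in> Y}"
  have linf: "clin (f i)" and line: "clin (e i)" for i
    by (rule clin_act, rule elem_mat_sl, simp)+
  have linh: "clin (act H)" if "H \<in> cartan k" for H by (rule clin_act[OF cartan_sl[OF that]])
  have stable: "act A x \<in> ?U" if "A \<in> sl k" "x \<in> ?U" for A x
  proof (rule generated_stable[OF _ _ that])
    show "e i y = 0" if "y \<in> Y" "i < n" for y i
      using that e_x0 by (auto simp: Y_def clin_scale[OF line])
    show "act H y \<in> Y" if "y \<in> Y" "H \<in> cartan k" for y H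
      using that act_word[of H "[]"] by (auto simp: Y_def clin_scale[OF linh])
  qed
  have folds: "foldr f J (cscale c x0) = cscale c (foldr f J x0)" for J c
    by (induction J) (auto simp: clin_scale[OF linf])
  have supp0: "foldr f J x0 i = 0" if "N \<le> i" for i J
    using that by (cases J) (auto simp: mop_supp vfun_supp)
  have supp: "x i = 0" if "x \<in> ?U" "N \<le> i" for x i
    using that(1)
  proof (induction rule: cfun.span_induct_alt)
    case base
    then show ?case by (simp add: zero_fun_apply)
  next
    case (step c s y)
    then have "s i = 0" using folds supp0[OF that(2)] by (auto simp: Y_def fun_apply)
    then show ?case using step by (simp add: fun_apply)
  qed
  have "?U = {0} \<or> (\<forall>w\<in>carrier_vec N. vfun N w \<in> ?U)"
    by (rule irreducible[OF cfun.subspace_span]) (erule (1) supp, erule (1) stable)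
  moreover have "x0 \<in> ?U"
  proof (rule cfun.span_base)
    have "x0 = foldr f [] x0" "x0 = cscale 1 x0" by simp_all
    then show "x0 \<in> {foldr f J y | J y. set J \<subseteq> {..<n} \<and> y \<in> Y}"
      unfolding Y_def by fastforce
  qed
  ultimately have "vfun N w \<in> ?U" using assms x0_nonzero by blast
  moreover have "?U \<subseteq> cfun.span ((\<lambda>J. foldr f J x0) ` {J. set J \<subseteq> {..<n}})"
  proof (rule cfun.span_minimal)
    show "{foldr f J y | J y. set J \<subseteq> {..<n} \<and> y \<in> Y} \<subseteq>
        cfun.span ((\<lambda>J. foldr f J x0) ` {J. set J \<subseteq> {..<n}})"
    proof
      fix s assume "s \<in> {foldr f J y | J y. set J \<subseteq> {..<n} \<and> y \<in> Y}"
      then obtain J c where "s = cscale c (foldr f J x0)" "set J \<subseteq> {..<n}"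
        unfolding Y_def using folds by blast
      then show "s \<in> cfun.span ((\<lambda>J. foldr f J x0) ` {J. set J \<subseteq> {..<n}})"
        by (simp add: cfun.span_scale cfun.span_base)
    qed
  qed (rule cfun.subspace_span)
  ultimately show ?thesis by blast
qed

text \<open>The submodule is generated by all singular vectors of level \<open>m\<close> at once: unlike a single
  singular vector, which need not be a weight vector, they form a space stable under the Cartan
  subalgebra.\<close>

lemma no_singular_vectors:
  assumes m: "0 < m" and x: "x \<in> cfun.span {foldr f J x0 | J. set J \<subseteq> {..<n} \<and> length J = m}"
    and sing: "\<And>i. i < n \<Longrightarrow> e i x = 0"
  shows "x = 0"
proof -
  let ?L = "{foldr f J x0 | J. set J \<subseteq> {..<n} \<and> length J = m}"
  define Y where "Y = {y \<in> cfun.span ?L. \<forall>i<n. e i y = 0}"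
  let ?U = "cfun.span {foldr f J y | J y. set J \<subseteq> {..<n} \<and> y \<in> Y}"
  define c where "c = wchar [] grading"
  have linf: "clin (f i)" and line: "clin (e i)" for i
    by (rule clin_act, rule elem_mat_sl, simp)+
  have linh: "clin (act H)" if "H \<in> cartan k" for H by (rule clin_act[OF cartan_sl[OF that]])
  have stable: "act A x \<in> ?U" if "A \<in> sl k" "x \<in> ?U" for A x
  proof (rule generated_stable[OF _ _ that])
    show "e i y = 0" if "y \<in> Y" "i < n" for y i
      using that by (auto simp: Y_def)
    show "act H y \<in> Y" if y: "y \<in> Y" and H: "H \<in> cartan k" for y H
      unfolding Y_def
    proof (intro CollectI conjI allI impI)
      have "y \<in> cfun.span ?L" using y by (simp add: Y_def)
      then show "act H y \<in> cfun.span ?L"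
      proof (rule clin_span[OF linh[OF H]])
        fix s assume "s \<in> ?L"
        then obtain J where J: "s = foldr f J x0" "set J \<subseteq> {..<n}" "length J = m" by blast
        then have "act H s = cscale (wchar J H) s" using act_word[OF H] by simp
        moreover have "s \<in> cfun.span ?L" using J by (intro cfun.span_base) blast
        ultimately show "act H s \<in> cfun.span ?L" by (simp add: cfun.span_scale)
      qed
      fix i assume i: "i < n"
      then have "act H (e i y) = e i (act H y) + cscale (H $$ (i, i) - H $$ (Suc i, Suc i)) (e i y)"
        by (intro act_cartan_elem[OF H]) auto
      moreover have "e i y = 0" using y i by (simp add: Y_def)
      ultimately show "e i (act H y) = 0" using clin_zero[OF linh[OF H]] by simp
    qed
  qed
  have supp0: "foldr f J x0 i = 0" if "N \<le> i" for i J
    using that by (cases J) (auto simp: mop_supp vfun_supp)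
  have suppY: "y i = 0" if "y \<in> cfun.span ?L" "N \<le> i" for y i
    using that(1)
  proof (induction rule: cfun.span_induct_alt)
    case base
    then show ?case by (simp add: zero_fun_apply)
  next
    case (step c s y)
    then show ?case using supp0[OF that(2)] by (auto simp: fun_apply)
  qed
  have supp: "z i = 0" if "z \<in> ?U" "N \<le> i" for z i
    using that(1)
  proof (induction rule: cfun.span_induct_alt)
    case base
    then show ?case by (simp add: zero_fun_apply)
  next
    case (step c s z)
    then obtain J y where J: "s = foldr f J y" "y \<in> Y" by blast
    have "s i = 0"
    proof (cases J)
      case Nil
      then show ?thesis using J suppY[OF _ that(2)] by (simp add: Y_def)
    next
      case (Cons j J')
      then show ?thesis using J that(2) by (simp add: mop_supp)
    qed
    then show ?case using step by (simp add: fun_apply)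
  qed
  have "?U = {0} \<or> (\<forall>w\<in>carrier_vec N. vfun N w \<in> ?U)"
    by (rule irreducible[OF cfun.subspace_span]) (erule (1) supp, erule (1) stable)
  \<comment> \<open>\<open>x0\<close> has \<open>grading\<close> eigenvalue \<open>c\<close>, while
    the generators of the submodule have eigenvalues \<open>c - m - length J\<close> with
    \<open>m > 0\<close>. So the submodule is proper, and irreducibility makes it 0.\<close>
  moreover have "x0 \<notin> ?U"
  proof
    assume in_U: "x0 \<in> ?U"
    define I where "I = {J. set J \<subseteq> {..<n}} \<times> Y"
    define u where "u = (\<lambda>(J, y). foldr f J y)"
    have img: "{foldr f J y | J y. set J \<subseteq> {..<n} \<and> y \<in> Y} = u ` I"
    proof (intro equalityI subsetI)
      fix s assume "s \<in> {foldr f J y | J y. set J \<subseteq> {..<n} \<and> y \<in> Y}"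
      then obtain J y where "s = foldr f J y" "set J \<subseteq> {..<n}" "y \<in> Y" by blast
      then have "(J, y) \<in> I" "s = u (J, y)" by (simp_all add: I_def u_def)
      then show "s \<in> u ` I" by (rule rev_image_eqI)
    next
      fix s assume "s \<in> u ` I"
      then obtain J y where "set J \<subseteq> {..<n}" "y \<in> Y" "s = foldr f J y"
        by (auto simp: I_def u_def)
      then show "s \<in> {foldr f J y | J y. set J \<subseteq> {..<n} \<and> y \<in> Y}" by blast
    qed
    have Yeig: "act grading y = cscale (c - of_nat m) y" if "y \<in> Y" for y
    proof (rule eigen_on_span[OF linh[OF grading_cartan]])
      show "y \<in> cfun.span ?L" using that by (simp add: Y_def)
      fix s assume "s \<in> ?L"
      then obtain J where J: "s = foldr f J x0" "set J \<subseteq> {..<n}" "length J = m" by blast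
      show "act grading s = cscale (c - of_nat m) s"
        using act_word[OF grading_cartan J(2)] wchar_grading[OF J(2)]
        unfolding J(1) J(3) c_def by simp
    qed
    have ueig: "act grading (foldr f J y) = cscale (c - of_nat m - of_nat (length J)) (foldr f J y)"
      if "y \<in> Y" "set J \<subseteq> {..<n}" for J y
      using that(2)
    proof (induction J)
      case Nil
      then show ?case using Yeig[OF that(1)] by simp
    next
      case (Cons j J)
      then have j: "j < k" "Suc j < k" and J: "set J \<subseteq> {..<n}" by auto
      have "grading $$ (Suc j, Suc j) - grading $$ (j, j) = -1" using grading_diff[OF j(2)]
        by (simp add: algebra_simps)
      then have "act grading (foldr f (j # J) y) = f j (act grading (foldr f J y)) +
          cscale (-1) (foldr f (j # J) y)"
        using act_cartan_elem[OF grading_cartan j(2,1)] by simp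
      also have "f j (act grading (foldr f J y)) =
          cscale (c - of_nat m - of_nat (length J)) (foldr f (j # J) y)"
        unfolding Cons.IH[OF J] by (simp add: clin_scale[OF linf])
      finally show ?case
        unfolding cfun.scale_left_distrib[symmetric] by (simp add: algebra_simps)
    qed
    \<comment> \<open>A single operator, indexed by \<open>()\<close>. The set of indices with
      eigenvalue \<open>c\<close> turns out to be empty, so \<open>x0\<close> would be 0.\<close>
    have "x0 \<in> cfun.span (u ` {q \<in> I. \<forall>h\<in>{()}. c - of_nat m - of_nat (length (fst q)) = c})"
    proof (rule eigenvector_in_span_image[where D = "\<lambda>_. act grading"])
      show "x0 \<in> cfun.span (u ` I)" using in_U img by simp
      show "clin (act grading)" by (rule linh[OF grading_cartan])
      show "act grading (u q) = cscale (c - of_nat m - of_nat (length (fst q))) (u q)"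
        if "q \<in> I" for q
        using that ueig by (auto simp: I_def u_def)
      show "act grading x0 = cscale c x0"
        using act_word[OF grading_cartan, of "[]"] by (simp add: c_def)
    qed
    moreover have "c - of_nat m - of_nat (length (fst q)) \<noteq> c" for q :: "nat list \<times> (nat \<Rightarrow> complex)"
    proof
      assume "c - of_nat m - of_nat (length (fst q)) = c"
      then have "of_nat (m + length (fst q)) = (0 :: complex)" by (simp add: algebra_simps)
      then show False using m unfolding of_nat_eq_0_iff by simp
    qed
    ultimately show False using x0_nonzero by simp
  qed
  moreover have "v \<in> carrier_vec N" using v by (simp add: weight_space_def)
  ultimately have U0: "?U = {0}" by blast
  have "x \<in> Y" using x sing by (simp add: Y_def)
  then have "foldr f [] x \<in> ?U" by (intro cfun.span_base) fastforce
  then show ?thesis using U0 by simp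
qed

lemma wchar_hmat:
  assumes a: "\<And>i. i < n \<Longrightarrow> real_of_int (a i) = l $ i - l $ Suc i"
    and i: "i < n" and J: "set J \<subseteq> {..<n}"
  shows "wchar J (hmat k i) = of_int (lower_weight a i J)"
  using J
proof (induction J)
  case Nil
  have ik: "i < k" "Suc i < k" using i by auto
  have "(\<Sum>m<k. complex_of_real (l $ m) * hmat k i $$ (m, m)) =
    (\<Sum>m<k. (if m = i then complex_of_real (l $ i) else 0) - (if m = Suc i then complex_of_real (l $ Suc i) else 0))"
    by (rule sum.cong) (auto simp: hmat_def dmat_index)
  also have "\<dots> = complex_of_real (l $ i - l $ Suc i)" using ik by (simp add: sum_subtractf)
  also have "\<dots> = of_int (a i)" using a[OF i] by (metis of_real_of_int_eq)
  finally show ?case by (simp add: wchar_def)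
next
  case (Cons j J)
  then have j: "j < k" "Suc j < k" by auto
  have "hmat k i $$ (j, j) - hmat k i $$ (Suc j, Suc j) = of_int (cartan_entry i j)"
    using j by (auto simp: hmat_def dmat_index cartan_entry_def)
  then show ?case using Cons by (simp add: wchar_def algebra_simps)
qed

lemma hw_module_act:
  assumes a: "\<And>i. i < n \<Longrightarrow> real_of_int (a i) = l $ i - l $ Suc i"
  shows "hw_module n a e f x0"
proof
  show "clin (e i)" "clin (f i)" for i
    by (rule clin_act, rule elem_mat_sl, simp)+
  show "e i (f j (foldr f J x0)) = f j (e i (foldr f J x0)) +
        (if i = j then cscale (of_int (lower_weight a i J)) (foldr f J x0) else 0)"
    if ij: "i < n" "j < n" and J: "set J \<subseteq> {..<n}" for i j J
  proof -
    have "hmat k i \<in> cartan k" using ij by (intro hmat_cartan) auto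
    then have "act (hmat k i) (foldr f J x0) = cscale (of_int (lower_weight a i J)) (foldr f J x0)"
      using act_word[OF _ J] wchar_hmat[OF a ij(1) J] by simp
    then show ?thesis using act_e_f[OF ij] by (cases "i = j") simp_all
  qed
qed (use x0_nonzero e_x0 no_singular_vectors in auto)

end

section \<open>Weight spaces and the comparison of the two modules\<close>

lemma abel_summation:
  fixes d h :: "nat \<Rightarrow> complex"
  shows "(\<Sum>m<t. (\<Sum>i\<le>m. d i) * (h m - h (Suc m))) = (\<Sum>i\<le>t. d i * h i) - (\<Sum>i\<le>t. d i) * h t"
  by (induction t) (simp_all add: algebra_simps)

lemma sum_list_count:
  fixes g :: "nat \<Rightarrow> complex"
  assumes "set J \<subseteq> {..<n}"
  shows "(\<Sum>j\<leftarrow>J. g j) = (\<Sum>m<n. of_nat (count_list J m) * g m)"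
  using assms
proof (induction J)
  case (Cons j J)
  have "(\<Sum>m<n. of_nat (count_list (j # J) m) * g m) =
      (\<Sum>m<n. of_nat (count_list J m) * g m + (if m = j then g j else 0))"
    by (rule sum.cong) (auto simp: algebra_simps)
  also have "\<dots> = (\<Sum>m<n. of_nat (count_list J m) * g m) + g j"
    using Cons.prems by (simp add: sum.distrib)
  finally show ?case using Cons by simp
qed simp

context sl_irrep
begin

text \<open>The partial sums of \<open>l - b\<close> are its coefficients in simple roots.
  \<open>abel_summation\<close> turns the sum over letters into the pairing of \<open>l - b\<close>
  with \<open>H\<close>; the boundary term contains the sum of all coordinates, which is 0.\<close>

lemma wchar_of_words:
  assumes kap: "\<And>j. j < n \<Longrightarrow> real_of_int (\<kappa> j) = (\<Sum>i\<le>j. l $ i - b $ i)"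
    and zero: "(\<Sum>i<k. l $ i) = 0" "(\<Sum>i<k. b $ i) = 0" and J: "J \<in> words n \<kappa>"
  shows "wchar J H = (\<Sum>i<k. complex_of_real (b $ i) * H $$ (i, i))"
proof -
  define d where "d i = complex_of_real (l $ i - b $ i)" for i
  have kn: "{..<k} = {..n}" using k by auto
  have cnt: "of_nat (count_list J m) = (\<Sum>i\<le>m. d i)" if "m < n" for m
  proof -
    have "int (count_list J m) = \<kappa> m" using J that by (simp add: words_def)
    then have "real_of_int (int (count_list J m)) = real_of_int (\<kappa> m)" by (simp only:)
    then have "real (count_list J m) = (\<Sum>i\<le>m. l $ i - b $ i)"
      unfolding kap[OF that] of_int_of_nat_eq .
    then have "complex_of_real (real (count_list J m)) = complex_of_real (\<Sum>i\<le>m. l $ i - b $ i)"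
      by simp
    then show ?thesis by (simp add: d_def)
  qed
  have "set J \<subseteq> {..<n}" using J by (simp add: words_def)
  then have "(\<Sum>j\<leftarrow>J. H $$ (j, j) - H $$ (Suc j, Suc j)) =
      (\<Sum>m<n. of_nat (count_list J m) * (H $$ (m, m) - H $$ (Suc m, Suc m)))"
    by (rule sum_list_count)
  also have "\<dots> = (\<Sum>m<n. (\<Sum>i\<le>m. d i) * (H $$ (m, m) - H $$ (Suc m, Suc m)))"
    using cnt by (intro sum.cong) auto
  also have "\<dots> = (\<Sum>i<k. d i * H $$ (i, i)) - (\<Sum>i<k. d i) * H $$ (n, n)"
    unfolding kn by (rule abel_summation)
  also have "(\<Sum>i<k. d i) = complex_of_real ((\<Sum>i<k. l $ i) - (\<Sum>i<k. b $ i))"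
    by (simp add: d_def sum_subtractf)
  also have "\<dots> = 0" using zero by simp
  finally show ?thesis by (simp add: wchar_def d_def algebra_simps sum_subtractf)
qed

lemma words_of_wchar:
  assumes kap: "\<And>j. j < n \<Longrightarrow> real_of_int (\<kappa> j) = (\<Sum>i\<le>j. l $ i - b $ i)"
    and zero: "(\<Sum>i<k. l $ i) = 0" "(\<Sum>i<k. b $ i) = 0" and J: "set J \<subseteq> {..<n}"
    and eq: "\<And>H. H \<in> cartan k \<Longrightarrow> wchar J H = (\<Sum>i<k. complex_of_real (b $ i) * H $$ (i, i))"
  shows "J \<in> words n \<kappa>"
  unfolding words_def
proof (intro CollectI conjI allI impI J)
  fix j assume j: "j < n"
  \<comment> \<open>The fundamental coweight of row \<open>j\<close>: the simple root
    \<open>j\<close> is 1 on it and the others are 0, so it counts the letters \<open>j\<close>. The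
    constant makes the trace 0 and drops out against coordinates of sum 0.\<close>
  define h where "h i = (if i \<le> j then 1 else 0) - of_nat (Suc j) / complex_of_nat k" for i
  define H where "H = dmat k h"
  have sub: "{..<k} \<inter> {..j} = {..j}" using j by auto
  have "(\<Sum>i<k. if i \<le> j then 1 else 0 :: complex) = of_nat (Suc j)"
    using sub by (simp add: sum.If_cases Collect_conj_eq[symmetric] atMost_def[symmetric])
  then have "(\<Sum>i<k. h i) = 0" using k by (simp add: h_def sum_subtractf)
  then have H: "H \<in> cartan k" unfolding H_def by (rule dmat_cartan)
  have pick: "(\<Sum>i<k. complex_of_real (c $ i) * H $$ (i, i)) = complex_of_real (\<Sum>i\<le>j. c $ i)"
    if "(\<Sum>i<k. c $ i) = 0" for c :: "real vec"
  proof -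
    have "(\<Sum>i<k. complex_of_real (c $ i) * H $$ (i, i)) =
      (\<Sum>i<k. (if i \<le> j then complex_of_real (c $ i) else 0) - of_nat (Suc j) / complex_of_nat k * complex_of_real (c $ i))"
      by (rule sum.cong) (auto simp: H_def dmat_index h_def algebra_simps)
    also have "\<dots> = (\<Sum>i<k. if i \<le> j then complex_of_real (c $ i) else 0) -
        of_nat (Suc j) / complex_of_nat k * complex_of_real (\<Sum>i<k. c $ i)"
      by (simp add: sum_subtractf sum_distrib_left)
    also have "\<dots> = complex_of_real (\<Sum>i\<le>j. c $ i)"
      using that sub by (simp add: sum.If_cases atMost_def[symmetric])
    finally show ?thesis .
  qed
  have "(\<Sum>r\<leftarrow>J. H $$ (r, r) - H $$ (Suc r, Suc r)) =
      (\<Sum>m<n. of_nat (count_list J m) * (H $$ (m, m) - H $$ (Suc m, Suc m)))"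
    by (rule sum_list_count[OF J])
  also have "\<dots> = (\<Sum>m<n. if m = j then of_nat (count_list J j) else 0)"
    by (rule sum.cong) (auto simp: H_def dmat_index h_def)
  also have "\<dots> = of_nat (count_list J j)" using j by simp
  finally have "wchar J H = complex_of_real (\<Sum>i\<le>j. l $ i) - of_nat (count_list J j)"
    using pick[OF zero(1)] by (simp add: wchar_def)
  then have "complex_of_real (real (count_list J j)) = complex_of_real (\<Sum>i\<le>j. l $ i - b $ i)"
    using eq[OF H] pick[OF zero(2)] by (simp add: sum_subtractf algebra_simps)
  then have "real (count_list J j) = (\<Sum>i\<le>j. l $ i - b $ i)" by (simp only: of_real_eq_iff)
  then have "real_of_int (int (count_list J j)) = real_of_int (\<kappa> j)" using kap[OF j] by simp
  then show "int (count_list J j) = \<kappa> j" by (simp only: of_int_eq_iff)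
qed

lemma weight_space_fun:
  "w \<in> weight_space k N \<rho> b \<longleftrightarrow> w \<in> carrier_vec N \<and> (\<forall>H\<in>cartan k.
     act H (vfun N w) = cscale (\<Sum>i<k. complex_of_real (b $ i) * H $$ (i, i)) (vfun N w))"
proof (cases "w \<in> carrier_vec N")
  case True
  have "\<rho> H *\<^sub>v w = c \<cdot>\<^sub>v w \<longleftrightarrow> act H (vfun N w) = cscale c (vfun N w)" if "H \<in> cartan k" for H c
    using True rep_carrier[OF cartan_sl[OF that]]
    by (simp add: mop_vfun vfun_smult[symmetric] vfun_inject)
  then show ?thesis using True by (simp add: weight_space_def)
qed (simp add: weight_space_def)

text \<open>Read in the representation, the words of \<open>word_basis\<close> stay independent and
  still generate all words of their weight. These span the weight space, since all words span the
  representation and a weight vector involves only those of its own weight.\<close>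

lemma weight_mult_eq_card:
  assumes kap: "\<And>j. j < n \<Longrightarrow> real_of_int (\<kappa> j) = (\<Sum>i\<le>j. l $ i - b $ i)"
    and zero: "(\<Sum>i<k. l $ i) = 0" "(\<Sum>i<k. b $ i) = 0"
    and gt: "gelfand_tsetlin n p"
    and p: "\<And>i. i < n \<Longrightarrow> real_of_int (p i - p (Suc i)) = l $ i - l $ Suc i"
  shows "weight_mult k N \<rho> b = card (gelfand_tsetlin.GT_deficit n p \<kappa>)"
proof -
  interpret GT: gelfand_tsetlin n p by (rule gt)
  let ?w = "\<lambda>J. foldr f J x0"
  have modV: "hw_module n (\<lambda>i. p i - p (Suc i)) e f x0" by (rule hw_module_act[OF p])
  obtain S where S: "finite S" "S \<subseteq> words n \<kappa>" "card S = card (GT.GT_deficit \<kappa>)"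
    and ind: "\<And>r. (\<Sum>J\<in>S. cscale (r J) (GT.word J)) = 0 \<Longrightarrow> \<forall>J\<in>S. r J = 0"
    and gen: "\<And>K. K \<in> words n \<kappa> \<Longrightarrow> \<exists>r. GT.word K = (\<Sum>J\<in>S. cscale (r J) (GT.word J))"
    by (rule GT.word_basis[where \<kappa> = \<kappa>]) (rule that)
  have rel: "(\<Sum>J\<in>T. cscale (r J) (?w J)) = 0 \<longleftrightarrow> (\<Sum>J\<in>T. cscale (r J) (GT.word J)) = 0"
    if T: "T \<subseteq> words n \<kappa>" for T r
    by (rule same_relations[OF modV GT.hw_module_GT words_length[of _ _ \<kappa>]]) (use T in blast)
  have indV: "\<forall>J\<in>S. r J = 0" if "(\<Sum>J\<in>S. cscale (r J) (?w J)) = 0" for r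
    using rel[OF S(2)] ind that by blast
  have genV: "?w K \<in> cfun.span (?w ` S)" if K: "K \<in> words n \<kappa>" for K
  proof (cases "K \<in> S")
    case True
    then show ?thesis by (intro cfun.span_base) auto
  next
    case False
    obtain r where r: "GT.word K = (\<Sum>J\<in>S. cscale (r J) (GT.word J))" using gen[OF K] by blast
    \<comment> \<open>The coefficient -1 at \<open>K\<close> turns the expansion of \<open>K\<close>
      in \<open>S\<close> into a vanishing combination, which \<open>rel\<close> transports;
      \<open>ins\<close> is stated for any \<open>u\<close> so as to serve both modules.\<close>
    define r' where "r' = r(K := -1)"
    have ins: "(\<Sum>J\<in>insert K S. cscale (r' J) (u J)) = (\<Sum>J\<in>S. cscale (r J) (u J)) - u K"
      for u :: "nat list \<Rightarrow> 'z \<Rightarrow> complex"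
    proof -
      have "(\<Sum>J\<in>S. cscale (r' J) (u J)) = (\<Sum>J\<in>S. cscale (r J) (u J))"
        using False by (intro sum.cong) (auto simp: r'_def)
      then show ?thesis using S(1) False by (simp add: r'_def)
    qed
    have "(\<Sum>J\<in>insert K S. cscale (r' J) (GT.word J)) = 0"
      unfolding ins r by simp
    then have "(\<Sum>J\<in>insert K S. cscale (r' J) (?w J)) = 0"
      using rel[of "insert K S" r'] K S(2) by simp
    then have "?w K = (\<Sum>J\<in>S. cscale (r J) (?w J))" unfolding ins by simp
    moreover have "(\<Sum>J\<in>S. cscale (r J) (?w J)) \<in> cfun.span (?w ` S)"
      by (intro cfun.span_sum cfun.span_scale cfun.span_base) auto
    ultimately show ?thesis by simp
  qed
  have weight: "w \<in> weight_space k N \<rho> b \<longleftrightarrow>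
      w \<in> carrier_vec N \<and> (\<exists>r. vfun N w = (\<Sum>J\<in>S. cscale (r J) (?w J)))" for w
  proof (intro iffI conjI)
    assume w: "w \<in> weight_space k N \<rho> b"
    then show wc: "w \<in> carrier_vec N" by (simp add: weight_space_def)
    have "vfun N w \<in> cfun.span (?w ` {J \<in> {J. set J \<subseteq> {..<n}}.
        \<forall>H\<in>cartan k. wchar J H = (\<Sum>i<k. complex_of_real (b $ i) * H $$ (i, i))})"
    proof (rule eigenvector_in_span_image[where D = act, OF words_span[OF wc]])
      show "clin (act H)" if "H \<in> cartan k" for H by (rule clin_act[OF cartan_sl[OF that]])
    qed (use w weight_space_fun act_word in auto)
    also have "\<dots> \<subseteq> cfun.span (?w ` S)"
    proof (intro cfun.span_minimal subsetI)
      fix s assume "s \<in> ?w ` {J \<in> {J. set J \<subseteq> {..<n}}.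
        \<forall>H\<in>cartan k. wchar J H = (\<Sum>i<k. complex_of_real (b $ i) * H $$ (i, i))}"
      then obtain J where "s = ?w J" "set J \<subseteq> {..<n}"
        "\<forall>H\<in>cartan k. wchar J H = (\<Sum>i<k. complex_of_real (b $ i) * H $$ (i, i))" by blast
      then show "s \<in> cfun.span (?w ` S)" using words_of_wchar[OF kap zero] genV by simp
    qed (rule cfun.subspace_span)
    finally show "\<exists>r. vfun N w = (\<Sum>J\<in>S. cscale (r J) (?w J))"
      using in_span_image_finite[OF S(1)] by blast
  next
    assume w: "w \<in> carrier_vec N \<and> (\<exists>r. vfun N w = (\<Sum>J\<in>S. cscale (r J) (?w J)))"
    then obtain r where r: "vfun N w = (\<Sum>J\<in>S. cscale (r J) (?w J))" by blast
    have "act H (vfun N w) = cscale (\<Sum>i<k. complex_of_real (b $ i) * H $$ (i, i)) (vfun N w)"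
      if H: "H \<in> cartan k" for H
    proof (rule eigen_on_span[OF clin_act[OF cartan_sl[OF H]]])
      show "vfun N w \<in> cfun.span (?w ` S)"
        unfolding r by (intro cfun.span_sum cfun.span_scale cfun.span_base) auto
      fix s assume "s \<in> ?w ` S"
      then obtain J where J: "s = ?w J" "J \<in> words n \<kappa>" using S(2) by blast
      then show "act H s = cscale (\<Sum>i<k. complex_of_real (b $ i) * H $$ (i, i)) s"
        using act_word[OF H] wchar_of_words[OF kap zero J(2)] by (simp add: words_def)
    qed
    then show "w \<in> weight_space k N \<rho> b" unfolding weight_space_fun using w by blast
  qed
  define u where "u J = vec N (?w J)" for J
  have u_index: "u J $ i = ?w J i" if "i < N" for J i using that by (simp add: u_def)
  have supp: "?w J i = 0" if "N \<le> i" for J i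
    using that by (cases J) (auto simp: mop_supp vfun_supp)
  have sum_zero: "(\<Sum>J\<in>S. cscale (r J) (?w J)) = 0"
    if "\<forall>i<N. (\<Sum>J\<in>S. r J * u J $ i) = 0" for r
  proof
    fix i
    show "(\<Sum>J\<in>S. cscale (r J) (?w J)) i = 0 i"
      using that supp[of i] by (cases "i < N") (simp_all add: fun_apply u_index)
  qed
  \<comment> \<open>\<open>dim_eq_card\<close> counts a set of vectors, and two words with the same
    vector would be a relation within \<open>S\<close>.\<close>
  have inj: "inj_on u S"
  proof (rule inj_onI, rule ccontr)
    fix J K assume JK: "J \<in> S" "K \<in> S" "u J = u K" "J \<noteq> K"
    define r where "r M = (if M = J then 1 else 0) - (if M = K then 1 else 0 :: complex)" for M
    have "(\<Sum>M\<in>S. r M * u M $ i) = u J $ i - u K $ i" if "i < N" for i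
    proof -
      have "(\<Sum>M\<in>S. r M * u M $ i) =
        (\<Sum>M\<in>S. (if M = J then u J $ i else 0) - (if M = K then u K $ i else 0))"
        by (rule sum.cong) (auto simp: r_def)
      then show ?thesis using S(1) JK by (simp add: sum_subtractf)
    qed
    then have "\<forall>M\<in>S. r M = 0" using indV[OF sum_zero] JK(3) by simp
    then show False using JK by (auto simp: r_def)
  qed
  have reindex: "(\<Sum>x\<in>u ` S. a x * x $ i) = (\<Sum>J\<in>S. a (u J) * u J $ i)" for a i
    by (simp add: sum.reindex[OF inj])
  have "weight_mult k N \<rho> b = card (u ` S)"
    unfolding weight_mult_def
  proof (rule dim_eq_card)
    show "finite (u ` S)" using S(1) by simp
    show "u ` S \<subseteq> carrier_vec N" by (auto simp: u_def)
    show "\<forall>x\<in>u ` S. a x = 0" if "\<forall>i<N. (\<Sum>x\<in>u ` S. a x * x $ i) = 0" for a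
    proof -
      have "\<forall>i<N. (\<Sum>J\<in>S. a (u J) * u J $ i) = 0" using that unfolding reindex .
      then have "\<forall>J\<in>S. a (u J) = 0" by (rule indV[OF sum_zero])
      then show ?thesis by simp
    qed
    show "w \<in> weight_space k N \<rho> b \<longleftrightarrow>
        w \<in> carrier_vec N \<and> (\<exists>a. \<forall>i<N. w $ i = (\<Sum>x\<in>u ` S. a x * x $ i))" for w
    proof -
      have "(\<exists>r. vfun N w = (\<Sum>J\<in>S. cscale (r J) (?w J))) \<longleftrightarrow>
        (\<exists>a. \<forall>i<N. w $ i = (\<Sum>x\<in>u ` S. a x * x $ i))"
      proof
        assume "\<exists>r. vfun N w = (\<Sum>J\<in>S. cscale (r J) (?w J))"
        then obtain r where r: "vfun N w = (\<Sum>J\<in>S. cscale (r J) (?w J))" by blast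
        have "w $ i = (\<Sum>x\<in>u ` S. r (inv_into S u x) * x $ i)" if "i < N" for i
        proof -
          have "w $ i = vfun N w i" using that by (simp add: vfun_def)
          also have "\<dots> = (\<Sum>J\<in>S. r J * u J $ i)"
            unfolding r using that by (simp add: fun_apply u_index)
          also have "\<dots> = (\<Sum>J\<in>S. r (inv_into S u (u J)) * u J $ i)"
            by (rule sum.cong) (simp_all add: inv_into_f_f[OF inj])
          finally show ?thesis unfolding reindex .
        qed
        then show "\<exists>a. \<forall>i<N. w $ i = (\<Sum>x\<in>u ` S. a x * x $ i)"
          by (intro exI[of _ "\<lambda>x. r (inv_into S u x)"]) simp
      next
        assume "\<exists>a. \<forall>i<N. w $ i = (\<Sum>x\<in>u ` S. a x * x $ i)"
        then obtain a where a: "\<forall>i<N. w $ i = (\<Sum>J\<in>S. a (u J) * u J $ i)"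
          unfolding reindex by blast
        have "vfun N w = (\<Sum>J\<in>S. cscale (a (u J)) (?w J))"
        proof
          fix i
          show "vfun N w i = (\<Sum>J\<in>S. cscale (a (u J)) (?w J)) i"
            using a supp[of i] by (cases "i < N") (simp_all add: fun_apply u_index vfun_def)
        qed
        then show "\<exists>r. vfun N w = (\<Sum>J\<in>S. cscale (r J) (?w J))"
          by (intro exI[of _ "\<lambda>J. a (u J)"])
      qed
      then show ?thesis using weight by blast
    qed
  qed
  also have "\<dots> = card (GT.GT_deficit \<kappa>)" using card_image[OF inj] S(3) by simp
  finally show ?thesis .
qed

end

section \<open>The vector partition function\<close>

text \<open>Lets the system be written with meaningful index types. Rows and columns are numbered by
  arbitrary bijections; only that of the rows, \<open>\<psi>\<close>, is visible outside, to form
  the right-hand side.\<close>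

lemma matrix_of_system:
  fixes C :: "'c set" and R :: "'r set" and E :: "'r \<Rightarrow> 'c \<Rightarrow> int" and B :: "'r \<Rightarrow> nat \<Rightarrow> int"
  assumes C: "finite C" and R: "finite R"
    and ker: "\<And>x :: 'c \<Rightarrow> real. (\<And>c. c \<in> C \<Longrightarrow> 0 \<le> x c) \<Longrightarrow>
      (\<And>r. r \<in> R \<Longrightarrow> (\<Sum>c\<in>C. of_int (E r c) * x c) = 0) \<Longrightarrow> (\<And>c. c \<in> C \<Longrightarrow> x c = 0)"
  obtains d m :: nat and Em Bm :: "int mat" and \<psi> :: "nat \<Rightarrow> 'r"
  where "Em \<in> carrier_mat d m" "Bm \<in> carrier_mat d q" "ker_meets_orthant_trivially d m Em"
    "\<And>s. s < d \<Longrightarrow> \<psi> s \<in> R"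
    "\<And>s z. s < d \<Longrightarrow> z \<in> carrier_vec q \<Longrightarrow>
      (map_mat real_of_int Bm *\<^sub>v z) $ s = (\<Sum>t<q. of_int (B (\<psi> s) t) * z $ t)"
    "\<And>y. vector_partition Em (vec d (\<lambda>s. y (\<psi> s))) =
      card {x :: 'c \<Rightarrow> nat. (\<forall>c. c \<notin> C \<longrightarrow> x c = 0) \<and> (\<forall>r\<in>R. (\<Sum>c\<in>C. E r c * int (x c)) = y r)}"
proof -
  define m where "m = card C"
  define d where "d = card R"
  obtain \<phi> where \<phi>: "bij_betw \<phi> {0..<m} C" using ex_bij_betw_nat_finite[OF C] m_def by blast
  obtain \<psi> where \<psi>: "bij_betw \<psi> {0..<d} R" using ex_bij_betw_nat_finite[OF R] d_def by blast
  define Em where "Em = mat d m (\<lambda>(s, t). E (\<psi> s) (\<phi> t))"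
  define Bm where "Bm = mat d q (\<lambda>(s, t). B (\<psi> s) t)"
  define \<theta> where "\<theta> = inv_into {0..<m} \<phi>"
  have \<phi>C: "\<phi> t \<in> C" "\<theta> (\<phi> t) = t" if "t < m" for t
    using \<phi> that by (auto simp: \<theta>_def bij_betw_def inv_into_f_f)
  have \<theta>C: "\<theta> c < m" "\<phi> (\<theta> c) = c" if "c \<in> C" for c
  proof -
    have "c \<in> \<phi> ` {0..<m}" using \<phi> that by (simp add: bij_betw_def)
    then show "\<theta> c < m" "\<phi> (\<theta> c) = c"
      using inv_into_into[of c \<phi> "{0..<m}"] f_inv_into_f[of c \<phi> "{0..<m}"] by (auto simp: \<theta>_def)
  qed
  have \<psi>R: "\<psi> s \<in> R" if "s < d" for s using \<psi> that by (auto simp: bij_betw_def)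
  have R_all: "(\<forall>r\<in>R. Q r) \<longleftrightarrow> (\<forall>s<d. Q (\<psi> s))" for Q
    using \<psi> by (auto simp: bij_betw_def)
  have reindex: "(\<Sum>t<m. g (\<phi> t)) = (\<Sum>c\<in>C. g c)" for g :: "'c \<Rightarrow> 'z :: comm_monoid_add"
    using sum.reindex_bij_betw[OF \<phi>, of g] by (simp add: atLeast0LessThan)
  show ?thesis
  proof
    show "Em \<in> carrier_mat d m" "Bm \<in> carrier_mat d q" by (simp_all add: Em_def Bm_def)
    show "ker_meets_orthant_trivially d m Em"
      unfolding ker_meets_orthant_trivially_def
    proof (intro equalityI subsetI)
      fix x assume "x \<in> {x \<in> carrier_vec m. (\<forall>i<m. 0 \<le> x $ i) \<and> map_mat real_of_int Em *\<^sub>v x = 0\<^sub>v d}"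
      then have x: "x \<in> carrier_vec m" "\<forall>i<m. 0 \<le> x $ i" "map_mat real_of_int Em *\<^sub>v x = 0\<^sub>v d" by auto
      have "x $ \<theta> c = 0" if "c \<in> C" for c
      proof (rule ker[OF _ _ that])
        show "0 \<le> x $ \<theta> c" if "c \<in> C" for c using x(2) \<theta>C[OF that] by simp
        fix r assume "r \<in> R"
        then obtain s where s: "s < d" "r = \<psi> s" using \<psi> by (auto simp: bij_betw_def)
        have "0 = (map_mat real_of_int Em *\<^sub>v x) $ s" using x(3) s by simp
        also have "\<dots> = (\<Sum>t<m. of_int (E r (\<phi> t)) * x $ t)"
          using s x(1) by (simp add: Em_def scalar_prod_def atLeast0LessThan)
        also have "\<dots> = (\<Sum>t<m. of_int (E r (\<phi> t)) * x $ \<theta> (\<phi> t))"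
          by (rule sum.cong) (simp_all add: \<phi>C)
        also have "\<dots> = (\<Sum>c\<in>C. of_int (E r c) * x $ \<theta> c)" by (rule reindex)
        finally show "(\<Sum>c\<in>C. of_int (E r c) * x $ \<theta> c) = 0" by simp
      qed
      then have "x $ t = 0" if "t < m" for t using \<phi>C[OF that] by metis
      then have "x = 0\<^sub>v m" using x(1) by (intro eq_vecI) auto
      then show "x \<in> {0\<^sub>v m}" by simp
    qed (auto simp: Em_def intro!: eq_vecI)
    show "\<psi> s \<in> R" if "s < d" for s using \<psi>R[OF that] .
    show "(map_mat real_of_int Bm *\<^sub>v z) $ s = (\<Sum>t<q. of_int (B (\<psi> s) t) * z $ t)"
      if "s < d" "z \<in> carrier_vec q" for s z
      using that by (simp add: Bm_def scalar_prod_def atLeast0LessThan)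
    show "vector_partition Em (vec d (\<lambda>s. y (\<psi> s))) =
      card {x :: 'c \<Rightarrow> nat. (\<forall>c. c \<notin> C \<longrightarrow> x c = 0) \<and> (\<forall>r\<in>R. (\<Sum>c\<in>C. E r c * int (x c)) = y r)}" for y
    proof -
      have eq: "Em *\<^sub>v map_vec int x = vec d (\<lambda>s. y (\<psi> s)) \<longleftrightarrow>
          (\<forall>r\<in>R. (\<Sum>c\<in>C. E r c * int (x $ \<theta> c)) = y r)" if x: "x \<in> carrier_vec m" for x
      proof -
        have "(Em *\<^sub>v map_vec int x) $ s = (\<Sum>c\<in>C. E (\<psi> s) c * int (x $ \<theta> c))" if s: "s < d" for s
        proof -
          have "(Em *\<^sub>v map_vec int x) $ s = (\<Sum>t<m. E (\<psi> s) (\<phi> t) * int (x $ t))"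
            using s x by (simp add: Em_def scalar_prod_def atLeast0LessThan)
          also have "\<dots> = (\<Sum>t<m. E (\<psi> s) (\<phi> t) * int (x $ \<theta> (\<phi> t)))"
            by (rule sum.cong) (simp_all add: \<phi>C)
          also have "\<dots> = (\<Sum>c\<in>C. E (\<psi> s) c * int (x $ \<theta> c))" by (rule reindex)
          finally show ?thesis .
        qed
        then show ?thesis unfolding R_all by (auto simp: vec_eq_iff Em_def)
      qed
      show ?thesis
        unfolding vector_partition_def
      proof (rule bij_betw_same_card, rule bij_betw_byWitness[where f' = "\<lambda>x. vec m (\<lambda>t. x (\<phi> t))"])
        let ?f = "\<lambda>(x :: nat vec) c. if c \<in> C then x $ \<theta> c else 0"
        let ?X = "{x \<in> carrier_vec (dim_col Em). Em *\<^sub>v map_vec int x = vec d (\<lambda>s. y (\<psi> s))}"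
        let ?Y = "{x :: 'c \<Rightarrow> nat. (\<forall>c. c \<notin> C \<longrightarrow> x c = 0) \<and> (\<forall>r\<in>R. (\<Sum>c\<in>C. E r c * int (x c)) = y r)}"
        have dim: "dim_col Em = m" by (simp add: Em_def)
        show "\<forall>a\<in>?X. vec m (\<lambda>t. ?f a (\<phi> t)) = a"
          unfolding dim by (auto simp: \<phi>C intro!: eq_vecI)
        show "\<forall>a'\<in>?Y. ?f (vec m (\<lambda>t. a' (\<phi> t))) = a'"
          by (auto simp: fun_eq_iff \<theta>C)
        show "?f ` ?X \<subseteq> ?Y"
          unfolding dim by (auto simp: eq)
        show "(\<lambda>x. vec m (\<lambda>t. x (\<phi> t))) ` ?Y \<subseteq> ?X"
          unfolding dim by (auto simp: eq \<theta>C)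
      qed
    qed
  qed
qed

section \<open>The linear system for the slacks\<close>

text \<open>The variables are the slacks of the interlacing inequalities:
  \<open>(True, j, i)\<close> for \<open>L (j + 1) i - L j i\<close> and \<open>(False, j, i)\<close> for \<open>L j i - L (j + 1) (i + 1)\<close>.
  Since \<open>L j i\<close> is \<open>p i\<close> minus the slacks \<open>(True, m, i)\<close> with \<open>m \<ge> j\<close>, the rows \<open>Inl (j, i)\<close> say that
  the two slacks at \<open>(j, i)\<close> come from one pattern, and the rows \<open>Inr j\<close> fix the weight.\<close>

definition gt_vars :: "nat \<Rightarrow> (bool \<times> nat \<times> nat) set" where
  "gt_vars n = UNIV \<times> (SIGMA m:{..<n}. {..m})"

definition gt_rows :: "nat \<Rightarrow> (nat \<times> nat + nat) set" where
  "gt_rows n = (SIGMA m:{..<n}. {..m}) <+> {..<n}"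

text \<open>Row \<open>Inl (j, i)\<close> arises by substituting the sums of slacks for
  \<open>L j i\<close> and \<open>L (j + 1) (i + 1)\<close> in the slack
  \<open>(False, j, i)\<close>; row \<open>Inr j\<close> is the deficit of row
  \<open>j\<close>.\<close>

definition gt_coeff :: "nat \<times> nat + nat \<Rightarrow> bool \<times> nat \<times> nat \<Rightarrow> int" where
  "gt_coeff r = (\<lambda>(t, m, i'). case r of
     Inl (j, i) \<Rightarrow> if t then (if i' = i \<and> j \<le> m then 1 else 0) - (if i' = Suc i \<and> Suc j \<le> m then 1 else 0)
       else (if m = j \<and> i' = i then 1 else 0)
   | Inr j \<Rightarrow> if t \<and> i' \<le> j \<and> j \<le> m then 1 else 0)"

text \<open>Columns below \<open>k\<close> act on \<open>\<lambda>\<close>, the others on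
  \<open>\<beta>\<close>. The forms are differences of neighbouring coordinates of
  \<open>\<lambda>\<close> and the coefficients of \<open>\<lambda> - \<beta>\<close> in simple
  roots, integral although the coordinates are fractions.\<close>

definition gt_rhs :: "nat \<Rightarrow> nat \<times> nat + nat \<Rightarrow> nat \<Rightarrow> int" where
  "gt_rhs k r t = (case r of
     Inl (j, i) \<Rightarrow> (if t = i then 1 else 0) - (if t = Suc i then 1 else 0)
   | Inr j \<Rightarrow> (if t \<le> j then 1 else 0) - (if k \<le> t \<and> t \<le> k + j then 1 else 0))"

lemma sum_gt_vars:
  fixes g :: "bool \<times> nat \<times> nat \<Rightarrow> 'a :: comm_monoid_add"
  shows "(\<Sum>c\<in>gt_vars n. g c) = (\<Sum>m<n. \<Sum>i\<le>m. g (True, m, i)) + (\<Sum>m<n. \<Sum>i\<le>m. g (False, m, i))"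
proof -
  have "(\<Sum>c\<in>gt_vars n. g c) = (\<Sum>t\<in>UNIV. \<Sum>q\<in>(SIGMA m:{..<n}. {..m}). g (t, q))"
    unfolding gt_vars_def by (simp add: sum.cartesian_product)
  also have "\<dots> = (\<Sum>t\<in>UNIV. \<Sum>m<n. \<Sum>i\<le>m. g (t, m, i))"
    by (simp add: sum.Sigma)
  finally show ?thesis by (simp add: UNIV_bool add.commute)
qed

lemma sum_column:
  fixes g :: "nat \<Rightarrow> nat \<Rightarrow> 'a :: comm_ring_1"
  assumes "i \<le> j"
  shows "(\<Sum>m<n. \<Sum>i'\<le>m. (if i' = i \<and> j \<le> m then 1 else 0) * g m i') = (\<Sum>m\<in>{j..<n}. g m i)"
proof -
  have "(\<Sum>i'\<le>m. (if i' = i \<and> j \<le> m then 1 else 0) * g m i') = (if j \<le> m then g m i else 0)" for m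
  proof -
    have "(\<Sum>i'\<le>m. (if i' = i \<and> j \<le> m then 1 else 0) * g m i') =
      (\<Sum>i'\<le>m. if i' = i then (if j \<le> m then g m i else 0) else 0)"
      by (rule sum.cong) auto
    then show ?thesis using assms by auto
  qed
  then have "(\<Sum>m<n. \<Sum>i'\<le>m. (if i' = i \<and> j \<le> m then 1 else 0) * g m i') =
    (\<Sum>m<n. if j \<le> m then g m i else 0)" by simp
  also have "\<dots> = (\<Sum>m\<in>{j..<n}. g m i)"
    by (rule sum.mono_neutral_cong_right) auto
  finally show ?thesis .
qed

text \<open>The ring is left open because the rows are evaluated both at real kernel vectors and at
  integer slacks.\<close>

lemma gt_row_Inl:
  fixes x :: "bool \<times> nat \<times> nat \<Rightarrow> 'a :: comm_ring_1"
  assumes "i \<le> j" "j < n"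
  shows "(\<Sum>c\<in>gt_vars n. of_int (gt_coeff (Inl (j, i)) c) * x c) =
    x (False, j, i) + (\<Sum>m\<in>{j..<n}. x (True, m, i)) - (\<Sum>m\<in>{Suc j..<n}. x (True, m, Suc i))"
proof -
  have "(\<Sum>m<n. \<Sum>i'\<le>m. of_int (gt_coeff (Inl (j, i)) (True, m, i')) * x (True, m, i')) =
    (\<Sum>m<n. \<Sum>i'\<le>m. (if i' = i \<and> j \<le> m then 1 else 0) * x (True, m, i')) -
    (\<Sum>m<n. \<Sum>i'\<le>m. (if i' = Suc i \<and> Suc j \<le> m then 1 else 0) * x (True, m, i'))"
    unfolding sum_subtractf[symmetric] left_diff_distrib[symmetric]
    by (intro sum.cong refl arg_cong2[where f = "(*)"]) (simp add: gt_coeff_def)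
  also have "\<dots> = (\<Sum>m\<in>{j..<n}. x (True, m, i)) - (\<Sum>m\<in>{Suc j..<n}. x (True, m, Suc i))"
    using assms by (simp only: sum_column Suc_le_mono)
  finally have 1: "(\<Sum>m<n. \<Sum>i'\<le>m. of_int (gt_coeff (Inl (j, i)) (True, m, i')) * x (True, m, i')) =
    (\<Sum>m\<in>{j..<n}. x (True, m, i)) - (\<Sum>m\<in>{Suc j..<n}. x (True, m, Suc i))" .
  have "(\<Sum>m<n. \<Sum>i'\<le>m. of_int (gt_coeff (Inl (j, i)) (False, m, i')) * x (False, m, i')) =
    (\<Sum>m<n. if m = j then (\<Sum>i'\<le>j. if i' = i then x (False, j, i) else 0) else 0)"
  proof (rule sum.cong[OF refl])
    fix m
    show "(\<Sum>i'\<le>m. of_int (gt_coeff (Inl (j, i)) (False, m, i')) * x (False, m, i')) =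
      (if m = j then (\<Sum>i'\<le>j. if i' = i then x (False, j, i) else 0) else 0)"
    proof (cases "m = j")
      case True
      have "(\<Sum>i'\<le>j. of_int (gt_coeff (Inl (j, i)) (False, j, i')) * x (False, j, i')) =
        (\<Sum>i'\<le>j. if i' = i then x (False, j, i) else 0)"
        by (rule sum.cong) (auto simp: gt_coeff_def)
      then show ?thesis using True by simp
    qed (simp add: gt_coeff_def)
  qed
  also have "\<dots> = x (False, j, i)" using assms by simp
  finally show ?thesis unfolding sum_gt_vars 1 by simp
qed

lemma gt_row_Inr:
  fixes x :: "bool \<times> nat \<times> nat \<Rightarrow> 'a :: comm_ring_1"
  assumes "j < n"
  shows "(\<Sum>c\<in>gt_vars n. of_int (gt_coeff (Inr j) c) * x c) = (\<Sum>i\<le>j. \<Sum>m\<in>{j..<n}. x (True, m, i))"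
proof -
  have "(\<Sum>i'\<le>m. of_int (gt_coeff (Inr j) (True, m, i')) * x (True, m, i')) =
      (if j \<le> m then \<Sum>i\<le>j. x (True, m, i) else 0)" for m
  proof (cases "j \<le> m")
    case True
    have "(\<Sum>i'\<le>m. of_int (gt_coeff (Inr j) (True, m, i')) * x (True, m, i')) =
        (\<Sum>i\<le>j. x (True, m, i))"
      using True by (intro sum.mono_neutral_cong_right) (auto simp: gt_coeff_def)
    then show ?thesis using True by simp
  qed (simp add: gt_coeff_def)
  then have "(\<Sum>m<n. \<Sum>i'\<le>m. of_int (gt_coeff (Inr j) (True, m, i')) * x (True, m, i')) =
      (\<Sum>m<n. if j \<le> m then \<Sum>i\<le>j. x (True, m, i) else 0)" by simp
  also have "\<dots> = (\<Sum>m\<in>{j..<n}. \<Sum>i\<le>j. x (True, m, i))"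
    by (rule sum.mono_neutral_cong_right) auto
  also have "\<dots> = (\<Sum>i\<le>j. \<Sum>m\<in>{j..<n}. x (True, m, i))" by (rule sum.swap)
  finally show ?thesis unfolding sum_gt_vars by (simp add: gt_coeff_def)
qed

text \<open>Row \<open>Inr m\<close> is a sum of nonnegative terms that contains every
  \<open>(True, m, i)\<close>, so these vanish, and then row \<open>Inl (m, i)\<close> reduces to
  \<open>(False, m, i)\<close>.\<close>

lemma gt_kernel:
  fixes x :: "bool \<times> nat \<times> nat \<Rightarrow> real"
  assumes pos: "\<And>c. c \<in> gt_vars n \<Longrightarrow> 0 \<le> x c"
    and zero: "\<And>r. r \<in> gt_rows n \<Longrightarrow> (\<Sum>c\<in>gt_vars n. of_int (gt_coeff r c) * x c) = 0"
    and c: "c \<in> gt_vars n"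
  shows "x c = 0"
proof -
  have a: "x (True, m, i) = 0" if mi: "i \<le> m" "m < n" for m i
  proof -
    have "Inr m \<in> gt_rows n" using mi by (auto simp: gt_rows_def)
    then have "(\<Sum>i\<le>m. \<Sum>m'\<in>{m..<n}. x (True, m', i)) = 0"
      using zero gt_row_Inr[OF mi(2), of x] by simp
    moreover have nn: "0 \<le> x (True, m', i')" if "i' \<le> m" "m' \<in> {m..<n}" for m' i'
      using that by (intro pos) (auto simp: gt_vars_def)
    ultimately have "(\<Sum>m'\<in>{m..<n}. x (True, m', i)) = 0"
      using mi by (subst (asm) sum_nonneg_eq_0_iff) (auto intro!: sum_nonneg)
    then show ?thesis using mi nn by (subst (asm) sum_nonneg_eq_0_iff) auto
  qed
  obtain t m i where cc: "c = (t, m, i)" "i \<le> m" "m < n" using c by (auto simp: gt_vars_def)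
  have "x (False, m, i) = 0"
  proof -
    have "Inl (m, i) \<in> gt_rows n" using cc by (auto simp: gt_rows_def)
    then have "x (False, m, i) + (\<Sum>m'\<in>{m..<n}. x (True, m', i)) - (\<Sum>m'\<in>{Suc m..<n}. x (True, m', Suc i)) = 0"
      using zero gt_row_Inl[OF cc(2,3), of x] by simp
    moreover have "(\<Sum>m'\<in>{m..<n}. x (True, m', i)) = 0" "(\<Sum>m'\<in>{Suc m..<n}. x (True, m', Suc i)) = 0"
      using cc by (auto intro!: sum.neutral a)
    ultimately show ?thesis by simp
  qed
  then show ?thesis using a[OF cc(2,3)] cc(1) by (cases t) auto
qed

context gelfand_tsetlin
begin

text \<open>Interlacing is nonnegativity of the slacks, and the slacks within a column determine the
  pattern by telescoping from the fixed top row.\<close>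

lemma card_GT_deficit:
  assumes y: "\<And>j i. y (Inl (j, i)) = p i - p (Suc i)" "\<And>j. y (Inr j) = \<kappa> j"
  shows "card (GT_deficit \<kappa>) = card {x :: bool \<times> nat \<times> nat \<Rightarrow> nat.
    (\<forall>c. c \<notin> gt_vars n \<longrightarrow> x c = 0) \<and>
    (\<forall>r\<in>gt_rows n. (\<Sum>c\<in>gt_vars n. gt_coeff r c * int (x c)) = y r)}" (is "_ = card ?X")
proof -
  define F :: "(nat \<Rightarrow> nat \<Rightarrow> int) \<Rightarrow> bool \<times> nat \<times> nat \<Rightarrow> nat" where
    "F L = (\<lambda>(t, j, i). if i \<le> j \<and> j < n then
       nat (if t then L (Suc j) i - L j i else L j i - L (Suc j) (Suc i)) else 0)" for L
  define G :: "(bool \<times> nat \<times> nat \<Rightarrow> nat) \<Rightarrow> nat \<Rightarrow> nat \<Rightarrow> int" where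
    "G x j i = (if i \<le> j \<and> j \<le> n then p i - (\<Sum>m\<in>{j..<n}. int (x (True, m, i))) else 0)" for x j i
  have X_iff: "x \<in> ?X \<longleftrightarrow> (\<forall>c. c \<notin> gt_vars n \<longrightarrow> x c = 0) \<and>
      (\<forall>j<n. \<forall>i\<le>j. int (x (False, j, i)) + (\<Sum>m\<in>{j..<n}. int (x (True, m, i)))
         - (\<Sum>m\<in>{Suc j..<n}. int (x (True, m, Suc i))) = p i - p (Suc i)) \<and>
      (\<forall>j<n. (\<Sum>i\<le>j. \<Sum>m\<in>{j..<n}. int (x (True, m, i))) = \<kappa> j)" for x
  proof -
    have "(\<forall>r\<in>gt_rows n. Q r) \<longleftrightarrow> (\<forall>j<n. \<forall>i\<le>j. Q (Inl (j, i))) \<and> (\<forall>j<n. Q (Inr j))" for Q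
      by (auto simp: gt_rows_def)
    then show ?thesis
      using gt_row_Inl[of _ _ n "\<lambda>c. int (x c)"] gt_row_Inr[of _ n "\<lambda>c. int (x c)"]
      by (simp add: y)
  qed
  have FT: "(\<Sum>m\<in>{j..<n}. int (F L (True, m, i))) = p i - L j i"
    if L: "L \<in> GT" and "i \<le> j" "j \<le> n" for L i j
  proof -
    have "(\<Sum>m\<in>{j..<n}. int (F L (True, m, i))) = (\<Sum>m\<in>{j..<n}. L (Suc m) i - L m i)"
      using GT_D(4)[OF L] that by (intro sum.cong) (auto simp: F_def)
    also have "\<dots> = L n i - L j i" using that by (intro sum_Suc_diff') auto
    finally show ?thesis using GT_D(2)[OF L] that by simp
  qed
  have "bij_betw F (GT_deficit \<kappa>) ?X"
  proof (rule bij_betw_byWitness[where f' = G])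
    show "\<forall>L\<in>GT_deficit \<kappa>. G (F L) = L"
      using FT GT_D(1) by (auto simp: GT_deficit_def G_def fun_eq_iff)
    show "F ` GT_deficit \<kappa> \<subseteq> ?X"
    proof
      fix x assume "x \<in> F ` GT_deficit \<kappa>"
      then obtain L where L: "L \<in> GT" "\<forall>j<n. deficit L j = \<kappa> j" "x = F L"
        by (auto simp: GT_deficit_def)
      show "x \<in> ?X"
        unfolding X_iff L(3)
      proof (intro conjI allI impI)
        show "F L c = 0" if "c \<notin> gt_vars n" for c
          using that by (cases c) (auto simp: F_def gt_vars_def)
        show "(\<Sum>i\<le>j. \<Sum>m\<in>{j..<n}. int (F L (True, m, i))) = \<kappa> j" if "j < n" for j
          using that L(2) by (simp add: FT[OF L(1)] deficit_def)
        show "int (F L (False, j, i)) + (\<Sum>m\<in>{j..<n}. int (F L (True, m, i)))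
         - (\<Sum>m\<in>{Suc j..<n}. int (F L (True, m, Suc i))) = p i - p (Suc i)" if "j < n" "i \<le> j" for j i
          using that GT_D(3)[OF L(1) that] FT[OF L(1), of i j] FT[OF L(1), of "Suc i" "Suc j"]
          by (simp add: F_def)
      qed
    qed
    have Gstep: "G x (Suc j) i - G x j i = int (x (True, j, i))" if "i \<le> j" "j < n" for x i j
      using that by (simp add: G_def sum.atLeast_Suc_lessThan)
    have Gdiag: "G x j i - G x (Suc j) (Suc i) = int (x (False, j, i))"
      if "x \<in> ?X" "i \<le> j" "j < n" for x i j
      using that unfolding X_iff by (fastforce simp: G_def)
    show "\<forall>x\<in>?X. F (G x) = x"
    proof (intro ballI ext)
      fix x :: "bool \<times> nat \<times> nat \<Rightarrow> nat" and c :: "bool \<times> nat \<times> nat" assume x: "x \<in> ?X"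
      obtain t j i where c: "c = (t, j, i)" by (cases c) auto
      show "F (G x) c = x c"
      proof (cases "i \<le> j \<and> j < n")
        case True
        then show ?thesis using Gstep[of i j x] Gdiag[OF x, of i j] c by (cases t) (auto simp: F_def)
      next
        case False
        then have "c \<notin> gt_vars n" using c by (auto simp: gt_vars_def)
        then have "x c = 0" using x unfolding X_iff by blast
        moreover have "F (G x) c = 0" using False c by (auto simp: F_def)
        ultimately show ?thesis by simp
      qed
    qed
    show "G ` ?X \<subseteq> GT_deficit \<kappa>"
    proof
      fix L assume "L \<in> G ` ?X"
      then obtain x where x: "x \<in> ?X" "L = G x" by blast
      have "L \<in> GT" unfolding x(2)
      proof (rule GT_I)
        show "G x (Suc j) (Suc i) \<le> G x j i" if "j < n" "i \<le> j" for j i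
          using Gdiag[OF x(1) that(2,1)] by simp
        show "G x j i \<le> G x (Suc j) i" if "j < n" "i \<le> j" for j i
          using Gstep[OF that(2,1), of x] by simp
      qed (auto simp: G_def)
      moreover have "deficit L j = \<kappa> j" if "j < n" for j
        using x that unfolding X_iff by (simp add: deficit_def G_def)
      ultimately show "L \<in> GT_deficit \<kappa>" by (simp add: GT_deficit_def)
    qed
  qed
  then show ?thesis by (rule bij_betw_same_card)
qed

end

section \<open>Integrality on the lattices and the final assembly\<close>

lemma fund_weight_index: "j < k \<Longrightarrow> fund_weight k i $ j = (1 / real k) * (if j < i then real k - real i else - real i)"
  by (simp add: fund_weight_def)

lemma weight_lattice_D:
  assumes l: "l \<in> weight_lattice k"
  shows "l \<in> carrier_vec k" "(\<Sum>j<k. l $ j) = 0" "i < k \<Longrightarrow> j < k \<Longrightarrow> l $ i - l $ j \<in> \<int>"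
proof -
  obtain c :: "nat \<Rightarrow> int" where c: "l = vec k (\<lambda>j. \<Sum>i\<in>{1..k - 1}. of_int (c i) * fund_weight k i $ j)"
    using l by (auto simp: weight_lattice_def int_span_def)
  show "l \<in> carrier_vec k" by (simp add: c)
  have "(\<Sum>j<k. fund_weight k i $ j) = 0" if "i \<in> {1..k - 1}" for i
  proof -
    have i: "i \<le> k" using that by auto
    have "(\<Sum>j<k. fund_weight k i $ j) = (\<Sum>j<k. (1 / real k) * ((if j < i then real k else 0) - real i))"
      by (rule sum.cong) (auto simp: fund_weight_index)
    also have "\<dots> = (1 / real k) * ((\<Sum>j<k. if j < i then real k else 0) - real k * real i)"
      by (simp only: sum_distrib_left[symmetric] sum_subtractf sum_constant card_lessThan)
    also have "(\<Sum>j<k. if j < i then real k else 0) = (\<Sum>j<i. real k)"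
      using i by (intro sum.mono_neutral_cong_right) auto
    finally show ?thesis by simp
  qed
  then have "(\<Sum>i\<in>{1..k - 1}. of_int (c i) * (\<Sum>j<k. fund_weight k i $ j)) = 0" by simp
  then show "(\<Sum>j<k. l $ j) = 0"
    unfolding c by (simp add: sum_distrib_left) (subst sum.swap, simp)
  show "l $ i - l $ j \<in> \<int>" if "i < k" "j < k"
  proof -
    have "fund_weight k m $ i - fund_weight k m $ j \<in> \<int>" for m
      using that by (auto simp: fund_weight_index field_simps)
    then have "(\<Sum>m\<in>{1..k - 1}. of_int (c m) * (fund_weight k m $ i - fund_weight k m $ j)) \<in> \<int>"
      by (intro Ints_sum Ints_mult) auto
    then show ?thesis using that by (simp add: c sum_subtractf right_diff_distrib)
  qed
qed

lemma root_lattice_Ints: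
  assumes "r \<in> root_lattice k" "j < k"
  shows "r $ j \<in> \<int>"
proof -
  obtain c :: "nat \<Rightarrow> int" where c: "r = vec k (\<lambda>j. \<Sum>i\<in>{1..k - 1}. of_int (c i) * simple_root k i $ j)"
    using assms(1) by (auto simp: root_lattice_def int_span_def)
  have "simple_root k i $ j \<in> \<int>" for i
    using assms(2) by (auto simp: simple_root_def unit_vec_def)
  then show ?thesis using assms(2) by (auto simp: c intro!: Ints_sum Ints_mult)
qed

lemma sum_lessThan_add:
  fixes g :: "nat \<Rightarrow> 'a :: comm_monoid_add"
  shows "(\<Sum>t<m + q. g t) = (\<Sum>t<m. g t) + (\<Sum>t<q. g (m + t))"
  by (induction q) (simp_all add: add.assoc)

lemma gt_rhs_sum:
  fixes l b :: "real vec"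
  assumes k: "2 \<le> k" and dim: "l \<in> carrier_vec k" "b \<in> carrier_vec k" and r: "r \<in> gt_rows (k - 1)"
  shows "(\<Sum>t<2 * k. of_int (gt_rhs k r t) * (l @\<^sub>v b) $ t) =
    (case r of Inl (j, i) \<Rightarrow> l $ i - l $ Suc i | Inr j \<Rightarrow> \<Sum>i\<le>j. l $ i - b $ i)"
proof -
  have split: "(\<Sum>t<2 * k. of_int (gt_rhs k r t) * (l @\<^sub>v b) $ t) =
    (\<Sum>t<k. of_int (gt_rhs k r t) * l $ t) + (\<Sum>t<k. of_int (gt_rhs k r (k + t)) * b $ t)"
    using dim unfolding mult_2 sum_lessThan_add by simp
  show ?thesis
  proof (cases r)
    case (Inl q)
    obtain j i where q: "q = (j, i)" "i \<le> j" "j < k - 1" using r Inl by (auto simp: gt_rows_def)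
    then have ik: "i < k" "Suc i < k" by auto
    have "(\<Sum>t<k. of_int (gt_rhs k r t) * l $ t) =
      (\<Sum>t<k. (if t = i then l $ i else 0) - (if t = Suc i then l $ Suc i else 0))"
      using Inl q by (intro sum.cong) (auto simp: gt_rhs_def)
    also have "\<dots> = l $ i - l $ Suc i" using ik by (simp add: sum_subtractf)
    moreover have "(\<Sum>t<k. of_int (gt_rhs k r (k + t)) * b $ t) = 0"
      using Inl q by (intro sum.neutral) (auto simp: gt_rhs_def)
    ultimately show ?thesis unfolding split using Inl q by simp
  next
    case (Inr j)
    then have j: "j < k" using r k by (auto simp: gt_rows_def)
    have "(\<Sum>t<k. of_int (gt_rhs k r t) * l $ t) = (\<Sum>t\<le>j. l $ t)"
      using Inr j by (intro sum.mono_neutral_cong_right) (auto simp: gt_rhs_def)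
    moreover have "(\<Sum>t<k. of_int (gt_rhs k r (k + t)) * b $ t) = (\<Sum>t\<le>j. - b $ t)"
      using Inr j by (intro sum.mono_neutral_cong_right) (auto simp: gt_rhs_def)
    ultimately show ?thesis unfolding split using Inr by (simp add: sum_subtractf sum_negf)
  qed
qed

theorem theorem2p1:
  fixes k :: nat
  assumes "2 \<le> k"
  shows "\<exists>(d :: nat) (n :: nat) (E :: int mat) (B :: int mat).
           E \<in> carrier_mat d n \<and> B \<in> carrier_mat d (2 * k) \<and>
           ker_meets_orthant_trivially d n E \<and>
           (\<forall>(l :: real vec) (b :: real vec).
              dominant_weight k l \<and> b \<in> weight_lattice k \<and> l - b \<in> root_lattice k \<longrightarrow>
              (\<exists>y :: int vec. y \<in> carrier_vec d \<and>
                 map_vec real_of_int y = map_mat real_of_int B *\<^sub>v (l @\<^sub>v b) \<and>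
                 (\<forall>(N :: nat) (\<rho> :: complex mat \<Rightarrow> complex mat).
                    irrep_of_highest_weight k l N \<rho> \<longrightarrow>
                    weight_mult k N \<rho> b = vector_partition E y)))"
proof -
  let ?n = "k - 1"
  have fin: "finite (gt_vars ?n)" "finite (gt_rows ?n)" by (auto simp: gt_vars_def gt_rows_def)
  obtain d m Em Bm \<psi> where sys: "Em \<in> carrier_mat d m" "Bm \<in> carrier_mat d (2 * k)"
    "ker_meets_orthant_trivially d m Em" "\<And>s. s < d \<Longrightarrow> \<psi> s \<in> gt_rows ?n"
    and Bm: "\<And>s z. s < d \<Longrightarrow> z \<in> carrier_vec (2 * k) \<Longrightarrow>
      (map_mat real_of_int Bm *\<^sub>v z) $ s = (\<Sum>t<2 * k. of_int (gt_rhs k (\<psi> s) t) * z $ t)"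
    and Em: "\<And>y. vector_partition Em (vec d (\<lambda>s. y (\<psi> s))) =
      card {x :: bool \<times> nat \<times> nat \<Rightarrow> nat. (\<forall>c. c \<notin> gt_vars ?n \<longrightarrow> x c = 0) \<and>
        (\<forall>r\<in>gt_rows ?n. (\<Sum>c\<in>gt_vars ?n. gt_coeff r c * int (x c)) = y r)}"
  proof (rule matrix_of_system[where E = gt_coeff and B = "gt_rhs k" and q = "2 * k", OF fin], goal_cases)
    case (1 x c)
    then show ?case by (intro gt_kernel[of ?n x c])
  next
    case 2
    show ?case by (rule that) (fact 2)+
  qed
  have "\<exists>y :: int vec. y \<in> carrier_vec d \<and>
      map_vec real_of_int y = map_mat real_of_int Bm *\<^sub>v (l @\<^sub>v b) \<and>
      (\<forall>N \<rho>. irrep_of_highest_weight k l N \<rho> \<longrightarrow> weight_mult k N \<rho> b = vector_partition Em y)"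
    if l: "dominant_weight k l" and b: "b \<in> weight_lattice k" and lb: "l - b \<in> root_lattice k" for l b
  proof -
    have lW: "l \<in> weight_lattice k" and dom: "\<And>i j. i \<le> j \<Longrightarrow> j < k \<Longrightarrow> l $ j \<le> l $ i"
      using l by (auto simp: dominant_weight_def)
    note lD = weight_lattice_D[OF lW] and bD = weight_lattice_D[OF b]
    have diff: "l $ i - b $ i \<in> \<int>" if "i < k" for i
      using root_lattice_Ints[OF lb that] lD(1) bD(1) that by simp
    \<comment> \<open>The top row normalised to end in 0. The floor is exact, since coordinates of a
      weight differ by integers, and subtracting a constant preserves the differences that determine
      the module.\<close>
    define p where "p i = \<lfloor>l $ i - l $ ?n\<rfloor>" for i
    \<comment> \<open>Exact for \<open>j < k - 1\<close> because \<open>l - b\<close> lies in the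
      root lattice. A value may be negative; then there is no pattern and the multiplicity is
      0.\<close>
    define \<kappa> where "\<kappa> j = \<lfloor>\<Sum>i\<le>j. l $ i - b $ i\<rfloor>" for j
    have p: "real_of_int (p i) = l $ i - l $ ?n" if "i < k" for i
      unfolding p_def using lD(3)[OF that, of ?n] assms by (intro of_int_floor) simp
    have kap: "real_of_int (\<kappa> j) = (\<Sum>i\<le>j. l $ i - b $ i)" if "j < ?n" for j
      unfolding \<kappa>_def using that diff by (intro of_int_floor Ints_sum) auto
    have pdiff: "real_of_int (p i - p (Suc i)) = l $ i - l $ Suc i" if "i < ?n" for i
      using p[of i] p[of "Suc i"] that by simp
    have gt: "gelfand_tsetlin ?n p"
    proof
      show "p j \<le> p i" if "i \<le> j" "j \<le> ?n" for i j
        unfolding p_def using dom[of i j] that assms by (intro floor_mono) simp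
    qed
    define y :: "nat \<times> nat + nat \<Rightarrow> int" where "y = (\<lambda>r. case r of Inl (j, i) \<Rightarrow> p i - p (Suc i) | Inr j \<Rightarrow> \<kappa> j)"
    show ?thesis
    proof (intro exI conjI allI impI)
      let ?y = "vec d (\<lambda>s. y (\<psi> s))"
      show "?y \<in> carrier_vec d" by simp
      have z: "l @\<^sub>v b \<in> carrier_vec (2 * k)" using lD(1) bD(1) unfolding mult_2 by (rule append_carrier_vec)
      show "map_vec real_of_int ?y = map_mat real_of_int Bm *\<^sub>v (l @\<^sub>v b)"
      proof (rule eq_vecI)
        fix s assume "s < dim_vec (map_mat real_of_int Bm *\<^sub>v (l @\<^sub>v b))"
        then have s: "s < d" using sys(2) by simp
        have "real_of_int (y (\<psi> s)) = (case \<psi> s of Inl (j, i) \<Rightarrow> l $ i - l $ Suc i | Inr j \<Rightarrow> \<Sum>i\<le>j. l $ i - b $ i)"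
          using sys(4)[OF s] pdiff kap by (auto simp: y_def gt_rows_def)
        also have "\<dots> = (map_mat real_of_int Bm *\<^sub>v (l @\<^sub>v b)) $ s"
          unfolding Bm[OF s z] gt_rhs_sum[OF assms lD(1) bD(1) sys(4)[OF s]] ..
        finally show "map_vec real_of_int ?y $ s = (map_mat real_of_int Bm *\<^sub>v (l @\<^sub>v b)) $ s"
          using s by simp
      qed (use sys(2) in simp)
      fix N and \<rho> :: "complex mat \<Rightarrow> complex mat"
      assume irr: "irrep_of_highest_weight k l N \<rho>"
      then obtain v where v: "v \<in> weight_space k N \<rho> l" "v \<noteq> 0\<^sub>v N"
        "\<And>i j. i < j \<Longrightarrow> j < k \<Longrightarrow> \<rho> (elem_mat k i j) *\<^sub>v v = 0\<^sub>v N"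
        unfolding irrep_of_highest_weight_def has_highest_weight_def by blast
      interpret sl_irrep k N \<rho> l v
        using assms irr v by unfold_locales (auto simp: irrep_of_highest_weight_def)
      have "weight_mult k N \<rho> b = card (gelfand_tsetlin.GT_deficit ?n p \<kappa>)"
        by (rule weight_mult_eq_card[OF kap lD(2) bD(2) gt pdiff])
      also have "\<dots> = vector_partition Em ?y"
        unfolding Em by (rule gelfand_tsetlin.card_GT_deficit[OF gt]) (simp_all add: y_def)
      finally show "weight_mult k N \<rho> b = vector_partition Em ?y" .
    qed
  qed
  then show ?thesis using sys(1-3) by blast
qed

end
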